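(* Let $F\colon\mathcal{C}\rightleftarrows\mathcal{D}\colon G$ (with $F$ left adjoint) be a Quillen adjunction between model categories and let $K$ be a small category. When $\mathcal{C}$ and $\mathcal{D}$ are monoidal, consider the pointwise monoidal structures on the diagram categories $\mathcal{C}^K$ and $\mathcal{D}^K$. (1) The induced adjunction on diagram categories $F^K\colon\mathcal{C}^K\rightleftarrows\mathcal{D}^K\colon G^K$ is also a Quillen adjunction with respect to each of the following model structures on diagram categories, when they exist: projective, injective, or Reedy (if $K$ is a Reedy category). (2) If moreover $F\dashv G$ is a Quillen equivalence, then so is the induced adjunction $F^K\dashv G^K$. (3) If $\mathcal{C}$ and $\mathcal{D}$ are monoidal and $F\colon\mathcal{C}\rightleftarrows\mathcal{D}\colon G$ is a weak monoidal Quillen adjunction, then so is the induced adjunction $F^K\dashv G^K$.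
   Context: $\mathcal{C}^K=\mathrm{Fun}(K,\mathcal{C})$; $F^K$ and $G^K$ are postcomposition with $F$ and $G$. In (2) and (3), as in (1), both diagram categories carry the same type of model structure (projective, injective, or Reedy), assumed to exist. In all of them weak equivalences are pointwise; the projective structure has pointwise fibrations and the injective structure has pointwise cofibrations. The pointwise monoidal structure on $\mathcal{C}^K$ is $(x\otimes y)_k=x_k\otimes y_k$, with unit the constant diagram at $\mathbb{1}_{\mathcal{C}}$. A monoidal model category is a model category with a closed monoidal structure $(\otimes,\mathbb{1})$ satisfying the pushout-product axiom (for cofibrations $i\colon a\to b$, $k\colon x\to y$, the map $(a\otimes y)\amalg_{a\otimes x}(b\otimes x)\to b\otimes y$ is a cofibration, acyclic if $i$ or $k$ is) and the unit axiom (for $x$ cofibrant and every cofibrant replacement $q\colon Q\mathbb{1}\to\mathbb{1}$, the map $x\otimes Q\mathbb{1}\to x\otimes\mathbb{1}\cong x$ is a weak equivalence). A weak monoidal Quillen adjunction is a Quillen adjunction $F\colon\mathcal{W}\rightleftarrows\mathcal{V}\colon G$ between monoidal model categories with a lax monoidal structure on $G$ such that for the corresponding oplax structure $\delta_{x,y}\colon F(x\otimes y)\to F(x)\otimes F(y)$, $\varepsilon\colon F(\mathbb{1}_{\mathcal{W}})\to\mathbb{1}_{\mathcal{V}}$ on $F$: (i) $\delta_{x,y}$ is a weak equivalence for all cofibrant $x,y\in\mathcal{W}$; (ii) for some (hence any) cofibrant replacement $q\colon Q\mathbb{1}_{\mathcal{W}}\to\mathbb{1}_{\mathcal{W}}$,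 the composite $\varepsilon\circ F(q)\colon F(Q\mathbb{1}_{\mathcal{W}})\to\mathbb{1}_{\mathcal{V}}$ is a weak equivalence. For the induced adjunction in (3), this means that $G^K$ has the pointwise lax monoidal structure and that (i) and (ii) hold with respect to the given model structures and pointwise monoidal structures on $\mathcal{C}^K$ and $\mathcal{D}^K$. *)

theory Defs
  imports "HOL-Library.FuncSet" "HOL-Library.Infinite_Typeclass"
begin

section \<open>Categories, functors, adjunctions\<close>

record ('o, 'a) cat =
  Obj :: "'o set"
  Arr :: "'a set"
  Dom :: "'a \<Rightarrow> 'o"
  Cod :: "'a \<Rightarrow> 'o"
  Ide :: "'o \<Rightarrow> 'a"
  Cmp :: "'a \<Rightarrow> 'a \<Rightarrow> 'a" (infixr \<open>\<cdot>\<index>\<close> 70)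

definition hom :: "('o, 'a) cat \<Rightarrow> 'o \<Rightarrow> 'o \<Rightarrow> 'a set" where
  "hom C a b = {f \<in> Arr C. Dom C f = a \<and> Cod C f = b}"

locale category =
  fixes C :: "('o, 'a) cat" (structure)
  assumes Dom_in: "f \<in> Arr C \<Longrightarrow> Dom C f \<in> Obj C"
    and Cod_in: "f \<in> Arr C \<Longrightarrow> Cod C f \<in> Obj C"
    and Ide_hom: "a \<in> Obj C \<Longrightarrow> Ide C a \<in> hom C a a"
    and Cmp_hom: "\<lbrakk>f \<in> hom C a b; g \<in> hom C b c\<rbrakk> \<Longrightarrow> g \<cdot> f \<in> hom C a c"
    and Cmp_Ide_left: "f \<in> hom C a b \<Longrightarrow> Ide C b \<cdot> f = f"
    and Cmp_Ide_right: "f \<in> hom C a b \<Longrightarrow> f \<cdot> Ide C a = f"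
    and Cmp_assoc: "\<lbrakk>f \<in> hom C a b; g \<in> hom C b c; h \<in> hom C c d\<rbrakk>
                      \<Longrightarrow> (h \<cdot> g) \<cdot> f = h \<cdot> (g \<cdot> f)"

definition iso :: "('o, 'a) cat \<Rightarrow> 'a \<Rightarrow> bool" where
  "iso C f \<longleftrightarrow> f \<in> Arr C \<and>
     (\<exists>g \<in> hom C (Cod C f) (Dom C f).
        g \<cdot>\<^bsub>C\<^esub> f = Ide C (Dom C f) \<and> f \<cdot>\<^bsub>C\<^esub> g = Ide C (Cod C f))"

record ('o, 'a, 'p, 'b) func =
  omap :: "'o \<Rightarrow> 'p"
  amap :: "'a \<Rightarrow> 'b"

locale cat_functor = C: category C + D: category D
  for C :: "('o, 'a) cat" and D :: "('p, 'b) cat" +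
  fixes F :: "('o, 'a, 'p, 'b) func"
  assumes omap_in: "a \<in> Obj C \<Longrightarrow> omap F a \<in> Obj D"
    and amap_hom: "f \<in> hom C a b \<Longrightarrow> amap F f \<in> hom D (omap F a) (omap F b)"
    and amap_Ide: "a \<in> Obj C \<Longrightarrow> amap F (Ide C a) = Ide D (omap F a)"
    and amap_Cmp: "\<lbrakk>f \<in> hom C a b; g \<in> hom C b c\<rbrakk>
                     \<Longrightarrow> amap F (g \<cdot>\<^bsub>C\<^esub> f) = amap F g \<cdot>\<^bsub>D\<^esub> amap F f"

definition id_func :: "('o, 'a, 'o, 'a) func" where
  "id_func = \<lparr>omap = (\<lambda>x. x), amap = (\<lambda>f. f)\<rparr>"

definition comp_func ::
  "('p, 'b, 'q, 'c) func \<Rightarrow> ('o, 'a, 'p, 'b) func \<Rightarrow> ('o, 'a, 'q, 'c) func" where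
  "comp_func G F = \<lparr>omap = (\<lambda>x. omap G (omap F x)), amap = (\<lambda>f. amap G (amap F f))\<rparr>"

locale nat_transf = S: cat_functor C D S + T: cat_functor C D T
  for C :: "('o, 'a) cat" and D :: "('p, 'b) cat" and S T +
  fixes \<tau> :: "'o \<Rightarrow> 'b"
  assumes component: "a \<in> Obj C \<Longrightarrow> \<tau> a \<in> hom D (omap S a) (omap T a)"
    and natural: "f \<in> hom C a b \<Longrightarrow> amap T f \<cdot>\<^bsub>D\<^esub> \<tau> a = \<tau> b \<cdot>\<^bsub>D\<^esub> amap S f"

locale adjunction =
    F: cat_functor C D F + G: cat_functor D C G
  + unit: nat_transf C C id_func "comp_func G F" \<eta>
  + counit: nat_transf D D "comp_func F G" id_func \<epsilon>
  for C :: "('o, 'a) cat" and D :: "('p, 'b) cat" and F G \<eta> \<epsilon> +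
  assumes triangle_F: "x \<in> Obj C \<Longrightarrow>
            \<epsilon> (omap F x) \<cdot>\<^bsub>D\<^esub> amap F (\<eta> x) = Ide D (omap F x)"
    and triangle_G: "y \<in> Obj D \<Longrightarrow>
            amap G (\<epsilon> y) \<cdot>\<^bsub>C\<^esub> \<eta> (omap G y) = Ide C (omap G y)"


section \<open>Limits and colimits\<close>

definition is_cocone ::
  "('j, 'k) cat \<Rightarrow> ('o, 'a) cat \<Rightarrow> ('j, 'k, 'o, 'a) func \<Rightarrow> 'o \<Rightarrow> ('j \<Rightarrow> 'a) \<Rightarrow> bool" where
  "is_cocone J C X c \<kappa> \<longleftrightarrow> c \<in> Obj C \<and> (\<forall>j \<in> Obj J. \<kappa> j \<in> hom C (omap X j) c) \<and>
     (\<forall>f \<in> Arr J. \<kappa> (Cod J f) \<cdot>\<^bsub>C\<^esub> amap X f = \<kappa> (Dom J f))"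

definition is_colimit ::
  "('j, 'k) cat \<Rightarrow> ('o, 'a) cat \<Rightarrow> ('j, 'k, 'o, 'a) func \<Rightarrow> 'o \<Rightarrow> ('j \<Rightarrow> 'a) \<Rightarrow> bool" where
  "is_colimit J C X c \<kappa> \<longleftrightarrow> is_cocone J C X c \<kappa> \<and>
     (\<forall>d \<delta>. is_cocone J C X d \<delta> \<longrightarrow>
        (\<exists>!u. u \<in> hom C c d \<and> (\<forall>j \<in> Obj J. u \<cdot>\<^bsub>C\<^esub> \<kappa> j = \<delta> j)))"

definition is_cone ::
  "('j, 'k) cat \<Rightarrow> ('o, 'a) cat \<Rightarrow> ('j, 'k, 'o, 'a) func \<Rightarrow> 'o \<Rightarrow> ('j \<Rightarrow> 'a) \<Rightarrow> bool" where
  "is_cone J C X c \<pi> \<longleftrightarrow> c \<in> Obj C \<and> (\<forall>j \<in> Obj J. \<pi> j \<in> hom C c (omap X j)) \<and>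
     (\<forall>f \<in> Arr J. amap X f \<cdot>\<^bsub>C\<^esub> \<pi> (Dom J f) = \<pi> (Cod J f))"

definition is_limit ::
  "('j, 'k) cat \<Rightarrow> ('o, 'a) cat \<Rightarrow> ('j, 'k, 'o, 'a) func \<Rightarrow> 'o \<Rightarrow> ('j \<Rightarrow> 'a) \<Rightarrow> bool" where
  "is_limit J C X c \<pi> \<longleftrightarrow> is_cone J C X c \<pi> \<and>
     (\<forall>d \<delta>. is_cone J C X d \<delta> \<longrightarrow>
        (\<exists>!u. u \<in> hom C d c \<and> (\<forall>j \<in> Obj J. \<pi> j \<cdot>\<^bsub>C\<^esub> u = \<delta> j)))"

text \<open>
  Smallness is relative to an infinite type \<open>'s\<close>: a category is small if its objects and arrows
  are elements of \<open>'s\<close> (up to isomorphism of categories, any category whose sets of objects and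
  arrows have at most the cardinality of \<open>'s\<close> is of this form). The type \<open>'s\<close> is passed as
  \<open>TYPE('s)\<close>.
\<close>

definition small_cocomplete :: "'s::infinite itself \<Rightarrow> ('o, 'a) cat \<Rightarrow> bool" where
  "small_cocomplete U C \<longleftrightarrow>
     (\<forall>(J :: ('s, 's) cat) X. cat_functor J C X \<longrightarrow> (\<exists>c \<kappa>. is_colimit J C X c \<kappa>))"

definition small_complete :: "'s::infinite itself \<Rightarrow> ('o, 'a) cat \<Rightarrow> bool" where
  "small_complete U C \<longleftrightarrow>
     (\<forall>(J :: ('s, 's) cat) X. cat_functor J C X \<longrightarrow> (\<exists>c \<pi>. is_limit J C X c \<pi>))"

definition is_initial :: "('o, 'a) cat \<Rightarrow> 'o \<Rightarrow> bool" where
  "is_initial C i \<longleftrightarrow> i \<in> Obj C \<and> (\<forall>x \<in> Obj C. \<exists>!f. f \<in> hom C i x)"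

definition is_terminal :: "('o, 'a) cat \<Rightarrow> 'o \<Rightarrow> bool" where
  "is_terminal C t \<longleftrightarrow> t \<in> Obj C \<and> (\<forall>x \<in> Obj C. \<exists>!f. f \<in> hom C x t)"

text \<open>\<open>p\<close> with legs \<open>i : b \<rightarrow> p\<close>, \<open>j : c \<rightarrow> p\<close> is a pushout of \<open>f : a \<rightarrow> b\<close> and \<open>g : a \<rightarrow> c\<close>.\<close>

definition is_pushout ::
  "('o, 'a) cat \<Rightarrow> 'a \<Rightarrow> 'a \<Rightarrow> 'o \<Rightarrow> 'a \<Rightarrow> 'a \<Rightarrow> bool" where
  "is_pushout C f g p i j \<longleftrightarrow>
     f \<in> Arr C \<and> g \<in> Arr C \<and> Dom C f = Dom C g \<and>
     i \<in> hom C (Cod C f) p \<and> j \<in> hom C (Cod C g) p \<and> i \<cdot>\<^bsub>C\<^esub> f = j \<cdot>\<^bsub>C\<^esub> g \<and>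
     (\<forall>d. \<forall>r \<in> hom C (Cod C f) d. \<forall>s \<in> hom C (Cod C g) d.
        r \<cdot>\<^bsub>C\<^esub> f = s \<cdot>\<^bsub>C\<^esub> g \<longrightarrow>
        (\<exists>!u. u \<in> hom C p d \<and> u \<cdot>\<^bsub>C\<^esub> i = r \<and> u \<cdot>\<^bsub>C\<^esub> j = s))"

text \<open>\<open>p\<close> with legs \<open>i : p \<rightarrow> b\<close>, \<open>j : p \<rightarrow> c\<close> is a pullback of \<open>f : b \<rightarrow> a\<close> and \<open>g : c \<rightarrow> a\<close>.\<close>

definition is_pullback ::
  "('o, 'a) cat \<Rightarrow> 'a \<Rightarrow> 'a \<Rightarrow> 'o \<Rightarrow> 'a \<Rightarrow> 'a \<Rightarrow> bool" where
  "is_pullback C f g p i j \<longleftrightarrow>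
     f \<in> Arr C \<and> g \<in> Arr C \<and> Cod C f = Cod C g \<and>
     i \<in> hom C p (Dom C f) \<and> j \<in> hom C p (Dom C g) \<and> f \<cdot>\<^bsub>C\<^esub> i = g \<cdot>\<^bsub>C\<^esub> j \<and>
     (\<forall>d. \<forall>r \<in> hom C d (Dom C f). \<forall>s \<in> hom C d (Dom C g).
        f \<cdot>\<^bsub>C\<^esub> r = g \<cdot>\<^bsub>C\<^esub> s \<longrightarrow>
        (\<exists>!u. u \<in> hom C d p \<and> i \<cdot>\<^bsub>C\<^esub> u = r \<and> j \<cdot>\<^bsub>C\<^esub> u = s))"


section \<open>Model categories and Quillen adjunctions\<close>

record 'a model_str =
  weq :: "'a set"
  cof :: "'a set"
  fib :: "'a set"

definition is_retract :: "('o, 'a) cat \<Rightarrow> 'a \<Rightarrow> 'a \<Rightarrow> bool" where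
  "is_retract C f g \<longleftrightarrow> f \<in> Arr C \<and> g \<in> Arr C \<and>
     (\<exists>i \<in> hom C (Dom C f) (Dom C g). \<exists>r \<in> hom C (Dom C g) (Dom C f).
      \<exists>j \<in> hom C (Cod C f) (Cod C g). \<exists>s \<in> hom C (Cod C g) (Cod C f).
        r \<cdot>\<^bsub>C\<^esub> i = Ide C (Dom C f) \<and> s \<cdot>\<^bsub>C\<^esub> j = Ide C (Cod C f) \<and>
        g \<cdot>\<^bsub>C\<^esub> i = j \<cdot>\<^bsub>C\<^esub> f \<and> f \<cdot>\<^bsub>C\<^esub> r = s \<cdot>\<^bsub>C\<^esub> g)"

definition has_lifting :: "('o, 'a) cat \<Rightarrow> 'a \<Rightarrow> 'a \<Rightarrow> bool" where
  "has_lifting C i p \<longleftrightarrow>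
     (\<forall>u \<in> hom C (Dom C i) (Dom C p). \<forall>v \<in> hom C (Cod C i) (Cod C p).
        p \<cdot>\<^bsub>C\<^esub> u = v \<cdot>\<^bsub>C\<^esub> i \<longrightarrow>
        (\<exists>h \<in> hom C (Cod C i) (Dom C p). h \<cdot>\<^bsub>C\<^esub> i = u \<and> p \<cdot>\<^bsub>C\<^esub> h = v))"

text \<open>Factorizations are not required to be functorial.\<close>

locale model_category = category C
  for U :: "'s::infinite itself" and C :: "('o, 'a) cat" (structure) +
  fixes M :: "'a model_str"
  assumes complete: "small_complete U C"
    and cocomplete: "small_cocomplete U C"
    and weq_Arr: "weq M \<subseteq> Arr C"
    and cof_Arr: "cof M \<subseteq> Arr C"
    and fib_Arr: "fib M \<subseteq> Arr C"
    and weq_comp: "\<lbrakk>f \<in> hom C a b; g \<in> hom C b c; f \<in> weq M; g \<in> weq M\<rbrakk> \<Longrightarrow> g \<cdot> f \<in> weq M"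
    and weq_cancel_left: "\<lbrakk>f \<in> hom C a b; g \<in> hom C b c; g \<in> weq M; g \<cdot> f \<in> weq M\<rbrakk> \<Longrightarrow> f \<in> weq M"
    and weq_cancel_right: "\<lbrakk>f \<in> hom C a b; g \<in> hom C b c; f \<in> weq M; g \<cdot> f \<in> weq M\<rbrakk> \<Longrightarrow> g \<in> weq M"
    and weq_retract: "\<lbrakk>is_retract C f g; g \<in> weq M\<rbrakk> \<Longrightarrow> f \<in> weq M"
    and cof_retract: "\<lbrakk>is_retract C f g; g \<in> cof M\<rbrakk> \<Longrightarrow> f \<in> cof M"
    and fib_retract: "\<lbrakk>is_retract C f g; g \<in> fib M\<rbrakk> \<Longrightarrow> f \<in> fib M"
    and lift_cof: "\<lbrakk>i \<in> cof M; p \<in> fib M \<inter> weq M\<rbrakk> \<Longrightarrow> has_lifting C i p"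
    and lift_acof: "\<lbrakk>i \<in> cof M \<inter> weq M; p \<in> fib M\<rbrakk> \<Longrightarrow> has_lifting C i p"
    and factor_cof: "f \<in> hom C a b \<Longrightarrow>
          \<exists>c. \<exists>i \<in> hom C a c. \<exists>p \<in> hom C c b. i \<in> cof M \<and> p \<in> fib M \<inter> weq M \<and> f = p \<cdot> i"
    and factor_acof: "f \<in> hom C a b \<Longrightarrow>
          \<exists>c. \<exists>i \<in> hom C a c. \<exists>p \<in> hom C c b. i \<in> cof M \<inter> weq M \<and> p \<in> fib M \<and> f = p \<cdot> i"

definition cofibrant :: "('o, 'a) cat \<Rightarrow> 'a model_str \<Rightarrow> 'o \<Rightarrow> bool" where
  "cofibrant C M x \<longleftrightarrow> (\<exists>i f. is_initial C i \<and> f \<in> hom C i x \<and> f \<in> cof M)"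

definition fibrant :: "('o, 'a) cat \<Rightarrow> 'a model_str \<Rightarrow> 'o \<Rightarrow> bool" where
  "fibrant C M x \<longleftrightarrow> (\<exists>t f. is_terminal C t \<and> f \<in> hom C x t \<and> f \<in> fib M)"

definition cofibrant_replacement ::
  "('o, 'a) cat \<Rightarrow> 'a model_str \<Rightarrow> 'o \<Rightarrow> 'o \<Rightarrow> 'a \<Rightarrow> bool" where
  "cofibrant_replacement C M x Q q \<longleftrightarrow> cofibrant C M Q \<and> q \<in> hom C Q x \<and> q \<in> weq M"

locale quillen_adjunction =
    adjunction C D F G \<eta> \<epsilon> + CM: model_category U C MC + DM: model_category U D MD
  for U :: "'s::infinite itself"
    and C :: "('o, 'a) cat" and MC and D :: "('p, 'b) cat" and MD and F G \<eta> \<epsilon> +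
  assumes F_cof: "f \<in> cof MC \<Longrightarrow> amap F f \<in> cof MD"
    and F_acof: "f \<in> cof MC \<inter> weq MC \<Longrightarrow> amap F f \<in> cof MD \<inter> weq MD"

locale quillen_equivalence = quillen_adjunction +
  assumes weq_iff_adjunct_weq:
    "\<lbrakk>cofibrant C MC x; fibrant D MD y; f \<in> hom D (omap F x) y\<rbrakk>
       \<Longrightarrow> f \<in> weq MD \<longleftrightarrow> amap G f \<cdot>\<^bsub>C\<^esub> \<eta> x \<in> weq MC"


section \<open>Monoidal model categories and weak monoidal Quillen adjunctions\<close>

text \<open>
  Structure maps: \<open>massoc x y z : (x \<otimes> y) \<otimes> z \<rightarrow> x \<otimes> (y \<otimes> z)\<close>, \<open>mleft x : 1 \<otimes> x \<rightarrow> x\<close>,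
  \<open>mright x : x \<otimes> 1 \<rightarrow> x\<close>.
\<close>

record ('o, 'a) monoidal_str =
  otens :: "'o \<Rightarrow> 'o \<Rightarrow> 'o"
  atens :: "'a \<Rightarrow> 'a \<Rightarrow> 'a"
  munit :: "'o"
  massoc :: "'o \<Rightarrow> 'o \<Rightarrow> 'o \<Rightarrow> 'a"
  mleft :: "'o \<Rightarrow> 'a"
  mright :: "'o \<Rightarrow> 'a"

locale monoidal_category = category C
  for C :: "('o, 'a) cat" (structure) +
  fixes T :: "('o, 'a) monoidal_str"
  assumes otens_in: "\<lbrakk>x \<in> Obj C; y \<in> Obj C\<rbrakk> \<Longrightarrow> otens T x y \<in> Obj C"
    and atens_hom: "\<lbrakk>f \<in> hom C a b; g \<in> hom C x y\<rbrakk>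
          \<Longrightarrow> atens T f g \<in> hom C (otens T a x) (otens T b y)"
    and atens_Ide: "\<lbrakk>x \<in> Obj C; y \<in> Obj C\<rbrakk>
          \<Longrightarrow> atens T (Ide C x) (Ide C y) = Ide C (otens T x y)"
    and atens_Cmp: "\<lbrakk>f \<in> hom C a b; f' \<in> hom C b c; g \<in> hom C x y; g' \<in> hom C y z\<rbrakk>
          \<Longrightarrow> atens T (f' \<cdot> f) (g' \<cdot> g) = atens T f' g' \<cdot> atens T f g"
    and munit_in: "munit T \<in> Obj C"
    and massoc_hom: "\<lbrakk>x \<in> Obj C; y \<in> Obj C; z \<in> Obj C\<rbrakk>
          \<Longrightarrow> massoc T x y z \<in> hom C (otens T (otens T x y) z) (otens T x (otens T y z))"
    and massoc_iso: "\<lbrakk>x \<in> Obj C; y \<in> Obj C; z \<in> Obj C\<rbrakk> \<Longrightarrow> iso C (massoc T x y z)"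
    and massoc_natural: "\<lbrakk>f \<in> hom C x x'; g \<in> hom C y y'; h \<in> hom C z z'\<rbrakk>
          \<Longrightarrow> atens T f (atens T g h) \<cdot> massoc T x y z
            = massoc T x' y' z' \<cdot> atens T (atens T f g) h"
    and mleft_hom: "x \<in> Obj C \<Longrightarrow> mleft T x \<in> hom C (otens T (munit T) x) x"
    and mleft_iso: "x \<in> Obj C \<Longrightarrow> iso C (mleft T x)"
    and mleft_natural: "f \<in> hom C x y
          \<Longrightarrow> f \<cdot> mleft T x = mleft T y \<cdot> atens T (Ide C (munit T)) f"
    and mright_hom: "x \<in> Obj C \<Longrightarrow> mright T x \<in> hom C (otens T x (munit T)) x"
    and mright_iso: "x \<in> Obj C \<Longrightarrow> iso C (mright T x)"
    and mright_natural: "f \<in> hom C x y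
          \<Longrightarrow> f \<cdot> mright T x = mright T y \<cdot> atens T f (Ide C (munit T))"
    and pentagon: "\<lbrakk>w \<in> Obj C; x \<in> Obj C; y \<in> Obj C; z \<in> Obj C\<rbrakk>
          \<Longrightarrow> massoc T w x (otens T y z) \<cdot> massoc T (otens T w x) y z
            = atens T (Ide C w) (massoc T x y z) \<cdot> massoc T w (otens T x y) z
              \<cdot> atens T (massoc T w x y) (Ide C z)"
    and triangle: "\<lbrakk>x \<in> Obj C; y \<in> Obj C\<rbrakk>
          \<Longrightarrow> atens T (Ide C x) (mleft T y) \<cdot> massoc T x (munit T) y
            = atens T (mright T x) (Ide C y)"

text \<open>The functor \<open>- \<otimes> y\<close>.\<close>

definition tens_right ::
  "('o, 'a) cat \<Rightarrow> ('o, 'a) monoidal_str \<Rightarrow> 'o \<Rightarrow> ('o, 'a, 'o, 'a) func" where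
  "tens_right C T y = \<lparr>omap = (\<lambda>x. otens T x y), amap = (\<lambda>f. atens T f (Ide C y))\<rparr>"

text \<open>
  Closed means that every \<open>- \<otimes> y\<close> has a right adjoint; nothing is required of \<open>x \<otimes> -\<close>, so biclosed
  and closed symmetric monoidal categories are included.
\<close>

locale closed_monoidal_category = monoidal_category +
  assumes closed: "y \<in> Obj C \<Longrightarrow> \<exists>H \<eta> \<epsilon>. adjunction C C (tens_right C T y) H \<eta> \<epsilon>"

text \<open>
  In \<open>pushout_product\<close>, \<open>p\<close> with legs \<open>r : b \<otimes> x \<rightarrow> p\<close>, \<open>s : a \<otimes> y \<rightarrow> p\<close> is a pushout over \<open>a \<otimes> x\<close> and
  \<open>u : p \<rightarrow> b \<otimes> y\<close> is the induced map.
\<close>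

locale monoidal_model_category =
    model_category U C M + closed_monoidal_category C T
  for U :: "'s::infinite itself" and C :: "('o, 'a) cat" (structure) and M T +
  assumes pushout_product:
    "\<lbrakk>i \<in> cof M; i \<in> hom C a b; k \<in> cof M; k \<in> hom C x y;
      is_pushout C (atens T i (Ide C x)) (atens T (Ide C a) k) p r s;
      u \<in> hom C p (otens T b y);
      u \<cdot> r = atens T (Ide C b) k; u \<cdot> s = atens T i (Ide C y)\<rbrakk>
     \<Longrightarrow> u \<in> cof M \<and> (i \<in> weq M \<or> k \<in> weq M \<longrightarrow> u \<in> weq M)"
    and unit_axiom:
    "\<lbrakk>cofibrant C M x; cofibrant_replacement C M (munit T) Q q\<rbrakk>
     \<Longrightarrow> mright T x \<cdot> atens T (Ide C x) q \<in> weq M"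

text \<open>A lax monoidal structure \<open>\<mu> x y : G x \<otimes> G y \<rightarrow> G (x \<otimes> y)\<close>, \<open>\<iota> : 1 \<rightarrow> G 1\<close> on \<open>G\<close>.\<close>

locale lax_monoidal_functor =
    D: monoidal_category D TD + C: monoidal_category C TC + G: cat_functor D C G
  for D :: "('p, 'b) cat" and TD and C :: "('o, 'a) cat" and TC and G +
  fixes \<mu> :: "'p \<Rightarrow> 'p \<Rightarrow> 'a" and \<iota> :: "'a"
  assumes lax_hom: "\<lbrakk>x \<in> Obj D; y \<in> Obj D\<rbrakk>
        \<Longrightarrow> \<mu> x y \<in> hom C (otens TC (omap G x) (omap G y)) (omap G (otens TD x y))"
    and lax_natural: "\<lbrakk>f \<in> hom D x x'; g \<in> hom D y y'\<rbrakk>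
        \<Longrightarrow> amap G (atens TD f g) \<cdot>\<^bsub>C\<^esub> \<mu> x y = \<mu> x' y' \<cdot>\<^bsub>C\<^esub> atens TC (amap G f) (amap G g)"
    and lax_unit_hom: "\<iota> \<in> hom C (munit TC) (omap G (munit TD))"
    and lax_assoc: "\<lbrakk>x \<in> Obj D; y \<in> Obj D; z \<in> Obj D\<rbrakk>
        \<Longrightarrow> amap G (massoc TD x y z) \<cdot>\<^bsub>C\<^esub> \<mu> (otens TD x y) z
              \<cdot>\<^bsub>C\<^esub> atens TC (\<mu> x y) (Ide C (omap G z))
          = \<mu> x (otens TD y z) \<cdot>\<^bsub>C\<^esub> atens TC (Ide C (omap G x)) (\<mu> y z)
              \<cdot>\<^bsub>C\<^esub> massoc TC (omap G x) (omap G y) (omap G z)"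
    and lax_left_unit: "x \<in> Obj D
        \<Longrightarrow> amap G (mleft TD x) \<cdot>\<^bsub>C\<^esub> \<mu> (munit TD) x
              \<cdot>\<^bsub>C\<^esub> atens TC \<iota> (Ide C (omap G x)) = mleft TC (omap G x)"
    and lax_right_unit: "x \<in> Obj D
        \<Longrightarrow> amap G (mright TD x) \<cdot>\<^bsub>C\<^esub> \<mu> x (munit TD)
              \<cdot>\<^bsub>C\<^esub> atens TC (Ide C (omap G x)) \<iota> = mright TC (omap G x)"

text \<open>
  The oplax structure on \<open>F\<close> corresponding to \<open>(\<mu>, \<iota>)\<close>: the adjuncts of
  \<open>x \<otimes> y \<rightarrow> G F x \<otimes> G F y \<rightarrow> G (F x \<otimes> F y)\<close> and of \<open>\<iota> : 1 \<rightarrow> G 1\<close>.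
\<close>

definition oplax_tens ::
  "('o, 'a) cat \<Rightarrow> ('o, 'a) monoidal_str \<Rightarrow> ('p, 'b) cat \<Rightarrow> ('p, 'b) monoidal_str \<Rightarrow>
   ('o, 'a, 'p, 'b) func \<Rightarrow> ('o \<Rightarrow> 'a) \<Rightarrow> ('p \<Rightarrow> 'b) \<Rightarrow> ('p \<Rightarrow> 'p \<Rightarrow> 'a) \<Rightarrow> 'o \<Rightarrow> 'o \<Rightarrow> 'b" where
  "oplax_tens C TC D TD F \<eta> \<epsilon> \<mu> x y =
     \<epsilon> (otens TD (omap F x) (omap F y))
       \<cdot>\<^bsub>D\<^esub> amap F (\<mu> (omap F x) (omap F y) \<cdot>\<^bsub>C\<^esub> atens TC (\<eta> x) (\<eta> y))"

definition oplax_unit ::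
  "('p, 'b) cat \<Rightarrow> ('p, 'b) monoidal_str \<Rightarrow> ('o, 'a, 'p, 'b) func \<Rightarrow> ('p \<Rightarrow> 'b) \<Rightarrow> 'a \<Rightarrow> 'b" where
  "oplax_unit D TD F \<epsilon> \<iota> = \<epsilon> (munit TD) \<cdot>\<^bsub>D\<^esub> amap F \<iota>"

text \<open>
  The conditions on the adjunction in the definition of a weak monoidal Quillen adjunction. They
  only need both sides to be model categories with some monoidal structure; this is what is
  asserted of diagram categories, for which the pushout-product and unit axioms are not claimed.
\<close>

locale weak_monoidal_quillen_conditions =
    quillen_adjunction U C MC D MD F G \<eta> \<epsilon> + lax_monoidal_functor D TD C TC G \<mu> \<iota>
  for U :: "'s::infinite itself"
    and C :: "('o, 'a) cat" and MC TC and D :: "('p, 'b) cat" and MD TD and F G \<eta> \<epsilon> \<mu> \<iota> +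
  assumes oplax_tens_weq: "\<lbrakk>cofibrant C MC x; cofibrant C MC y\<rbrakk>
        \<Longrightarrow> oplax_tens C TC D TD F \<eta> \<epsilon> \<mu> x y \<in> weq MD"
    and oplax_unit_weq: "\<exists>Q q. cofibrant_replacement C MC (munit TC) Q q \<and>
        oplax_unit D TD F \<epsilon> \<iota> \<cdot>\<^bsub>D\<^esub> amap F q \<in> weq MD"

locale weak_monoidal_quillen_adjunction =
    weak_monoidal_quillen_conditions U C MC TC D MD TD F G \<eta> \<epsilon> \<mu> \<iota>
  + CMM: monoidal_model_category U C MC TC + DMM: monoidal_model_category U D MD TD
  for U :: "'s::infinite itself"
    and C :: "('o, 'a) cat" and MC TC and D :: "('p, 'b) cat" and MD TD and F G \<eta> \<epsilon> \<mu> \<iota>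


section \<open>Diagram categories\<close>

text \<open>
  In \<open>diagrams K C\<close>, that is, \<open>C\<^sup>K\<close>, functors and transformations are required to be \<open>undefined\<close>
  outside \<open>K\<close>, so that equality of functors (and of arrows) is equality in HOL. An arrow carries
  its source and target functors along with its components.
\<close>

record ('o, 'a, 'p, 'b) ntrans =
  nsrc :: "('o, 'a, 'p, 'b) func"
  ntgt :: "('o, 'a, 'p, 'b) func"
  ncmp :: "'o \<Rightarrow> 'b"

definition mk_diagram ::
  "('k, 'l) cat \<Rightarrow> ('k \<Rightarrow> 'o) \<Rightarrow> ('l \<Rightarrow> 'a) \<Rightarrow> ('k, 'l, 'o, 'a) func" where
  "mk_diagram K xo xa = \<lparr>omap = restrict xo (Obj K), amap = restrict xa (Arr K)\<rparr>"

definition mk_arrow ::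
  "('k, 'l) cat \<Rightarrow> ('k, 'l, 'o, 'a) func \<Rightarrow> ('k, 'l, 'o, 'a) func \<Rightarrow> ('k \<Rightarrow> 'a)
     \<Rightarrow> ('k, 'l, 'o, 'a) ntrans" where
  "mk_arrow K X Y t = \<lparr>nsrc = X, ntgt = Y, ncmp = restrict t (Obj K)\<rparr>"

definition diagrams ::
  "('k, 'l) cat \<Rightarrow> ('o, 'a) cat \<Rightarrow> (('k, 'l, 'o, 'a) func, ('k, 'l, 'o, 'a) ntrans) cat" where
  "diagrams K C =
     \<lparr>Obj = {X. cat_functor K C X \<and> omap X \<in> extensional (Obj K) \<and> amap X \<in> extensional (Arr K)},
      Arr = {t. nat_transf K C (nsrc t) (ntgt t) (ncmp t) \<and> ncmp t \<in> extensional (Obj K) \<and>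
                (\<forall>X \<in> {nsrc t, ntgt t}.
                   omap X \<in> extensional (Obj K) \<and> amap X \<in> extensional (Arr K))},
      Dom = nsrc,
      Cod = ntgt,
      Ide = (\<lambda>X. mk_arrow K X X (\<lambda>k. Ide C (omap X k))),
      Cmp = (\<lambda>t s. mk_arrow K (nsrc s) (ntgt t) (\<lambda>k. ncmp t k \<cdot>\<^bsub>C\<^esub> ncmp s k))\<rparr>"

text \<open>Postcomposition \<open>F\<^sup>K : C\<^sup>K \<rightarrow> D\<^sup>K\<close> with \<open>F : C \<rightarrow> D\<close>.\<close>

definition postcomp_obj ::
  "('k, 'l) cat \<Rightarrow> ('o, 'a, 'p, 'b) func \<Rightarrow> ('k, 'l, 'o, 'a) func \<Rightarrow> ('k, 'l, 'p, 'b) func" where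
  "postcomp_obj K F X = mk_diagram K (\<lambda>k. omap F (omap X k)) (\<lambda>f. amap F (amap X f))"

definition postcomp ::
  "('k, 'l) cat \<Rightarrow> ('o, 'a, 'p, 'b) func \<Rightarrow>
   (('k, 'l, 'o, 'a) func, ('k, 'l, 'o, 'a) ntrans,
    ('k, 'l, 'p, 'b) func, ('k, 'l, 'p, 'b) ntrans) func" where
  "postcomp K F =
     \<lparr>omap = postcomp_obj K F,
      amap = (\<lambda>t. mk_arrow K (postcomp_obj K F (nsrc t)) (postcomp_obj K F (ntgt t))
                     (\<lambda>k. amap F (ncmp t k)))\<rparr>"

text \<open>
  The pointwise transformation \<open>P\<^sup>K \<rightarrow> Q\<^sup>K\<close> induced by \<open>\<tau> : P \<rightarrow> Q\<close>. On \<open>C\<^sup>K\<close>, \<open>postcomp K id_func\<close> is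
  the identity and \<open>postcomp K (comp_func G F)\<close> is the composite of \<open>F\<^sup>K\<close> and \<open>G\<^sup>K\<close>.
\<close>

definition pointwise_nat ::
  "('k, 'l) cat \<Rightarrow> ('o, 'a, 'p, 'b) func \<Rightarrow> ('o, 'a, 'p, 'b) func \<Rightarrow> ('o \<Rightarrow> 'b)
     \<Rightarrow> ('k, 'l, 'o, 'a) func \<Rightarrow> ('k, 'l, 'p, 'b) ntrans" where
  "pointwise_nat K P Q \<tau> X =
     mk_arrow K (postcomp_obj K P X) (postcomp_obj K Q X) (\<lambda>k. \<tau> (omap X k))"

abbreviation diagram_unit where
  "diagram_unit K F G \<eta> \<equiv> pointwise_nat K id_func (comp_func G F) \<eta>"

abbreviation diagram_counit where
  "diagram_counit K F G \<epsilon> \<equiv> pointwise_nat K (comp_func F G) id_func \<epsilon>"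

definition pointwise_tens ::
  "('k, 'l) cat \<Rightarrow> ('o, 'a) monoidal_str \<Rightarrow> ('k, 'l, 'o, 'a) func \<Rightarrow> ('k, 'l, 'o, 'a) func
     \<Rightarrow> ('k, 'l, 'o, 'a) func" where
  "pointwise_tens K T X Y =
     mk_diagram K (\<lambda>k. otens T (omap X k) (omap Y k)) (\<lambda>f. atens T (amap X f) (amap Y f))"

definition constant_diagram :: "('k, 'l) cat \<Rightarrow> ('o, 'a) cat \<Rightarrow> 'o \<Rightarrow> ('k, 'l, 'o, 'a) func" where
  "constant_diagram K C x = mk_diagram K (\<lambda>k. x) (\<lambda>f. Ide C x)"

definition pointwise_monoidal ::
  "('k, 'l) cat \<Rightarrow> ('o, 'a) cat \<Rightarrow> ('o, 'a) monoidal_str \<Rightarrow>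
   (('k, 'l, 'o, 'a) func, ('k, 'l, 'o, 'a) ntrans) monoidal_str" where
  "pointwise_monoidal K C T =
     \<lparr>otens = pointwise_tens K T,
      atens = (\<lambda>s t. mk_arrow K (pointwise_tens K T (nsrc s) (nsrc t))
                       (pointwise_tens K T (ntgt s) (ntgt t))
                       (\<lambda>k. atens T (ncmp s k) (ncmp t k))),
      munit = constant_diagram K C (munit T),
      massoc = (\<lambda>X Y Z. mk_arrow K (pointwise_tens K T (pointwise_tens K T X Y) Z)
                          (pointwise_tens K T X (pointwise_tens K T Y Z))
                          (\<lambda>k. massoc T (omap X k) (omap Y k) (omap Z k))),
      mleft = (\<lambda>X. mk_arrow K (pointwise_tens K T (constant_diagram K C (munit T)) X) X
                     (\<lambda>k. mleft T (omap X k))),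
      mright = (\<lambda>X. mk_arrow K (pointwise_tens K T X (constant_diagram K C (munit T))) X
                      (\<lambda>k. mright T (omap X k)))\<rparr>"

text \<open>The pointwise lax monoidal structure on \<open>G\<^sup>K : D\<^sup>K \<rightarrow> C\<^sup>K\<close>.\<close>

definition pointwise_lax ::
  "('k, 'l) cat \<Rightarrow> ('o, 'a) monoidal_str \<Rightarrow> ('p, 'b) monoidal_str \<Rightarrow> ('p, 'b, 'o, 'a) func \<Rightarrow>
   ('p \<Rightarrow> 'p \<Rightarrow> 'a) \<Rightarrow> ('k, 'l, 'p, 'b) func \<Rightarrow> ('k, 'l, 'p, 'b) func \<Rightarrow> ('k, 'l, 'o, 'a) ntrans" where
  "pointwise_lax K TC TD G \<mu> X Y =
     mk_arrow K (pointwise_tens K TC (postcomp_obj K G X) (postcomp_obj K G Y))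
       (postcomp_obj K G (pointwise_tens K TD X Y))
       (\<lambda>k. \<mu> (omap X k) (omap Y k))"

definition pointwise_lax_unit ::
  "('k, 'l) cat \<Rightarrow> ('o, 'a) cat \<Rightarrow> ('o, 'a) monoidal_str \<Rightarrow> ('p, 'b) cat \<Rightarrow> ('p, 'b) monoidal_str \<Rightarrow>
   ('p, 'b, 'o, 'a) func \<Rightarrow> 'a \<Rightarrow> ('k, 'l, 'o, 'a) ntrans" where
  "pointwise_lax_unit K C TC D TD G \<iota> =
     mk_arrow K (constant_diagram K C (munit TC))
       (postcomp_obj K G (constant_diagram K D (munit TD))) (\<lambda>k. \<iota>)"

definition pointwise_class ::
  "('k, 'l) cat \<Rightarrow> ('o, 'a) cat \<Rightarrow> 'a set \<Rightarrow> ('k, 'l, 'o, 'a) ntrans set" where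
  "pointwise_class K C S = {t \<in> Arr (diagrams K C). \<forall>k \<in> Obj K. ncmp t k \<in> S}"


section \<open>Reedy categories\<close>

record ('k, 'l, 'd) reedy_str =
  up :: "'l set"
  down :: "'l set"
  deg :: "'k \<Rightarrow> 'd"

text \<open>The degree takes values in an arbitrary well-ordered type, i.e. in an ordinal.\<close>

locale reedy_category = category K
  for K :: "('k, 'l) cat" (structure) +
  fixes R :: "('k, 'l, 'd::wellorder) reedy_str"
  assumes up_Arr: "up R \<subseteq> Arr K"
    and up_Ide: "k \<in> Obj K \<Longrightarrow> Ide K k \<in> up R"
    and up_Cmp: "\<lbrakk>f \<in> up R; g \<in> up R; Cod K f = Dom K g\<rbrakk> \<Longrightarrow> g \<cdot> f \<in> up R"
    and down_Arr: "down R \<subseteq> Arr K"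
    and down_Ide: "k \<in> Obj K \<Longrightarrow> Ide K k \<in> down R"
    and down_Cmp: "\<lbrakk>f \<in> down R; g \<in> down R; Cod K f = Dom K g\<rbrakk> \<Longrightarrow> g \<cdot> f \<in> down R"
    and up_raises: "\<lbrakk>f \<in> up R; f \<noteq> Ide K (Dom K f)\<rbrakk> \<Longrightarrow> deg R (Dom K f) < deg R (Cod K f)"
    and down_lowers: "\<lbrakk>f \<in> down R; f \<noteq> Ide K (Dom K f)\<rbrakk> \<Longrightarrow> deg R (Cod K f) < deg R (Dom K f)"
    and factorization: "f \<in> Arr K \<Longrightarrow>
          \<exists>!(g, h). g \<in> up R \<and> h \<in> down R \<and> Cod K h = Dom K g \<and> f = g \<cdot> h"

text \<open>
  The latching category at \<open>k\<close>: the full subcategory of the slice of the direct subcategory over \<open>k\<close>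
  on the nonidentity arrows. The arrow \<open>h : g \<cdot> h \<rightarrow> g\<close> of the slice is encoded as \<open>(h, g)\<close>.
\<close>

definition latching_category ::
  "('k, 'l) cat \<Rightarrow> ('k, 'l, 'd) reedy_str \<Rightarrow> 'k \<Rightarrow> ('l, 'l \<times> 'l) cat" where
  "latching_category K R k =
     \<lparr>Obj = {f \<in> up R. Cod K f = k \<and> f \<noteq> Ide K k},
      Arr = {(h, g). h \<in> up R \<and> g \<in> up R \<and> Cod K h = Dom K g \<and> Cod K g = k \<and>
                     g \<noteq> Ide K k \<and> g \<cdot>\<^bsub>K\<^esub> h \<noteq> Ide K k},
      Dom = (\<lambda>(h, g). g \<cdot>\<^bsub>K\<^esub> h),
      Cod = (\<lambda>(h, g). g),
      Ide = (\<lambda>f. (Ide K (Dom K f), f)),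
      Cmp = (\<lambda>(h', g') (h, g). (h' \<cdot>\<^bsub>K\<^esub> h, g'))\<rparr>"

definition latching_diagram ::
  "('k, 'l) cat \<Rightarrow> ('k, 'l, 'o, 'a) func \<Rightarrow> ('l, 'l \<times> 'l, 'o, 'a) func" where
  "latching_diagram K X = \<lparr>omap = (\<lambda>f. omap X (Dom K f)), amap = (\<lambda>(h, g). amap X h)\<rparr>"

text \<open>Dually, \<open>(h, f)\<close> encodes the arrow \<open>h : f \<rightarrow> h \<cdot> f\<close> of the coslice.\<close>

definition matching_category ::
  "('k, 'l) cat \<Rightarrow> ('k, 'l, 'd) reedy_str \<Rightarrow> 'k \<Rightarrow> ('l, 'l \<times> 'l) cat" where
  "matching_category K R k =
     \<lparr>Obj = {f \<in> down R. Dom K f = k \<and> f \<noteq> Ide K k},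
      Arr = {(h, f). h \<in> down R \<and> f \<in> down R \<and> Cod K f = Dom K h \<and> Dom K f = k \<and>
                     f \<noteq> Ide K k \<and> h \<cdot>\<^bsub>K\<^esub> f \<noteq> Ide K k},
      Dom = (\<lambda>(h, f). f),
      Cod = (\<lambda>(h, f). h \<cdot>\<^bsub>K\<^esub> f),
      Ide = (\<lambda>f. (Ide K (Cod K f), f)),
      Cmp = (\<lambda>(h', f') (h, f). (h' \<cdot>\<^bsub>K\<^esub> h, f))\<rparr>"

definition matching_diagram ::
  "('k, 'l) cat \<Rightarrow> ('k, 'l, 'o, 'a) func \<Rightarrow> ('l, 'l \<times> 'l, 'o, 'a) func" where
  "matching_diagram K X = \<lparr>omap = (\<lambda>f. omap X (Cod K f)), amap = (\<lambda>(h, f). amap X h)\<rparr>"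

text \<open>
  \<open>u\<close> is the relative latching map \<open>X\<^sub>k \<squnion>\<^bsub>L\<^sub>k X\<^esub> L\<^sub>k Y \<rightarrow> Y\<^sub>k\<close> of \<open>t : X \<rightarrow> Y\<close>, for some choice of the
  latching objects \<open>L\<close> of \<open>X\<close> and \<open>L'\<close> of \<open>Y\<close> and of the pushout \<open>p\<close>; it is determined by
  \<open>t\<close> and \<open>k\<close> up to isomorphism. Here \<open>m : L \<rightarrow> X\<^sub>k\<close> and \<open>m' : L' \<rightarrow> Y\<^sub>k\<close> are the latching maps and
  \<open>l : L \<rightarrow> L'\<close> is the map induced by \<open>t\<close>.
\<close>

definition relative_latching_map ::
  "('k, 'l) cat \<Rightarrow> ('k, 'l, 'd) reedy_str \<Rightarrow> ('o, 'a) cat \<Rightarrow> ('k, 'l, 'o, 'a) ntrans \<Rightarrow> 'k \<Rightarrow> 'a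
     \<Rightarrow> bool" where
  "relative_latching_map K R C t k u \<longleftrightarrow>
     (\<exists>L \<kappa> L' \<kappa>' m m' l p i j.
        is_colimit (latching_category K R k) C (latching_diagram K (nsrc t)) L \<kappa> \<and>
        is_colimit (latching_category K R k) C (latching_diagram K (ntgt t)) L' \<kappa>' \<and>
        m \<in> hom C L (omap (nsrc t) k) \<and>
        (\<forall>f \<in> Obj (latching_category K R k). m \<cdot>\<^bsub>C\<^esub> \<kappa> f = amap (nsrc t) f) \<and>
        m' \<in> hom C L' (omap (ntgt t) k) \<and>
        (\<forall>f \<in> Obj (latching_category K R k). m' \<cdot>\<^bsub>C\<^esub> \<kappa>' f = amap (ntgt t) f) \<and>
        l \<in> hom C L L' \<and>
        (\<forall>f \<in> Obj (latching_category K R k). l \<cdot>\<^bsub>C\<^esub> \<kappa> f = \<kappa>' f \<cdot>\<^bsub>C\<^esub> ncmp t (Dom K f)) \<and>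
        is_pushout C m l p i j \<and>
        u \<in> hom C p (omap (ntgt t) k) \<and> u \<cdot>\<^bsub>C\<^esub> i = ncmp t k \<and> u \<cdot>\<^bsub>C\<^esub> j = m')"

text \<open>Dually, the relative matching map \<open>X\<^sub>k \<rightarrow> Y\<^sub>k \<times>\<^bsub>M\<^sub>k Y\<^esub> M\<^sub>k X\<close>.\<close>

definition relative_matching_map ::
  "('k, 'l) cat \<Rightarrow> ('k, 'l, 'd) reedy_str \<Rightarrow> ('o, 'a) cat \<Rightarrow> ('k, 'l, 'o, 'a) ntrans \<Rightarrow> 'k \<Rightarrow> 'a
     \<Rightarrow> bool" where
  "relative_matching_map K R C t k u \<longleftrightarrow>
     (\<exists>L \<pi> L' \<pi>' m m' l p i j.
        is_limit (matching_category K R k) C (matching_diagram K (nsrc t)) L \<pi> \<and>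
        is_limit (matching_category K R k) C (matching_diagram K (ntgt t)) L' \<pi>' \<and>
        m \<in> hom C (omap (nsrc t) k) L \<and>
        (\<forall>f \<in> Obj (matching_category K R k). \<pi> f \<cdot>\<^bsub>C\<^esub> m = amap (nsrc t) f) \<and>
        m' \<in> hom C (omap (ntgt t) k) L' \<and>
        (\<forall>f \<in> Obj (matching_category K R k). \<pi>' f \<cdot>\<^bsub>C\<^esub> m' = amap (ntgt t) f) \<and>
        l \<in> hom C L L' \<and>
        (\<forall>f \<in> Obj (matching_category K R k). \<pi>' f \<cdot>\<^bsub>C\<^esub> l = ncmp t (Cod K f) \<cdot>\<^bsub>C\<^esub> \<pi> f) \<and>
        is_pullback C m' l p i j \<and>
        u \<in> hom C (omap (nsrc t) k) p \<and> i \<cdot>\<^bsub>C\<^esub> u = ncmp t k \<and> j \<cdot>\<^bsub>C\<^esub> u = m)"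


section \<open>Model structures on diagram categories\<close>

locale diagram_model_structure = model_category U "diagrams K C" N
  for U :: "'s::infinite itself" and K :: "('k, 'l) cat" and C :: "('o, 'a) cat"
    and M :: "'a model_str" and N :: "('k, 'l, 'o, 'a) ntrans model_str" +
  assumes weq_pointwise: "weq N = pointwise_class K C (weq M)"

locale projective_structure = diagram_model_structure +
  assumes fib_pointwise: "fib N = pointwise_class K C (fib M)"

locale injective_structure = diagram_model_structure +
  assumes cof_pointwise: "cof N = pointwise_class K C (cof M)"

locale reedy_structure = diagram_model_structure U K C M N + reedy_category K R
  for U :: "'s::infinite itself" and K :: "('k, 'l) cat" and R :: "('k, 'l, 'd::wellorder) reedy_str"
    and C :: "('o, 'a) cat" and M :: "'a model_str" and N +
  assumes cof_latching: "cof N = {t \<in> Arr (diagrams K C).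
            \<forall>k \<in> Obj K. \<exists>u. relative_latching_map K R C t k u \<and> u \<in> cof M}"
    and fib_matching: "fib N = {t \<in> Arr (diagrams K C).
            \<forall>k \<in> Obj K. \<exists>u. relative_matching_map K R C t k u \<and> u \<in> fib M}"

end

theory Submission
  imports Defs
begin

text \<open>
  The proof works with lifting properties. In a model category, each of the four classes of
  (acyclic) cofibrations and (acyclic) fibrations is determined by lifting against its partner
  class, and an adjunction \<open>F \<stileturn> G\<close> turns liftings of \<open>F i\<close> against \<open>p\<close> into liftings of \<open>i\<close>
  against \<open>G p\<close>. So an adjunction is a Quillen adjunction as soon as \<open>G\<close> preserves fibrations and
  acyclic fibrations (\<open>quillen_adjunctionI_fib\<close>), or \<open>F\<close> preserves cofibrations and \<open>G\<close> preserves
  fibrations (\<open>quillen_adjunctionI_cof_fib\<close>).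

  Quillen adjunctions. \<open>F\<^sup>K \<stileturn> G\<^sup>K\<close> is an adjunction with pointwise unit and counit. For the
  projective structures the first criterion holds pointwise, and for the injective structures
  \<open>F\<^sup>K\<close> preserves both classes pointwise. For the Reedy structures, \<open>F\<close> preserves the colimits and
  the pushout from which a relative latching map is built, so \<open>F\<^sup>K\<close> preserves cofibrations; dually
  \<open>G\<^sup>K\<close> preserves fibrations, and the second criterion applies.

  Quillen equivalences. The claim is a pointwise comparison with \<open>F \<stileturn> G\<close>, once it is known that
  cofibrant and fibrant diagrams are so pointwise. The reason for this is that evaluation at an
  object \<open>k\<close> has a right adjoint, sending \<open>a\<close> to the power diagram \<open>j \<mapsto> a\<^bsup>K(j,k)\<^esup>\<close>. If it takes
  acyclic fibrations to acyclic fibrations, then evaluation preserves cofibrations. For the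
  projective structure this holds because acyclic fibrations are closed under products. For the
  Reedy structure, let \<open>B\<close> be the set of those maps \<open>j \<rightarrow> k\<close> whose degree-lowering factor is not an
  identity. By uniqueness of the Reedy factorization, the power \<open>a\<^sup>B\<close> is the matching object at
  \<open>j\<close> of the power diagram. Therefore the relative matching map of the map of power diagrams
  induced by \<open>p\<close> is a product of copies of \<open>p\<close>, one for each map \<open>j \<rightarrow> k\<close> outside \<open>B\<close>, and of
  identities (\<open>relative_matching_map_power_arrow\<close>). The statements on fibrations follow by passing
  to opposite categories.

  Weak monoidal Quillen adjunctions. The comparison maps of \<open>F\<^sup>K\<close> are those of \<open>F\<close> at each \<open>k\<close>, so
  the condition on \<open>F (x \<otimes> y) \<rightarrow> F x \<otimes> F y\<close> is again pointwise. A cofibrant replacement of the unit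
  of \<open>C\<^sup>K\<close> is at each \<open>k\<close> a cofibrant replacement of the unit of \<open>C\<close>, but not necessarily the one
  for which the unit condition is given. Ken Brown's lemma (\<open>F_weq_between_cofibrant\<close>) shows that
  the unit condition does not depend on the replacement.
\<close>


section \<open>Composition in categories\<close>

lemma hom_iff: "f \<in> hom C a b \<longleftrightarrow> f \<in> Arr C \<and> Dom C f = a \<and> Cod C f = b"
  by (simp add: hom_def)

lemma in_hom_Dom_Cod: "f \<in> Arr C \<Longrightarrow> f \<in> hom C (Dom C f) (Cod C f)"
  by (simp add: hom_iff)

context category
begin

lemma hom_Obj: "f \<in> hom C a b \<Longrightarrow> a \<in> Obj C \<and> b \<in> Obj C"
  using Dom_in Cod_in by (auto simp: hom_iff)

lemma Ide_simps [simp]: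
  "a \<in> Obj C \<Longrightarrow> Ide C a \<in> Arr C" "a \<in> Obj C \<Longrightarrow> Dom C (Ide C a) = a"
  "a \<in> Obj C \<Longrightarrow> Cod C (Ide C a) = a"
  using Ide_hom[of a] by (auto simp: hom_iff)

lemma Cmp_simps [simp]:
  assumes "f \<in> Arr C" "g \<in> Arr C" "Cod C f = Dom C g"
  shows "g \<cdot> f \<in> Arr C" "Dom C (g \<cdot> f) = Dom C f" "Cod C (g \<cdot> f) = Cod C g"
  using Cmp_hom[of f "Dom C f" "Cod C f" g "Cod C g"] assms by (auto simp: hom_iff)

lemma eq_Ide_Dom_iff_Cod: "f \<in> Arr C \<Longrightarrow> f = Ide C (Dom C f) \<longleftrightarrow> f = Ide C (Cod C f)"
  using Ide_simps(2,3) Dom_in Cod_in by metis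

lemma Cmp_Ide_simps [simp]:
  "f \<in> Arr C \<Longrightarrow> Cod C f = b \<Longrightarrow> Ide C b \<cdot> f = f"
  "f \<in> Arr C \<Longrightarrow> Dom C f = a \<Longrightarrow> f \<cdot> Ide C a = f"
  using Cmp_Ide_left[of f "Dom C f" b] Cmp_Ide_right[of f a "Cod C f"] by (auto simp: hom_iff)

lemma Cmp_assoc_simp [simp]:
  "\<lbrakk>f \<in> Arr C; g \<in> Arr C; h \<in> Arr C; Cod C f = Dom C g; Cod C g = Dom C h\<rbrakk>
     \<Longrightarrow> (h \<cdot> g) \<cdot> f = h \<cdot> (g \<cdot> f)"
  by (rule Cmp_assoc[of f "Dom C f" "Dom C g" g "Dom C h" h "Cod C h"]) (auto simp: hom_iff)

end


lemma id_func_simps [simp]: "omap id_func x = x" "amap id_func f = f"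
  by (simp_all add: id_func_def)

lemma comp_func_simps [simp]:
  "omap (comp_func G F) x = omap G (omap F x)" "amap (comp_func G F) f = amap G (amap F f)"
  by (simp_all add: comp_func_def)

lemma cat_functor_id_func: "category C \<Longrightarrow> cat_functor C C id_func"
  by (simp add: cat_functor_def cat_functor_axioms_def)

lemma cat_functor_comp_func:
  assumes "cat_functor B C F" "cat_functor C D G"
  shows "cat_functor B D (comp_func G F)"
proof -
  interpret F: cat_functor B C F by fact
  interpret G: cat_functor C D G by fact
  show ?thesis
    by unfold_locales
      (simp_all add: F.omap_in G.omap_in F.amap_Ide G.amap_Ide F.amap_hom G.amap_hom
        F.amap_Cmp G.amap_Cmp[OF F.amap_hom F.amap_hom])
qed

section \<open>Duality\<close>

text \<open>
  Statements about limits, fibrations and matching maps are obtained from their counterparts by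
  passing to opposite categories. A functor \<open>K \<rightarrow> C\<close> is literally a functor \<open>opposite K \<rightarrow> opposite C\<close>, so
  that diagrams need no translation; for arrows between diagrams, \<open>opposite_arrow\<close> below exchanges
  source and target.
\<close>

definition opposite :: "('o, 'a) cat \<Rightarrow> ('o, 'a) cat" where
  "opposite C = \<lparr>Obj = Obj C, Arr = Arr C, Dom = Cod C, Cod = Dom C, Ide = Ide C,
     Cmp = (\<lambda>g f. f \<cdot>\<^bsub>C\<^esub> g)\<rparr>"

lemma opposite_simps [simp]:
  "Obj (opposite C) = Obj C" "Arr (opposite C) = Arr C"
  "Dom (opposite C) = Cod C" "Cod (opposite C) = Dom C" "Ide (opposite C) = Ide C"
  "g \<cdot>\<^bsub>opposite C\<^esub> f = f \<cdot>\<^bsub>C\<^esub> g"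
  by (simp_all add: opposite_def)

lemma opposite_opposite [simp]: "opposite (opposite C) = C"
  by (simp add: opposite_def)

lemma hom_opposite [simp]: "hom (opposite C) a b = hom C b a"
  by (auto simp: hom_def)

lemma category_opposite:
  assumes "category C" shows "category (opposite C)"
proof -
  interpret category C by fact
  show ?thesis
    by unfold_locales (auto simp: hom_iff Dom_in Cod_in)
qed

lemma cat_functor_opposite:
  assumes "cat_functor C D F" shows "cat_functor (opposite C) (opposite D) F"
proof -
  interpret cat_functor C D F by fact
  interpret C': category "opposite C" by (rule category_opposite) (rule C.category_axioms)
  interpret D': category "opposite D" by (rule category_opposite) (rule D.category_axioms)
  show ?thesis
    by unfold_locales (auto simp: omap_in amap_Ide intro: amap_hom amap_Cmp)
qed

lemma cat_functor_opposite_iff: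
  "cat_functor (opposite C) (opposite D) F \<longleftrightarrow> cat_functor C D F"
  using cat_functor_opposite[of C D F] cat_functor_opposite[of "opposite C" "opposite D" F] by auto

lemma nat_transf_opposite:
  assumes "nat_transf C D S T \<tau>" shows "nat_transf (opposite C) (opposite D) T S \<tau>"
proof -
  interpret nat_transf C D S T \<tau> by fact
  interpret S': cat_functor "opposite C" "opposite D" S
    by (rule cat_functor_opposite) (rule S.cat_functor_axioms)
  interpret T': cat_functor "opposite C" "opposite D" T
    by (rule cat_functor_opposite) (rule T.cat_functor_axioms)
  show ?thesis
    by unfold_locales (auto simp: component natural)
qed

lemma adjunction_opposite:
  assumes "adjunction C D F G \<eta> \<epsilon>" shows "adjunction (opposite D) (opposite C) G F \<epsilon> \<eta>"
proof -
  interpret adjunction C D F G \<eta> \<epsilon> by fact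
  interpret F': cat_functor "opposite C" "opposite D" F
    by (rule cat_functor_opposite) (rule F.cat_functor_axioms)
  interpret G': cat_functor "opposite D" "opposite C" G
    by (rule cat_functor_opposite) (rule G.cat_functor_axioms)
  interpret u': nat_transf "opposite C" "opposite C" "comp_func G F" id_func \<eta>
    by (rule nat_transf_opposite) (rule unit.nat_transf_axioms)
  interpret c': nat_transf "opposite D" "opposite D" id_func "comp_func F G" \<epsilon>
    by (rule nat_transf_opposite) (rule counit.nat_transf_axioms)
  show ?thesis
    by unfold_locales (auto simp: triangle_F triangle_G)
qed

lemma is_colimit_opposite:
  "is_colimit (opposite J) (opposite C) X c \<kappa> \<longleftrightarrow> is_limit J C X c \<kappa>"
  by (simp add: is_colimit_def is_limit_def is_cocone_def is_cone_def)

lemma is_limit_opposite: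
  "is_limit (opposite J) (opposite C) X c \<kappa> \<longleftrightarrow> is_colimit J C X c \<kappa>"
  by (simp add: is_colimit_def is_limit_def is_cocone_def is_cone_def)

lemma is_pushout_opposite: "is_pushout (opposite C) f g p i j \<longleftrightarrow> is_pullback C f g p i j"
  by (simp add: is_pushout_def is_pullback_def)

lemma is_initial_opposite: "is_initial (opposite C) x \<longleftrightarrow> is_terminal C x"
  by (simp add: is_initial_def is_terminal_def)

lemma is_retract_opposite:
  assumes "is_retract (opposite C) f g" shows "is_retract C f g"
  using assms unfolding is_retract_def opposite_simps hom_opposite
  by (elim conjE bexE) (intro conjI bexI; (assumption | erule sym))

lemma has_liftingI:
  assumes "\<And>u v. \<lbrakk>u \<in> hom C (Dom C i) (Dom C p); v \<in> hom C (Cod C i) (Cod C p); p \<cdot>\<^bsub>C\<^esub> u = v \<cdot>\<^bsub>C\<^esub> i\<rbrakk>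
    \<Longrightarrow> \<exists>h \<in> hom C (Cod C i) (Dom C p). h \<cdot>\<^bsub>C\<^esub> i = u \<and> p \<cdot>\<^bsub>C\<^esub> h = v"
  shows "has_lifting C i p"
  using assms by (simp add: has_lifting_def)

lemma has_liftingE:
  assumes "has_lifting C i p" "p \<cdot>\<^bsub>C\<^esub> u = v \<cdot>\<^bsub>C\<^esub> i"
    "u \<in> hom C (Dom C i) (Dom C p)" "v \<in> hom C (Cod C i) (Cod C p)"
  obtains h where "h \<in> hom C (Cod C i) (Dom C p)" "h \<cdot>\<^bsub>C\<^esub> i = u" "p \<cdot>\<^bsub>C\<^esub> h = v"
  using assms by (auto simp: has_lifting_def)

lemma has_lifting_oppositeI:
  assumes "has_lifting C p i" shows "has_lifting (opposite C) i p"
proof (rule has_liftingI, unfold opposite_simps hom_opposite)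
  fix u v
  assume "u \<in> hom C (Cod C p) (Cod C i)" "v \<in> hom C (Dom C p) (Dom C i)" "u \<cdot>\<^bsub>C\<^esub> p = i \<cdot>\<^bsub>C\<^esub> v"
  then obtain h where "h \<in> hom C (Cod C p) (Dom C i)" "h \<cdot>\<^bsub>C\<^esub> p = v" "i \<cdot>\<^bsub>C\<^esub> h = u"
    using assms by (metis has_liftingE)
  then show "\<exists>h \<in> hom C (Cod C p) (Dom C i). i \<cdot>\<^bsub>C\<^esub> h = u \<and> h \<cdot>\<^bsub>C\<^esub> p = v"
    by blast
qed

lemma has_lifting_opposite: "has_lifting (opposite C) i p \<longleftrightarrow> has_lifting C p i"
  using has_lifting_oppositeI[of C p i] has_lifting_oppositeI[of "opposite C" i p] by auto

lemma small_complete_opposite: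
  assumes "small_cocomplete U C" shows "small_complete U (opposite C)"
  unfolding small_complete_def
proof (intro allI impI)
  fix J :: "('a, 'a) cat" and X :: "('a, 'a, 'b, 'c) func"
  assume "cat_functor J (opposite C) X"
  then have "cat_functor (opposite J) C X"
    using cat_functor_opposite by fastforce
  then show "\<exists>c \<pi>. is_limit J (opposite C) X c \<pi>"
    using assms is_limit_opposite[of "opposite J" C X] by (fastforce simp: small_cocomplete_def)
qed

lemma small_cocomplete_opposite:
  assumes "small_complete U C" shows "small_cocomplete U (opposite C)"
  unfolding small_cocomplete_def
proof (intro allI impI)
  fix J :: "('a, 'a) cat" and X :: "('a, 'a, 'b, 'c) func"
  assume "cat_functor J (opposite C) X"
  then have "cat_functor (opposite J) C X"
    using cat_functor_opposite by fastforce
  then show "\<exists>c \<kappa>. is_colimit J (opposite C) X c \<kappa>"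
    using assms is_colimit_opposite[of "opposite J" C X] by (fastforce simp: small_complete_def)
qed

definition opposite_model :: "'a model_str \<Rightarrow> 'a model_str" where
  "opposite_model M = \<lparr>weq = weq M, cof = fib M, fib = cof M\<rparr>"

lemma opposite_model_simps [simp]:
  "weq (opposite_model M) = weq M" "cof (opposite_model M) = fib M" "fib (opposite_model M) = cof M"
  by (simp_all add: opposite_model_def)

lemma model_category_opposite:
  assumes "model_category U C M" shows "model_category U (opposite C) (opposite_model M)"
proof -
  interpret model_category U C M by fact
  interpret op: category "opposite C" by (rule category_opposite) (rule category_axioms)
  show ?thesis
  proof
    show "small_complete U (opposite C)" using cocomplete by (rule small_complete_opposite)
    show "small_cocomplete U (opposite C)" using complete by (rule small_cocomplete_opposite)
    show "has_lifting (opposite C) i p"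
      if "i \<in> cof (opposite_model M)" "p \<in> fib (opposite_model M) \<inter> weq (opposite_model M)" for i p
      using that lift_acof by (simp add: has_lifting_opposite)
    show "has_lifting (opposite C) i p"
      if "i \<in> cof (opposite_model M) \<inter> weq (opposite_model M)" "p \<in> fib (opposite_model M)" for i p
      using that lift_cof by (simp add: has_lifting_opposite)
    show "\<exists>c. \<exists>i\<in>hom (opposite C) a c. \<exists>p\<in>hom (opposite C) c b. i \<in> cof (opposite_model M) \<and>
        p \<in> fib (opposite_model M) \<inter> weq (opposite_model M) \<and> f = p \<cdot>\<^bsub>opposite C\<^esub> i"
      if "f \<in> hom (opposite C) a b" for f a b
      using factor_acof[of f b a] that by simp blast
    show "\<exists>c. \<exists>i\<in>hom (opposite C) a c. \<exists>p\<in>hom (opposite C) c b.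
        i \<in> cof (opposite_model M) \<inter> weq (opposite_model M) \<and>
        p \<in> fib (opposite_model M) \<and> f = p \<cdot>\<^bsub>opposite C\<^esub> i"
      if "f \<in> hom (opposite C) a b" for f a b
      using factor_cof[of f b a] that by simp blast
  qed (use weq_Arr cof_Arr fib_Arr weq_comp weq_cancel_left weq_cancel_right weq_retract cof_retract
      fib_retract in \<open>auto dest: is_retract_opposite\<close>)
qed

definition opposite_reedy :: "('k, 'l, 'd) reedy_str \<Rightarrow> ('k, 'l, 'd) reedy_str" where
  "opposite_reedy R = \<lparr>up = down R, down = up R, deg = deg R\<rparr>"

lemma opposite_reedy_simps [simp]:
  "up (opposite_reedy R) = down R" "down (opposite_reedy R) = up R" "deg (opposite_reedy R) = deg R"
  by (simp_all add: opposite_reedy_def)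

lemma opposite_reedy_opposite_reedy [simp]: "opposite_reedy (opposite_reedy R) = R"
  by (simp add: opposite_reedy_def)

lemma reedy_category_opposite:
  assumes "reedy_category K R" shows "reedy_category (opposite K) (opposite_reedy R)"
proof -
  interpret reedy_category K R by fact
  interpret op: category "opposite K" by (rule category_opposite) (rule category_axioms)
  show ?thesis
  proof
    fix f assume f: "f \<in> Arr (opposite K)"
    then obtain x where x: "(\<lambda>(g, h). g \<in> up R \<and> h \<in> down R \<and> Cod K h = Dom K g \<and> f = g \<cdot>\<^bsub>K\<^esub> h) x"
      and uniq: "\<And>y. (\<lambda>(g, h). g \<in> up R \<and> h \<in> down R \<and> Cod K h = Dom K g \<and> f = g \<cdot>\<^bsub>K\<^esub> h) y \<Longrightarrow> y = x"
      using factorization[of f] by (auto elim!: ex1E)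
    show "\<exists>!(g, h). g \<in> up (opposite_reedy R) \<and> h \<in> down (opposite_reedy R) \<and>
        Cod (opposite K) h = Dom (opposite K) g \<and> f = g \<cdot>\<^bsub>opposite K\<^esub> h"
    proof (rule ex1I[of _ "(snd x, fst x)"])
      fix y assume y: "(\<lambda>(g, h). g \<in> up (opposite_reedy R) \<and> h \<in> down (opposite_reedy R) \<and>
        Cod (opposite K) h = Dom (opposite K) g \<and> f = g \<cdot>\<^bsub>opposite K\<^esub> h) y"
      have "(snd y, fst y) = x"
        by (rule uniq) (use y in \<open>simp add: case_prod_beta\<close>)
      then show "y = (snd x, fst x)" by auto
    qed (use x in \<open>simp add: case_prod_beta\<close>)
  next
    show "deg (opposite_reedy R) (Dom (opposite K) f) < deg (opposite_reedy R) (Cod (opposite K) f)"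
      if "f \<in> up (opposite_reedy R)" "f \<noteq> Ide (opposite K) (Dom (opposite K) f)" for f
      using that down_lowers[of f] down_Arr eq_Ide_Dom_iff_Cod[of f] by auto
    show "deg (opposite_reedy R) (Cod (opposite K) f) < deg (opposite_reedy R) (Dom (opposite K) f)"
      if "f \<in> down (opposite_reedy R)" "f \<noteq> Ide (opposite K) (Dom (opposite K) f)" for f
      using that up_raises[of f] up_Arr eq_Ide_Dom_iff_Cod[of f] by auto
  qed (use up_Arr down_Arr up_Ide down_Ide up_Cmp down_Cmp in auto)
qed


section \<open>Diagram categories\<close>

lemma diagrams_simps [simp]:
  "Dom (diagrams K C) = nsrc" "Cod (diagrams K C) = ntgt"
  "Ide (diagrams K C) X = mk_arrow K X X (\<lambda>k. Ide C (omap X k))"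
  "t \<cdot>\<^bsub>diagrams K C\<^esub> s = mk_arrow K (nsrc s) (ntgt t) (\<lambda>k. ncmp t k \<cdot>\<^bsub>C\<^esub> ncmp s k)"
  by (simp_all add: diagrams_def)

lemma mk_arrow_simps [simp]:
  "nsrc (mk_arrow K X Y t) = X" "ntgt (mk_arrow K X Y t) = Y"
  "k \<in> Obj K \<Longrightarrow> ncmp (mk_arrow K X Y t) k = t k"
  by (simp_all add: mk_arrow_def)

text \<open>
  Identities, composites and tensor products of arrows of diagrams all unfold to \<open>mk_arrow\<close>. By this
  rule an equation between such arrows with the same ends reduces to its components.
\<close>

lemma mk_arrow_cong:
  "(\<And>k. k \<in> Obj K \<Longrightarrow> s k = t k) \<Longrightarrow> mk_arrow K X Y s = mk_arrow K X Y t"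
  by (auto simp: mk_arrow_def intro!: restrict_ext)

lemma mk_diagram_simps [simp]:
  "k \<in> Obj K \<Longrightarrow> omap (mk_diagram K xo xa) k = xo k"
  "f \<in> Arr K \<Longrightarrow> amap (mk_diagram K xo xa) f = xa f"
  by (simp_all add: mk_diagram_def)

lemma Obj_diagrams_iff:
  "X \<in> Obj (diagrams K C) \<longleftrightarrow>
     cat_functor K C X \<and> omap X \<in> extensional (Obj K) \<and> amap X \<in> extensional (Arr K)"
  by (simp add: diagrams_def)

lemma in_hom_diagrams_iff:
  "t \<in> hom (diagrams K C) X Y \<longleftrightarrow>
     X \<in> Obj (diagrams K C) \<and> Y \<in> Obj (diagrams K C) \<and> nsrc t = X \<and> ntgt t = Y \<and>
     ncmp t \<in> extensional (Obj K) \<and>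
     (\<forall>k \<in> Obj K. ncmp t k \<in> hom C (omap X k) (omap Y k)) \<and>
     (\<forall>f \<in> Arr K. amap Y f \<cdot>\<^bsub>C\<^esub> ncmp t (Dom K f) = ncmp t (Cod K f) \<cdot>\<^bsub>C\<^esub> amap X f)"
  unfolding hom_iff
  by (auto simp: diagrams_def nat_transf_def nat_transf_axioms_def hom_iff)

lemma diagram_arrow_eqI:
  assumes "s \<in> hom (diagrams K C) X Y" "t \<in> hom (diagrams K C) X Y"
    and "\<And>k. k \<in> Obj K \<Longrightarrow> ncmp s k = ncmp t k"
  shows "s = t"
proof -
  have "ncmp s = ncmp t"
    by (rule extensionalityI[of _ "Obj K"]) (use assms in \<open>auto simp: in_hom_diagrams_iff\<close>)
  then show ?thesis
    using assms by (auto simp: in_hom_diagrams_iff)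
qed

lemma mk_arrow_hom:
  assumes "X \<in> Obj (diagrams K C)" "Y \<in> Obj (diagrams K C)" "category K"
    and "\<And>k. k \<in> Obj K \<Longrightarrow> t k \<in> hom C (omap X k) (omap Y k)"
    and "\<And>f. f \<in> Arr K \<Longrightarrow> amap Y f \<cdot>\<^bsub>C\<^esub> t (Dom K f) = t (Cod K f) \<cdot>\<^bsub>C\<^esub> amap X f"
  shows "mk_arrow K X Y t \<in> hom (diagrams K C) X Y"
proof -
  interpret K: category K by fact
  show ?thesis
    using assms(1,2,4,5) K.Dom_in K.Cod_in
    by (simp add: in_hom_diagrams_iff) (simp add: mk_arrow_def)
qed

lemma diagram_component:
  "t \<in> hom (diagrams K C) X Y \<Longrightarrow> k \<in> Obj K \<Longrightarrow> ncmp t k \<in> hom C (omap X k) (omap Y k)"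
  by (simp add: in_hom_diagrams_iff)

lemma diagram_natural:
  "t \<in> hom (diagrams K C) X Y \<Longrightarrow> f \<in> Arr K
     \<Longrightarrow> amap Y f \<cdot>\<^bsub>C\<^esub> ncmp t (Dom K f) = ncmp t (Cod K f) \<cdot>\<^bsub>C\<^esub> amap X f"
  by (simp add: in_hom_diagrams_iff)

lemma diagram_Arr_simps [simp]:
  assumes "t \<in> Arr (diagrams K C)" "k \<in> Obj K"
  shows "ncmp t k \<in> Arr C" "Dom C (ncmp t k) = omap (nsrc t) k" "Cod C (ncmp t k) = omap (ntgt t) k"
  using diagram_component[OF in_hom_Dom_Cod] assms by (fastforce simp: hom_iff)+

lemma diagram_Arr_Obj [simp]:
  assumes "t \<in> Arr (diagrams K C)"
  shows "nsrc t \<in> Obj (diagrams K C)" "ntgt t \<in> Obj (diagrams K C)"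
  using in_hom_Dom_Cod[OF assms] by (auto simp: in_hom_diagrams_iff)

lemma diagram_Obj_omap [simp]:
  "X \<in> Obj (diagrams K C) \<Longrightarrow> k \<in> Obj K \<Longrightarrow> omap X k \<in> Obj C"
  using cat_functor.omap_in[of K C X k] by (simp add: Obj_diagrams_iff)

lemma diagram_Obj_amap [simp]:
  assumes "X \<in> Obj (diagrams K C)" "f \<in> Arr K"
  shows "amap X f \<in> Arr C" "Dom C (amap X f) = omap X (Dom K f)"
    "Cod C (amap X f) = omap X (Cod K f)"
  using cat_functor.amap_hom[of K C X f "Dom K f" "Cod K f"] assms
  by (auto simp: Obj_diagrams_iff hom_iff)

lemma diagram_amap_Ide [simp]:
  "X \<in> Obj (diagrams K C) \<Longrightarrow> k \<in> Obj K \<Longrightarrow> amap X (Ide K k) = Ide C (omap X k)"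
  using cat_functor.amap_Ide[of K C X k] by (simp add: Obj_diagrams_iff)

lemma diagram_amap_Cmp:
  assumes "X \<in> Obj (diagrams K C)" "f \<in> Arr K" "g \<in> Arr K" "Cod K f = Dom K g"
  shows "amap X (g \<cdot>\<^bsub>K\<^esub> f) = amap X g \<cdot>\<^bsub>C\<^esub> amap X f"
  using assms cat_functor.amap_Cmp[of K C X f "Dom K f" "Cod K f" g "Cod K g"]
  by (auto simp: Obj_diagrams_iff hom_iff)

lemma mk_diagram_Obj:
  assumes "category K" "category C"
    and xo: "\<And>k. k \<in> Obj K \<Longrightarrow> xo k \<in> Obj C"
    and xa: "\<And>f. f \<in> Arr K \<Longrightarrow> xa f \<in> hom C (xo (Dom K f)) (xo (Cod K f))"
    and xa_Ide: "\<And>k. k \<in> Obj K \<Longrightarrow> xa (Ide K k) = Ide C (xo k)"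
    and xa_Cmp: "\<And>f g. \<lbrakk>f \<in> Arr K; g \<in> Arr K; Cod K f = Dom K g\<rbrakk>
           \<Longrightarrow> xa (g \<cdot>\<^bsub>K\<^esub> f) = xa g \<cdot>\<^bsub>C\<^esub> xa f"
  shows "mk_diagram K xo xa \<in> Obj (diagrams K C)"
proof -
  interpret K: category K by fact
  interpret C: category C by fact
  have "cat_functor K C (mk_diagram K xo xa)"
  proof
    fix f a b assume "f \<in> hom K a b"
    then show "amap (mk_diagram K xo xa) f
        \<in> hom C (omap (mk_diagram K xo xa) a) (omap (mk_diagram K xo xa) b)"
      using xa[of f] K.hom_Obj[of f a b] by (auto simp: hom_iff)
  next
    fix f a b g c assume "f \<in> hom K a b" "g \<in> hom K b c"
    then show "amap (mk_diagram K xo xa) (g \<cdot>\<^bsub>K\<^esub> f)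
        = amap (mk_diagram K xo xa) g \<cdot>\<^bsub>C\<^esub> amap (mk_diagram K xo xa) f"
      using xa_Cmp[of f g] by (auto simp: hom_iff)
  qed (simp_all add: xo xa_Ide)
  then show ?thesis
    by (simp add: Obj_diagrams_iff) (simp add: mk_diagram_def)
qed

locale category_pair = K: category K + C: category C
  for K :: "('k, 'l) cat" and C :: "('o, 'a) cat"
begin

sublocale diagrams: category "diagrams K C"
proof
  fix X assume "X \<in> Obj (diagrams K C)"
  then show "Ide (diagrams K C) X \<in> hom (diagrams K C) X X"
    unfolding diagrams_simps
    by (intro mk_arrow_hom K.category_axioms C.Ide_hom) (auto simp: K.Dom_in K.Cod_in)
next
  fix s X Y t Z assume s: "s \<in> hom (diagrams K C) X Y" and t: "t \<in> hom (diagrams K C) Y Z"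
  then have XYZ: "X \<in> Obj (diagrams K C)" "Y \<in> Obj (diagrams K C)" "Z \<in> Obj (diagrams K C)"
    "nsrc s = X" "ntgt s = Y" "nsrc t = Y" "ntgt t = Z"
    by (auto simp: in_hom_diagrams_iff)
  have st: "s \<in> Arr (diagrams K C)" "t \<in> Arr (diagrams K C)"
    using s t by (simp_all add: hom_iff)
  have "mk_arrow K X Z (\<lambda>k. ncmp t k \<cdot>\<^bsub>C\<^esub> ncmp s k) \<in> hom (diagrams K C) X Z"
  proof (rule mk_arrow_hom)
    fix f assume f: "f \<in> Arr K"
    have "amap Z f \<cdot>\<^bsub>C\<^esub> (ncmp t (Dom K f) \<cdot>\<^bsub>C\<^esub> ncmp s (Dom K f))
        = (amap Z f \<cdot>\<^bsub>C\<^esub> ncmp t (Dom K f)) \<cdot>\<^bsub>C\<^esub> ncmp s (Dom K f)"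
      using st f XYZ by (simp add: K.Dom_in)
    also have "\<dots> = ncmp t (Cod K f) \<cdot>\<^bsub>C\<^esub> (amap Y f \<cdot>\<^bsub>C\<^esub> ncmp s (Dom K f))"
      unfolding diagram_natural[OF t f] using st f XYZ by (simp add: K.Dom_in K.Cod_in)
    also have "\<dots> = (ncmp t (Cod K f) \<cdot>\<^bsub>C\<^esub> ncmp s (Cod K f)) \<cdot>\<^bsub>C\<^esub> amap X f"
      unfolding diagram_natural[OF s f] using st f XYZ by (simp add: K.Dom_in K.Cod_in)
    finally show "amap Z f \<cdot>\<^bsub>C\<^esub> (ncmp t (Dom K f) \<cdot>\<^bsub>C\<^esub> ncmp s (Dom K f))
        = (ncmp t (Cod K f) \<cdot>\<^bsub>C\<^esub> ncmp s (Cod K f)) \<cdot>\<^bsub>C\<^esub> amap X f" .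
  qed (use st XYZ K.category_axioms in \<open>auto simp: hom_iff\<close>)
  then show "t \<cdot>\<^bsub>diagrams K C\<^esub> s \<in> hom (diagrams K C) X Z"
    by (simp add: XYZ)
next
  fix t X Y assume t: "t \<in> hom (diagrams K C) X Y"
  then have XY: "t \<in> Arr (diagrams K C)" "nsrc t = X" "ntgt t = Y" "ncmp t \<in> extensional (Obj K)"
    by (auto simp: hom_iff) (auto simp: in_hom_diagrams_iff hom_iff diagrams_def)
  have "ncmp (mk_arrow K X Y s) = ncmp t" if "\<And>k. k \<in> Obj K \<Longrightarrow> s k = ncmp t k" for s
    by (rule extensionalityI[of _ "Obj K"]) (auto simp: XY that mk_arrow_def)
  then have *: "mk_arrow K X Y s = t" if "\<And>k. k \<in> Obj K \<Longrightarrow> s k = ncmp t k" for s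
    using that XY by (cases t) (auto simp: mk_arrow_def)
  show "Ide (diagrams K C) Y \<cdot>\<^bsub>diagrams K C\<^esub> t = t" "t \<cdot>\<^bsub>diagrams K C\<^esub> Ide (diagrams K C) X = t"
    unfolding diagrams_simps mk_arrow_simps XY by (rule *, use XY in simp)+
next
  fix s W X t Y u Z
  assume "s \<in> hom (diagrams K C) W X" "t \<in> hom (diagrams K C) X Y" "u \<in> hom (diagrams K C) Y Z"
  then show "(u \<cdot>\<^bsub>diagrams K C\<^esub> t) \<cdot>\<^bsub>diagrams K C\<^esub> s = u \<cdot>\<^bsub>diagrams K C\<^esub> t \<cdot>\<^bsub>diagrams K C\<^esub> s"
    by (auto simp: hom_iff mk_arrow_def intro!: restrict_ext)
qed simp_all

end

definition opposite_arrow :: "('o, 'a, 'p, 'b) ntrans \<Rightarrow> ('o, 'a, 'p, 'b) ntrans" where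
  "opposite_arrow t = \<lparr>nsrc = ntgt t, ntgt = nsrc t, ncmp = ncmp t\<rparr>"

lemma opposite_arrow_simps [simp]:
  "nsrc (opposite_arrow t) = ntgt t" "ntgt (opposite_arrow t) = nsrc t"
  "ncmp (opposite_arrow t) = ncmp t" "opposite_arrow (opposite_arrow t) = t"
  by (simp_all add: opposite_arrow_def)

lemma opposite_arrow_mk_arrow [simp]: "opposite_arrow (mk_arrow K X Y t) = mk_arrow (opposite K) Y X t"
  by (simp add: opposite_arrow_def mk_arrow_def)

lemma Obj_diagrams_opposite [simp]: "Obj (diagrams (opposite K) (opposite C)) = Obj (diagrams K C)"
  by (auto simp: Obj_diagrams_iff cat_functor_opposite_iff)

lemma opposite_arrow_hom_iff:
  "opposite_arrow t \<in> hom (diagrams (opposite K) (opposite C)) Y X \<longleftrightarrow> t \<in> hom (diagrams K C) X Y"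
  by (auto simp: in_hom_diagrams_iff)

lemma opposite_arrow_Arr_iff [simp]:
  "opposite_arrow t \<in> Arr (diagrams (opposite K) (opposite C)) \<longleftrightarrow> t \<in> Arr (diagrams K C)"
  using opposite_arrow_hom_iff[of t K C "ntgt t" "nsrc t"] by (simp add: hom_iff)

lemma opposite_arrow_Cmp:
  "opposite_arrow (t \<cdot>\<^bsub>diagrams K C\<^esub> s)
     = opposite_arrow s \<cdot>\<^bsub>diagrams (opposite K) (opposite C)\<^esub> opposite_arrow t"
  by simp

lemma has_lifting_opposite_arrow:
  assumes "has_lifting (diagrams (opposite K) (opposite C)) (opposite_arrow p) (opposite_arrow i)"
  shows "has_lifting (diagrams K C) i p"
proof (rule has_liftingI)
  let ?D = "diagrams K C" and ?D' = "diagrams (opposite K) (opposite C)"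
  fix u v assume u: "u \<in> hom ?D (Dom ?D i) (Dom ?D p)" and v: "v \<in> hom ?D (Cod ?D i) (Cod ?D p)"
    and eq: "p \<cdot>\<^bsub>?D\<^esub> u = v \<cdot>\<^bsub>?D\<^esub> i"
  from arg_cong[OF eq, of opposite_arrow]
  have eq': "opposite_arrow i \<cdot>\<^bsub>?D'\<^esub> opposite_arrow v = opposite_arrow u \<cdot>\<^bsub>?D'\<^esub> opposite_arrow p"
    unfolding opposite_arrow_Cmp by simp
  obtain h where h: "h \<in> hom ?D' (ntgt (opposite_arrow p)) (nsrc (opposite_arrow i))"
    "h \<cdot>\<^bsub>?D'\<^esub> opposite_arrow p = opposite_arrow v" "opposite_arrow i \<cdot>\<^bsub>?D'\<^esub> h = opposite_arrow u"
    by (rule has_liftingE[OF assms eq'])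
      (use u v in \<open>simp_all add: opposite_arrow_hom_iff\<close>)
  have "opposite_arrow (h \<cdot>\<^bsub>?D'\<^esub> opposite_arrow p) = v" "opposite_arrow (opposite_arrow i \<cdot>\<^bsub>?D'\<^esub> h) = u"
    by (simp_all only: h opposite_arrow_simps)
  then have "p \<cdot>\<^bsub>?D\<^esub> opposite_arrow h = v" "opposite_arrow h \<cdot>\<^bsub>?D\<^esub> i = u"
    using opposite_arrow_Cmp[where K = "opposite K" and C = "opposite C"] by auto
  moreover have "opposite_arrow h \<in> hom ?D (ntgt i) (nsrc p)"
    using h(1) opposite_arrow_hom_iff[of "opposite_arrow h" K C] by simp
  ultimately show "\<exists>h \<in> hom ?D (Cod ?D i) (Dom ?D p). h \<cdot>\<^bsub>?D\<^esub> i = u \<and> p \<cdot>\<^bsub>?D\<^esub> h = v"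
    by (intro bexI[of _ "opposite_arrow h"] conjI) (simp_all only: diagrams_simps)
qed


section \<open>Postcomposition with functors and adjunctions\<close>

lemma postcomp_obj_Obj:
  assumes "category K" "cat_functor C D F" "X \<in> Obj (diagrams K C)"
  shows "postcomp_obj K F X \<in> Obj (diagrams K D)"
proof -
  interpret K: category K by fact
  interpret F: cat_functor C D F by fact
  interpret X: cat_functor K C X using assms(3) by (simp add: Obj_diagrams_iff)
  have "omap F (omap X k) \<in> Obj D" if "k \<in> Obj K" for k
    using that by (intro F.omap_in X.omap_in)
  moreover have "amap F (amap X f) \<in> hom D (omap F (omap X (Dom K f))) (omap F (omap X (Cod K f)))"
    if "f \<in> Arr K" for f
    using that by (intro F.amap_hom X.amap_hom in_hom_Dom_Cod)
  moreover have "amap F (amap X (g \<cdot>\<^bsub>K\<^esub> f)) = amap F (amap X g) \<cdot>\<^bsub>D\<^esub> amap F (amap X f)"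
    if "f \<in> Arr K" "g \<in> Arr K" "Cod K f = Dom K g" for f g
    using that assms(3) F.amap_Cmp[OF in_hom_Dom_Cod, of "amap X f" "amap X g"]
    by (simp add: diagram_amap_Cmp hom_iff)
  ultimately show ?thesis
    unfolding postcomp_obj_def
    by (intro mk_diagram_Obj K.category_axioms F.D.category_axioms)
      (auto simp: F.amap_Ide X.omap_in X.amap_Ide)
qed

lemma postcomp_obj_simps [simp]:
  "k \<in> Obj K \<Longrightarrow> omap (postcomp_obj K F X) k = omap F (omap X k)"
  "f \<in> Arr K \<Longrightarrow> amap (postcomp_obj K F X) f = amap F (amap X f)"
  by (simp_all add: postcomp_obj_def)

lemma postcomp_simps [simp]:
  "omap (postcomp K F) X = postcomp_obj K F X"
  "nsrc (amap (postcomp K F) t) = postcomp_obj K F (nsrc t)"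
  "ntgt (amap (postcomp K F) t) = postcomp_obj K F (ntgt t)"
  "k \<in> Obj K \<Longrightarrow> ncmp (amap (postcomp K F) t) k = amap F (ncmp t k)"
  by (simp_all add: postcomp_def)

lemma postcomp_obj_comp_func:
  assumes "category K"
  shows "postcomp_obj K (comp_func G F) X = postcomp_obj K G (postcomp_obj K F X)"
proof -
  interpret K: category K by fact
  show ?thesis
    by (auto simp: postcomp_obj_def mk_diagram_def comp_func_def intro!: restrict_ext)
qed

lemma postcomp_obj_id_func:
  assumes "X \<in> Obj (diagrams K C)"
  shows "postcomp_obj K id_func X = X"
  using assms by (simp add: postcomp_obj_def mk_diagram_def id_func_def Obj_diagrams_iff extensional_restrict)

lemma mk_arrow_eta: "t \<in> Arr (diagrams K C) \<Longrightarrow> mk_arrow K (nsrc t) (ntgt t) (ncmp t) = t"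
  by (cases t) (simp add: mk_arrow_def diagrams_def extensional_restrict)

lemma amap_postcomp_id_func: "t \<in> Arr (diagrams K C) \<Longrightarrow> amap (postcomp K id_func) t = t"
  using mk_arrow_eta[of t K C]
  by (simp add: postcomp_def postcomp_obj_id_func[where C = C])

lemma amap_postcomp_comp_func:
  assumes "category K"
  shows "amap (postcomp K (comp_func G F)) t = amap (postcomp K G) (amap (postcomp K F) t)"
  by (simp add: postcomp_def postcomp_obj_comp_func[OF assms] mk_arrow_def)
    (auto simp: comp_func_def intro!: restrict_ext)

lemma cat_functor_postcomp:
  assumes "category K" "cat_functor C D F"
  shows "cat_functor (diagrams K C) (diagrams K D) (postcomp K F)"
proof -
  interpret K: category K by fact
  interpret F: cat_functor C D F by fact
  interpret KC: category_pair K C ..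
  interpret KD: category_pair K D ..
  have hom: "amap (postcomp K F) t \<in> hom (diagrams K D) (omap (postcomp K F) X) (omap (postcomp K F) Y)"
    if t: "t \<in> hom (diagrams K C) X Y" for t X Y
  proof -
    have XY: "X \<in> Obj (diagrams K C)" "Y \<in> Obj (diagrams K C)" "nsrc t = X" "ntgt t = Y"
      using t by (auto simp: in_hom_diagrams_iff)
    note cmp = diagram_component[OF t]
    have "amap F (amap Y f) \<cdot>\<^bsub>D\<^esub> amap F (ncmp t (Dom K f))
        = amap F (ncmp t (Cod K f)) \<cdot>\<^bsub>D\<^esub> amap F (amap X f)" if f: "f \<in> Arr K" for f
    proof -
      have "amap X f \<in> hom C (omap X (Dom K f)) (omap X (Cod K f))"
        "amap Y f \<in> hom C (omap Y (Dom K f)) (omap Y (Cod K f))"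
        using XY f by (auto simp: hom_iff)
      then show ?thesis
        using F.amap_Cmp cmp[OF K.Dom_in[OF f]] cmp[OF K.Cod_in[OF f]] diagram_natural[OF t f]
        by metis
    qed
    then show ?thesis
      using XY cmp unfolding postcomp_def
      by (auto intro!: mk_arrow_hom K.category_axioms postcomp_obj_Obj[OF _ F.cat_functor_axioms]
          F.amap_hom simp: K.Dom_in K.Cod_in)
  qed
  show ?thesis
  proof
    fix X assume X: "X \<in> Obj (diagrams K C)"
    then show "omap (postcomp K F) X \<in> Obj (diagrams K D)"
      by (simp add: postcomp_obj_Obj[OF K.category_axioms F.cat_functor_axioms])
    show "amap (postcomp K F) (Ide (diagrams K C) X) = Ide (diagrams K D) (omap (postcomp K F) X)"
      using X by (auto simp: postcomp_def F.amap_Ide intro!: mk_arrow_cong)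
  next
    fix s X Y t Z assume st: "s \<in> hom (diagrams K C) X Y" "t \<in> hom (diagrams K C) Y Z"
    show "amap (postcomp K F) (t \<cdot>\<^bsub>diagrams K C\<^esub> s)
        = amap (postcomp K F) t \<cdot>\<^bsub>diagrams K D\<^esub> amap (postcomp K F) s"
      using F.amap_Cmp[OF st[THEN diagram_component]] by (auto simp: postcomp_def intro!: mk_arrow_cong)
  qed (rule hom)
qed

lemma pointwise_nat_simps [simp]:
  "nsrc (pointwise_nat K P Q \<tau> X) = postcomp_obj K P X"
  "ntgt (pointwise_nat K P Q \<tau> X) = postcomp_obj K Q X"
  "k \<in> Obj K \<Longrightarrow> ncmp (pointwise_nat K P Q \<tau> X) k = \<tau> (omap X k)"
  by (simp_all add: pointwise_nat_def)

lemma pointwise_nat_hom: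
  assumes "category K" "nat_transf C D P Q \<tau>" and X: "X \<in> Obj (diagrams K C)"
  shows "pointwise_nat K P Q \<tau> X \<in> hom (diagrams K D) (postcomp_obj K P X) (postcomp_obj K Q X)"
proof -
  interpret K: category K by fact
  interpret nat_transf C D P Q \<tau> by fact
  have "amap Q (amap X f) \<cdot>\<^bsub>D\<^esub> \<tau> (omap X (Dom K f)) = \<tau> (omap X (Cod K f)) \<cdot>\<^bsub>D\<^esub> amap P (amap X f)"
    if "f \<in> Arr K" for f
    by (rule natural) (use that X in \<open>auto simp: hom_iff\<close>)
  then show ?thesis
    unfolding pointwise_nat_def
    by (intro mk_arrow_hom postcomp_obj_Obj[OF _ S.cat_functor_axioms]
        postcomp_obj_Obj[OF _ T.cat_functor_axioms] K.category_axioms X)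
      (use X in \<open>auto intro!: component simp: K.Dom_in K.Cod_in\<close>)
qed

lemma nat_transf_postcomp:
  assumes K: "category K" and \<tau>: "nat_transf C D P Q \<tau>"
  shows "nat_transf (diagrams K C) (diagrams K D) (postcomp K P) (postcomp K Q) (pointwise_nat K P Q \<tau>)"
proof -
  interpret nat_transf C D P Q \<tau> by fact
  interpret P: cat_functor "diagrams K C" "diagrams K D" "postcomp K P"
    by (rule cat_functor_postcomp[OF K S.cat_functor_axioms])
  interpret Q: cat_functor "diagrams K C" "diagrams K D" "postcomp K Q"
    by (rule cat_functor_postcomp[OF K T.cat_functor_axioms])
  show ?thesis
  proof
    fix t X Y assume t: "t \<in> hom (diagrams K C) X Y"
    then have "nsrc t = X" "ntgt t = Y" by (auto simp: in_hom_diagrams_iff)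
    then show "amap (postcomp K Q) t \<cdot>\<^bsub>diagrams K D\<^esub> pointwise_nat K P Q \<tau> X
        = pointwise_nat K P Q \<tau> Y \<cdot>\<^bsub>diagrams K D\<^esub> amap (postcomp K P) t"
      using natural[OF diagram_component[OF t]] by (auto intro!: mk_arrow_cong)
  qed (use pointwise_nat_hom[OF K \<tau>] in simp)
qed

text \<open>
  On diagrams, \<open>postcomp K id_func\<close> agrees with the identity and \<open>postcomp K (comp_func G F)\<close> agrees with
  the composite of \<open>postcomp K G\<close> and \<open>postcomp K F\<close>. They differ in general outside of the category
  of diagrams, so the functors cannot be replaced by equality.
\<close>

lemma nat_transf_functor_cong:
  assumes "nat_transf C D S T \<tau>" "cat_functor C D S'" "cat_functor C D T'"
    and "\<And>x. x \<in> Obj C \<Longrightarrow> omap S x = omap S' x \<and> omap T x = omap T' x"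
    and "\<And>f. f \<in> Arr C \<Longrightarrow> amap S f = amap S' f \<and> amap T f = amap T' f"
  shows "nat_transf C D S' T' \<tau>"
proof -
  interpret nat_transf C D S T \<tau> by fact
  interpret S': cat_functor C D S' by fact
  interpret T': cat_functor C D T' by fact
  show ?thesis
    by unfold_locales (use assms(4,5) component natural in \<open>auto simp: hom_iff\<close>)
qed

lemma adjunction_diagrams:
  assumes K: "category K" and "adjunction C D F G \<eta> \<epsilon>"
  shows "adjunction (diagrams K C) (diagrams K D) (postcomp K F) (postcomp K G)
    (diagram_unit K F G \<eta>) (diagram_counit K F G \<epsilon>)"
proof -
  interpret K: category K by fact
  interpret adjunction C D F G \<eta> \<epsilon> by fact
  interpret KC: category_pair K C ..
  interpret KD: category_pair K D ..
  interpret FK: cat_functor "diagrams K C" "diagrams K D" "postcomp K F"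
    by (rule cat_functor_postcomp[OF K F.cat_functor_axioms])
  interpret GK: cat_functor "diagrams K D" "diagrams K C" "postcomp K G"
    by (rule cat_functor_postcomp[OF K G.cat_functor_axioms])
  interpret unitK: nat_transf "diagrams K C" "diagrams K C" id_func
    "comp_func (postcomp K G) (postcomp K F)" "diagram_unit K F G \<eta>"
    by (rule nat_transf_functor_cong[OF nat_transf_postcomp[OF K unit.nat_transf_axioms]
          cat_functor_id_func[OF KC.diagrams.category_axioms]
          cat_functor_comp_func[OF FK.cat_functor_axioms GK.cat_functor_axioms]])
      (auto simp: postcomp_obj_id_func postcomp_obj_comp_func[OF K] amap_postcomp_id_func amap_postcomp_comp_func[OF K])
  interpret counitK: nat_transf "diagrams K D" "diagrams K D"
    "comp_func (postcomp K F) (postcomp K G)" id_func "diagram_counit K F G \<epsilon>"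
    by (rule nat_transf_functor_cong[OF nat_transf_postcomp[OF K counit.nat_transf_axioms]
          cat_functor_comp_func[OF GK.cat_functor_axioms FK.cat_functor_axioms]
          cat_functor_id_func[OF KD.diagrams.category_axioms]])
      (auto simp: postcomp_obj_id_func postcomp_obj_comp_func[OF K] amap_postcomp_id_func amap_postcomp_comp_func[OF K])
  show ?thesis
  proof
    fix X assume X: "X \<in> Obj (diagrams K C)"
    show "diagram_counit K F G \<epsilon> (omap (postcomp K F) X)
        \<cdot>\<^bsub>diagrams K D\<^esub> amap (postcomp K F) (diagram_unit K F G \<eta> X)
      = Ide (diagrams K D) (omap (postcomp K F) X)"
      using X FK.omap_in[OF X]
      by (auto simp: postcomp_obj_id_func triangle_F intro!: mk_arrow_cong)
  next
    fix Y assume Y: "Y \<in> Obj (diagrams K D)"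
    show "amap (postcomp K G) (diagram_counit K F G \<epsilon> Y)
        \<cdot>\<^bsub>diagrams K C\<^esub> diagram_unit K F G \<eta> (omap (postcomp K G) Y)
      = Ide (diagrams K C) (omap (postcomp K G) Y)"
      using Y GK.omap_in[OF Y]
      by (auto simp: postcomp_obj_id_func triangle_G intro!: mk_arrow_cong)
  qed
qed


section \<open>Adjunctions: transposition, lifting, colimits\<close>

lemma is_colimit_factorization:
  assumes "is_colimit J C X c \<kappa>" "is_cocone J C X d \<delta>"
  obtains u where "u \<in> hom C c d" "\<And>j. j \<in> Obj J \<Longrightarrow> u \<cdot>\<^bsub>C\<^esub> \<kappa> j = \<delta> j"
    "\<And>u'. \<lbrakk>u' \<in> hom C c d; \<forall>j \<in> Obj J. u' \<cdot>\<^bsub>C\<^esub> \<kappa> j = \<delta> j\<rbrakk> \<Longrightarrow> u' = u"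
proof -
  have "\<exists>!u. u \<in> hom C c d \<and> (\<forall>j \<in> Obj J. u \<cdot>\<^bsub>C\<^esub> \<kappa> j = \<delta> j)"
    using assms unfolding is_colimit_def by blast
  then show thesis
    by (rule ex1E) (rule that, blast+)
qed

lemma is_pushout_factorization:
  assumes "is_pushout C f g p i j" "r \<cdot>\<^bsub>C\<^esub> f = s \<cdot>\<^bsub>C\<^esub> g"
    "r \<in> hom C (Cod C f) d" "s \<in> hom C (Cod C g) d"
  obtains u where "u \<in> hom C p d" "u \<cdot>\<^bsub>C\<^esub> i = r" "u \<cdot>\<^bsub>C\<^esub> j = s"
    "\<And>u'. \<lbrakk>u' \<in> hom C p d; u' \<cdot>\<^bsub>C\<^esub> i = r; u' \<cdot>\<^bsub>C\<^esub> j = s\<rbrakk> \<Longrightarrow> u' = u"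
proof -
  have "\<exists>!u. u \<in> hom C p d \<and> u \<cdot>\<^bsub>C\<^esub> i = r \<and> u \<cdot>\<^bsub>C\<^esub> j = s"
    using assms unfolding is_pushout_def by blast
  then show thesis
    by (rule ex1E) (rule that, blast+)
qed

context adjunction
begin

text \<open>
  The transposition maps \<open>hom (F x) y \<rightarrow> hom x (G y)\<close> and back.
\<close>

definition sharp :: "'o \<Rightarrow> 'b \<Rightarrow> 'a" where
  "sharp x f = amap G f \<cdot>\<^bsub>C\<^esub> \<eta> x"

definition flat :: "'p \<Rightarrow> 'a \<Rightarrow> 'b" where
  "flat y g = \<epsilon> y \<cdot>\<^bsub>D\<^esub> amap F g"

lemma unit_hom: "x \<in> Obj C \<Longrightarrow> \<eta> x \<in> hom C x (omap G (omap F x))"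
  using unit.component[of x] by simp

lemma counit_hom: "y \<in> Obj D \<Longrightarrow> \<epsilon> y \<in> hom D (omap F (omap G y)) y"
  using counit.component[of y] by simp

lemma sharp_hom:
  "x \<in> Obj C \<Longrightarrow> f \<in> hom D (omap F x) y \<Longrightarrow> sharp x f \<in> hom C x (omap G y)"
  unfolding sharp_def by (rule F.C.Cmp_hom[OF unit_hom G.amap_hom])

lemma flat_hom:
  "y \<in> Obj D \<Longrightarrow> g \<in> hom C x (omap G y) \<Longrightarrow> flat y g \<in> hom D (omap F x) y"
  unfolding flat_def by (rule F.D.Cmp_hom[OF F.amap_hom counit_hom])

lemma flat_sharp:
  assumes "x \<in> Obj C" "f \<in> hom D (omap F x) y"
  shows "flat y (sharp x f) = f"
proof -
  have Fx: "omap F x \<in> Obj D" by (rule F.omap_in) fact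
  note Gf = G.amap_hom[OF assms(2)] and \<eta> = unit_hom[OF assms(1)]
  have y: "y \<in> Obj D" using F.D.hom_Obj[OF assms(2)] by simp
  have "flat y (sharp x f) = \<epsilon> y \<cdot>\<^bsub>D\<^esub> (amap F (amap G f) \<cdot>\<^bsub>D\<^esub> amap F (\<eta> x))"
    by (simp add: flat_def sharp_def F.amap_Cmp[OF \<eta> Gf])
  also have "\<dots> = (\<epsilon> y \<cdot>\<^bsub>D\<^esub> amap F (amap G f)) \<cdot>\<^bsub>D\<^esub> amap F (\<eta> x)"
    by (rule F.D.Cmp_assoc[OF F.amap_hom[OF \<eta>] F.amap_hom[OF Gf] counit_hom[OF y], symmetric])
  also have "\<epsilon> y \<cdot>\<^bsub>D\<^esub> amap F (amap G f) = f \<cdot>\<^bsub>D\<^esub> \<epsilon> (omap F x)"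
    using counit.natural[OF assms(2)] by simp
  also have "(f \<cdot>\<^bsub>D\<^esub> \<epsilon> (omap F x)) \<cdot>\<^bsub>D\<^esub> amap F (\<eta> x) = f \<cdot>\<^bsub>D\<^esub> Ide D (omap F x)"
    using F.D.Cmp_assoc[OF F.amap_hom[OF \<eta>] counit_hom[OF Fx] assms(2)] triangle_F[OF assms(1)] by simp
  also have "\<dots> = f"
    by (rule F.D.Cmp_Ide_right[OF assms(2)])
  finally show ?thesis .
qed

lemma flat_Cmp:
  assumes "y \<in> Obj D" "i \<in> hom C w x" "g \<in> hom C x (omap G y)"
  shows "flat y (g \<cdot>\<^bsub>C\<^esub> i) = flat y g \<cdot>\<^bsub>D\<^esub> amap F i"
  using F.amap_Cmp[OF assms(2,3)]
    F.D.Cmp_assoc[OF F.amap_hom[OF assms(2)] F.amap_hom[OF assms(3)] counit_hom[OF assms(1)]]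
  by (simp add: flat_def)

lemma flat_amap_Cmp:
  assumes "p \<in> hom D y z" "g \<in> hom C x (omap G y)"
  shows "flat z (amap G p \<cdot>\<^bsub>C\<^esub> g) = p \<cdot>\<^bsub>D\<^esub> flat y g"
proof -
  have yz: "y \<in> Obj D" "z \<in> Obj D" using F.D.hom_Obj[OF assms(1)] by auto
  note Gp = G.amap_hom[OF assms(1)]
  have "flat z (amap G p \<cdot>\<^bsub>C\<^esub> g) = (\<epsilon> z \<cdot>\<^bsub>D\<^esub> amap F (amap G p)) \<cdot>\<^bsub>D\<^esub> amap F g"
    unfolding flat_def F.amap_Cmp[OF assms(2) Gp]
    by (rule F.D.Cmp_assoc[OF F.amap_hom[OF assms(2)] F.amap_hom[OF Gp] counit_hom[OF yz(2)], symmetric])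
  also have "\<epsilon> z \<cdot>\<^bsub>D\<^esub> amap F (amap G p) = p \<cdot>\<^bsub>D\<^esub> \<epsilon> y"
    using counit.natural[OF assms(1)] by simp
  also have "(p \<cdot>\<^bsub>D\<^esub> \<epsilon> y) \<cdot>\<^bsub>D\<^esub> amap F g = p \<cdot>\<^bsub>D\<^esub> flat y g"
    unfolding flat_def by (rule F.D.Cmp_assoc[OF F.amap_hom[OF assms(2)] counit_hom[OF yz(1)] assms(1)])
  finally show ?thesis .
qed

lemma opposite_adjunction: "adjunction (opposite D) (opposite C) G F \<epsilon> \<eta>"
  by (rule adjunction_opposite) (rule adjunction_axioms)

lemma opposite_flat: "adjunction.flat (opposite C) G \<eta> = sharp"
  by (intro ext) (simp add: adjunction.flat_def[OF opposite_adjunction] sharp_def)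

lemma opposite_sharp: "adjunction.sharp (opposite D) F \<epsilon> = flat"
  by (intro ext) (simp add: adjunction.sharp_def[OF opposite_adjunction] flat_def)

lemma sharp_flat:
  "y \<in> Obj D \<Longrightarrow> g \<in> hom C x (omap G y) \<Longrightarrow> sharp x (flat y g) = g"
  using adjunction.flat_sharp[OF opposite_adjunction, of y g x]
  by (simp add: opposite_flat opposite_sharp)

lemma sharp_Cmp:
  "\<lbrakk>x \<in> Obj C; f \<in> hom D (omap F x) y; p \<in> hom D y z\<rbrakk>
     \<Longrightarrow> sharp x (p \<cdot>\<^bsub>D\<^esub> f) = amap G p \<cdot>\<^bsub>C\<^esub> sharp x f"
  using adjunction.flat_Cmp[OF opposite_adjunction, of x p z y f] by (simp add: opposite_flat)

lemma sharp_Cmp_amap: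
  "\<lbrakk>i \<in> hom C w x; f \<in> hom D (omap F x) y\<rbrakk>
     \<Longrightarrow> sharp w (f \<cdot>\<^bsub>D\<^esub> amap F i) = sharp x f \<cdot>\<^bsub>C\<^esub> i"
  using adjunction.flat_amap_Cmp[OF opposite_adjunction, of i x w f y] by (simp add: opposite_flat)

text \<open>
  A square from \<open>i\<close> to \<open>G p\<close> transposes to a square from \<open>F i\<close> to \<open>p\<close>, and a diagonal of the latter
  transposes back.
\<close>

lemma has_lifting_right_adjoint:
  assumes i: "i \<in> Arr C" and p: "p \<in> Arr D" and lift: "has_lifting D (amap F i) p"
  shows "has_lifting C i (amap G p)"
proof (rule has_liftingI)
  let ?a = "Dom C i" and ?b = "Cod C i" and ?x = "Dom D p" and ?y = "Cod D p"
  have obj: "?a \<in> Obj C" "?b \<in> Obj C" "?x \<in> Obj D" "?y \<in> Obj D"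
    using i p by (simp_all add: F.C.Dom_in F.C.Cod_in F.D.Dom_in F.D.Cod_in)
  have i': "i \<in> hom C ?a ?b" and p': "p \<in> hom D ?x ?y"
    using i p by (simp_all add: hom_iff)
  note Fi = F.amap_hom[OF i'] and Gp = G.amap_hom[OF p']
  fix u v
  assume u: "u \<in> hom C ?a (Dom C (amap G p))" and v: "v \<in> hom C ?b (Cod C (amap G p))"
    and eq: "amap G p \<cdot>\<^bsub>C\<^esub> u = v \<cdot>\<^bsub>C\<^esub> i"
  have u: "u \<in> hom C ?a (omap G ?x)" and v: "v \<in> hom C ?b (omap G ?y)"
    using u v Gp by (auto simp: hom_iff)
  have "p \<cdot>\<^bsub>D\<^esub> flat ?x u = flat ?y v \<cdot>\<^bsub>D\<^esub> amap F i"
    using arg_cong[OF eq, of "flat ?y"] flat_amap_Cmp[OF p' u] flat_Cmp[OF obj(4) i' v] by simp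
  then obtain h where "h \<in> hom D (Cod D (amap F i)) ?x"
    and hi: "h \<cdot>\<^bsub>D\<^esub> amap F i = flat ?x u" and ph: "p \<cdot>\<^bsub>D\<^esub> h = flat ?y v"
    by (rule has_liftingE[OF lift])
      (use Fi flat_hom[OF obj(3) u] flat_hom[OF obj(4) v] in \<open>auto simp: hom_iff\<close>)
  then have h: "h \<in> hom D (omap F ?b) ?x"
    using Fi by (simp add: hom_iff)
  have "sharp ?b h \<cdot>\<^bsub>C\<^esub> i = u"
    using sharp_Cmp_amap[OF i' h] sharp_flat[OF obj(3) u] hi by simp
  moreover have "amap G p \<cdot>\<^bsub>C\<^esub> sharp ?b h = v"
    using sharp_Cmp[OF obj(2) h p'] sharp_flat[OF obj(4) v] ph by simp
  moreover have "sharp ?b h \<in> hom C ?b (Dom C (amap G p))"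
    using sharp_hom[OF obj(2) h] Gp by (simp add: hom_iff)
  ultimately show "\<exists>h \<in> hom C ?b (Dom C (amap G p)). h \<cdot>\<^bsub>C\<^esub> i = u \<and> amap G p \<cdot>\<^bsub>C\<^esub> h = v"
    by blast
qed

lemma has_lifting_left_adjoint:
  assumes "i \<in> Arr C" "p \<in> Arr D" "has_lifting C i (amap G p)"
  shows "has_lifting D (amap F i) p"
  using adjunction.has_lifting_right_adjoint[OF opposite_adjunction, of p i] assms
  by (simp add: has_lifting_opposite)

text \<open>
  Cocones on \<open>F X\<close> with vertex \<open>d\<close> transpose to cocones on \<open>X\<close> with vertex \<open>G d\<close>. The diagram \<open>X'\<close> is
  only required to agree with \<open>F X\<close> on \<open>J\<close>, because postcomposed diagrams are normalized to be
  \<open>undefined\<close> elsewhere.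
\<close>

lemma left_adjoint_preserves_colimit:
  assumes X: "\<And>f. f \<in> Arr J \<Longrightarrow> Dom J f \<in> Obj J \<and> Cod J f \<in> Obj J \<and>
      amap X f \<in> hom C (omap X (Dom J f)) (omap X (Cod J f))"
    and FX: "\<And>j. j \<in> Obj J \<Longrightarrow> omap X' j = omap F (omap X j)"
      "\<And>f. f \<in> Arr J \<Longrightarrow> amap X' f = amap F (amap X f)"
    and colim: "is_colimit J C X c \<kappa>"
  shows "is_colimit J D X' (omap F c) (\<lambda>j. amap F (\<kappa> j))"
proof -
  have c: "c \<in> Obj C" and \<kappa>: "\<And>j. j \<in> Obj J \<Longrightarrow> \<kappa> j \<in> hom C (omap X j) c"
    and \<kappa>_nat: "\<And>f. f \<in> Arr J \<Longrightarrow> \<kappa> (Cod J f) \<cdot>\<^bsub>C\<^esub> amap X f = \<kappa> (Dom J f)"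
    using colim by (auto simp: is_colimit_def is_cocone_def)
  have "is_cocone J D X' (omap F c) (\<lambda>j. amap F (\<kappa> j))"
    unfolding is_cocone_def
  proof (intro conjI ballI)
    fix f assume f: "f \<in> Arr J"
    have "amap F (\<kappa> (Cod J f) \<cdot>\<^bsub>C\<^esub> amap X f) = amap F (\<kappa> (Cod J f)) \<cdot>\<^bsub>D\<^esub> amap F (amap X f)"
      using X[OF f] \<kappa> by (intro F.amap_Cmp) auto
    then show "amap F (\<kappa> (Cod J f)) \<cdot>\<^bsub>D\<^esub> amap X' f = amap F (\<kappa> (Dom J f))"
      using f by (simp add: \<kappa>_nat FX)
  qed (use F.omap_in[OF c] F.amap_hom[OF \<kappa>] FX in auto)
  moreover have "\<exists>!u. u \<in> hom D (omap F c) d \<and> (\<forall>j \<in> Obj J. u \<cdot>\<^bsub>D\<^esub> amap F (\<kappa> j) = \<delta> j)"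
    if \<delta>: "is_cocone J D X' d \<delta>" for d \<delta>
  proof -
    have d: "d \<in> Obj D" and \<delta>_hom: "\<And>j. j \<in> Obj J \<Longrightarrow> \<delta> j \<in> hom D (omap F (omap X j)) d"
      and \<delta>_nat: "\<And>f. f \<in> Arr J \<Longrightarrow> \<delta> (Cod J f) \<cdot>\<^bsub>D\<^esub> amap F (amap X f) = \<delta> (Dom J f)"
      using \<delta> FX by (auto simp: is_cocone_def)
    have Xj: "omap X j \<in> Obj C" if "j \<in> Obj J" for j
      using F.C.hom_Obj[OF \<kappa>[OF that]] by simp
    have "is_cocone J C X (omap G d) (\<lambda>j. sharp (omap X j) (\<delta> j))"
      unfolding is_cocone_def
    proof (intro conjI ballI)
      fix f assume f: "f \<in> Arr J"
      show "sharp (omap X (Cod J f)) (\<delta> (Cod J f)) \<cdot>\<^bsub>C\<^esub> amap X f = sharp (omap X (Dom J f)) (\<delta> (Dom J f))"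
        using sharp_Cmp_amap[of "amap X f" "omap X (Dom J f)" "omap X (Cod J f)" "\<delta> (Cod J f)" d]
          X[OF f] \<delta>_hom \<delta>_nat[OF f] by simp
    qed (use sharp_hom[OF Xj \<delta>_hom] G.omap_in[OF d] in auto)
    then obtain u where u: "u \<in> hom C c (omap G d)" "\<And>j. j \<in> Obj J \<Longrightarrow> u \<cdot>\<^bsub>C\<^esub> \<kappa> j = sharp (omap X j) (\<delta> j)"
      and uniq: "\<And>u'. u' \<in> hom C c (omap G d) \<Longrightarrow> \<forall>j \<in> Obj J. u' \<cdot>\<^bsub>C\<^esub> \<kappa> j = sharp (omap X j) (\<delta> j) \<Longrightarrow> u' = u"
      by (rule is_colimit_factorization[OF colim]) blast
    show ?thesis
    proof (rule ex1I[of _ "flat d u"])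
      show "flat d u \<in> hom D (omap F c) d \<and> (\<forall>j \<in> Obj J. flat d u \<cdot>\<^bsub>D\<^esub> amap F (\<kappa> j) = \<delta> j)"
        using flat_hom[OF d u(1)] flat_Cmp[OF d \<kappa> u(1)] u(2) flat_sharp[OF Xj \<delta>_hom] by auto
    next
      fix v assume v: "v \<in> hom D (omap F c) d \<and> (\<forall>j \<in> Obj J. v \<cdot>\<^bsub>D\<^esub> amap F (\<kappa> j) = \<delta> j)"
      have "sharp c v \<cdot>\<^bsub>C\<^esub> \<kappa> j = sharp (omap X j) (\<delta> j)" if "j \<in> Obj J" for j
        using sharp_Cmp_amap[OF \<kappa>[OF that], of v d] v that by simp
      then have "sharp c v = u"
        using v sharp_hom[OF c] by (intro uniq) auto
      then show "v = flat d u"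
        using flat_sharp[OF c] v by auto
    qed
  qed
  ultimately show ?thesis
    by (auto simp: is_colimit_def)
qed

lemma left_adjoint_preserves_pushout:
  assumes po: "is_pushout C f g p i j"
  shows "is_pushout D (amap F f) (amap F g) (omap F p) (amap F i) (amap F j)"
proof -
  define a b c where abc: "a = Dom C f" "b = Cod C f" "c = Cod C g"
  have f: "f \<in> hom C a b" and g: "g \<in> hom C a c" and i: "i \<in> hom C b p" and j: "j \<in> hom C c p"
    and comm: "i \<cdot>\<^bsub>C\<^esub> f = j \<cdot>\<^bsub>C\<^esub> g"
    using po by (auto simp: is_pushout_def hom_iff abc)
  have obj: "a \<in> Obj C" "b \<in> Obj C" "c \<in> Obj C" "p \<in> Obj C"
    using F.C.hom_Obj[OF f] F.C.hom_Obj[OF j] by auto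
  have F: "amap F f \<in> hom D (omap F a) (omap F b)" "amap F g \<in> hom D (omap F a) (omap F c)"
    "amap F i \<in> hom D (omap F b) (omap F p)" "amap F j \<in> hom D (omap F c) (omap F p)"
    using f g i j by (auto intro: F.amap_hom)
  have "\<exists>!u. u \<in> hom D (omap F p) d \<and> u \<cdot>\<^bsub>D\<^esub> amap F i = r \<and> u \<cdot>\<^bsub>D\<^esub> amap F j = s"
    if r: "r \<in> hom D (omap F b) d" and s: "s \<in> hom D (omap F c) d"
      and rs: "r \<cdot>\<^bsub>D\<^esub> amap F f = s \<cdot>\<^bsub>D\<^esub> amap F g" for d r s
  proof -
    have d: "d \<in> Obj D" using F.D.hom_Obj[OF r] by simp
    have eq: "sharp b r \<cdot>\<^bsub>C\<^esub> f = sharp c s \<cdot>\<^bsub>C\<^esub> g"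
      using sharp_Cmp_amap[OF f r] sharp_Cmp_amap[OF g s] rs by simp
    have hom: "sharp b r \<in> hom C (Cod C f) (omap G d)" "sharp c s \<in> hom C (Cod C g) (omap G d)"
      using sharp_hom[OF obj(2) r] sharp_hom[OF obj(3) s] by (simp_all add: abc)
    obtain u where u: "u \<in> hom C p (omap G d)" "u \<cdot>\<^bsub>C\<^esub> i = sharp b r" "u \<cdot>\<^bsub>C\<^esub> j = sharp c s"
      and uniq: "\<And>u'. \<lbrakk>u' \<in> hom C p (omap G d); u' \<cdot>\<^bsub>C\<^esub> i = sharp b r; u' \<cdot>\<^bsub>C\<^esub> j = sharp c s\<rbrakk> \<Longrightarrow> u' = u"
      by (rule is_pushout_factorization[OF po eq hom]) blast
    show ?thesis
    proof (rule ex1I[of _ "flat d u"])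
      show "flat d u \<in> hom D (omap F p) d \<and> flat d u \<cdot>\<^bsub>D\<^esub> amap F i = r \<and> flat d u \<cdot>\<^bsub>D\<^esub> amap F j = s"
        using flat_hom[OF d u(1)] flat_Cmp[OF d i u(1)] flat_Cmp[OF d j u(1)] u(2,3)
          flat_sharp[OF obj(2) r] flat_sharp[OF obj(3) s] by simp
    next
      fix v assume v: "v \<in> hom D (omap F p) d \<and> v \<cdot>\<^bsub>D\<^esub> amap F i = r \<and> v \<cdot>\<^bsub>D\<^esub> amap F j = s"
      have "sharp p v = u"
        using v sharp_hom[OF obj(4)] sharp_Cmp_amap[OF i, of v d] sharp_Cmp_amap[OF j, of v d]
        by (intro uniq) auto
      then show "v = flat d u"
        using flat_sharp[OF obj(4)] v by auto
    qed
  qed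
  moreover have "amap F i \<cdot>\<^bsub>D\<^esub> amap F f = amap F j \<cdot>\<^bsub>D\<^esub> amap F g"
    using F.amap_Cmp[OF f i] F.amap_Cmp[OF g j] comm by simp
  moreover have "Dom D (amap F f) = omap F a" "Dom D (amap F g) = omap F a"
    "Cod D (amap F f) = omap F b" "Cod D (amap F g) = omap F c"
    "amap F f \<in> Arr D" "amap F g \<in> Arr D"
    using F by (simp_all add: hom_iff)
  ultimately show ?thesis
    using F(3,4) by (simp add: is_pushout_def)
qed

end

section \<open>Cofibrations and fibrations in terms of liftings\<close>

lemma is_retractI:
  assumes "f \<in> hom C a b" "g \<in> hom C x y" "i \<in> hom C a x" "r \<in> hom C x a"
    "j \<in> hom C b y" "s \<in> hom C y b" "r \<cdot>\<^bsub>C\<^esub> i = Ide C a" "s \<cdot>\<^bsub>C\<^esub> j = Ide C b"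
    "g \<cdot>\<^bsub>C\<^esub> i = j \<cdot>\<^bsub>C\<^esub> f" "f \<cdot>\<^bsub>C\<^esub> r = s \<cdot>\<^bsub>C\<^esub> g"
  shows "is_retract C f g"
proof -
  have ends: "Dom C f = a" "Cod C f = b" "Dom C g = x" "Cod C g = y" "f \<in> Arr C" "g \<in> Arr C"
    using assms(1,2) by (auto simp: hom_iff)
  have "\<exists>i\<in>hom C a x. \<exists>r\<in>hom C x a. \<exists>j\<in>hom C b y. \<exists>s\<in>hom C y b.
      r \<cdot>\<^bsub>C\<^esub> i = Ide C a \<and> s \<cdot>\<^bsub>C\<^esub> j = Ide C b \<and> g \<cdot>\<^bsub>C\<^esub> i = j \<cdot>\<^bsub>C\<^esub> f \<and> f \<cdot>\<^bsub>C\<^esub> r = s \<cdot>\<^bsub>C\<^esub> g"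
    by (rule bexI[of _ i], rule bexI[of _ r], rule bexI[of _ j], rule bexI[of _ s]) (simp_all add: assms)
  with ends show ?thesis
    by (simp add: is_retract_def)
qed

text \<open>
  The retract argument: a diagonal in the square from \<open>p \<cdot> i\<close> to \<open>p\<close> with upper side \<open>i\<close> and lower side
  an identity exhibits \<open>p \<cdot> i\<close> as a retract of \<open>i\<close>.
\<close>

lemma (in category) is_retract_of_factor:
  assumes i: "i \<in> hom C a c" and p: "p \<in> hom C c b" and lift: "has_lifting C (p \<cdot> i) p"
  shows "is_retract C (p \<cdot> i) i"
proof -
  have ab: "a \<in> Obj C" "b \<in> Obj C" using hom_Obj[OF i] hom_Obj[OF p] by auto
  have "p \<cdot> i \<in> hom C a b" using Cmp_hom[OF i p] .
  moreover obtain h where "h \<in> hom C (Cod C (p \<cdot> i)) (Dom C p)" "h \<cdot> (p \<cdot> i) = i" "p \<cdot> h = Ide C b"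
    by (rule has_liftingE[OF lift, of i "Ide C b"]) (use i p ab in \<open>auto simp: hom_iff\<close>)
  ultimately show ?thesis
    using i p ab
    by (intro is_retractI[where i = "Ide C a" and r = "Ide C a" and j = h and s = p]) (auto simp: hom_iff)
qed

context model_category
begin

text \<open>
  A map with the lifting property lifts against the second factor of its own factorization, and the
  retract argument applies.
\<close>

lemma cof_iff: "i \<in> cof M \<longleftrightarrow> i \<in> Arr C \<and> (\<forall>p \<in> fib M \<inter> weq M. has_lifting C i p)"
proof (intro iffI conjI ballI)
  assume i: "i \<in> Arr C \<and> (\<forall>p \<in> fib M \<inter> weq M. has_lifting C i p)"
  then obtain c j p where "j \<in> hom C (Dom C i) c" "p \<in> hom C c (Cod C i)" "j \<in> cof M"
    "p \<in> fib M \<inter> weq M" "i = p \<cdot> j"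
    using factor_cof[OF in_hom_Dom_Cod] by metis
  then show "i \<in> cof M"
    using is_retract_of_factor i cof_retract by blast
qed (use cof_Arr lift_cof in auto)

lemma acof_iff: "i \<in> cof M \<inter> weq M \<longleftrightarrow> i \<in> Arr C \<and> (\<forall>p \<in> fib M. has_lifting C i p)"
proof (intro iffI conjI ballI)
  assume i: "i \<in> Arr C \<and> (\<forall>p \<in> fib M. has_lifting C i p)"
  then obtain c j p where "j \<in> hom C (Dom C i) c" "p \<in> hom C c (Cod C i)" "j \<in> cof M \<inter> weq M"
    "p \<in> fib M" "i = p \<cdot> j"
    using factor_acof[OF in_hom_Dom_Cod] by metis
  then show "i \<in> cof M \<inter> weq M"
    using is_retract_of_factor i cof_retract weq_retract by blast
qed (use cof_Arr lift_acof in auto)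

lemma opposite_model_category: "model_category U (opposite C) (opposite_model M)"
  by (rule model_category_opposite) (rule model_category_axioms)

lemma fib_iff: "p \<in> fib M \<longleftrightarrow> p \<in> Arr C \<and> (\<forall>i \<in> cof M \<inter> weq M. has_lifting C i p)"
  using model_category.cof_iff[OF opposite_model_category] by (simp add: has_lifting_opposite)

lemma afib_iff: "p \<in> fib M \<inter> weq M \<longleftrightarrow> p \<in> Arr C \<and> (\<forall>i \<in> cof M. has_lifting C i p)"
  using model_category.acof_iff[OF opposite_model_category] by (simp add: has_lifting_opposite)

end

context adjunction
begin

lemma quillen_adjunctionI_fib:
  assumes "model_category U C MC" "model_category U D MD"
    and fib: "\<And>p. p \<in> fib MD \<Longrightarrow> amap G p \<in> fib MC"
    and afib: "\<And>p. p \<in> fib MD \<inter> weq MD \<Longrightarrow> amap G p \<in> fib MC \<inter> weq MC"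
  shows "quillen_adjunction U C MC D MD F G \<eta> \<epsilon>"
proof -
  interpret CM: model_category U C MC by fact
  interpret DM: model_category U D MD by fact
  have F_Arr: "amap F i \<in> Arr D" if "i \<in> Arr C" for i
    using F.amap_hom[OF in_hom_Dom_Cod[OF that]] by (simp add: hom_iff)
  show ?thesis
  proof
    show "amap F i \<in> cof MD" if "i \<in> cof MC" for i
      using that CM.cof_Arr DM.fib_Arr F_Arr afib CM.lift_cof
      unfolding DM.cof_iff by (blast intro: has_lifting_left_adjoint)
    show "amap F i \<in> cof MD \<inter> weq MD" if "i \<in> cof MC \<inter> weq MC" for i
      using that CM.cof_Arr DM.fib_Arr F_Arr fib CM.lift_acof
      unfolding DM.acof_iff by (blast intro: has_lifting_left_adjoint)
  qed
qed

lemma quillen_adjunctionI_cof_fib: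
  assumes "model_category U C MC" "model_category U D MD"
    and cof: "\<And>i. i \<in> cof MC \<Longrightarrow> amap F i \<in> cof MD"
    and fib: "\<And>p. p \<in> fib MD \<Longrightarrow> amap G p \<in> fib MC"
  shows "quillen_adjunction U C MC D MD F G \<eta> \<epsilon>"
proof -
  interpret CM: model_category U C MC by fact
  interpret DM: model_category U D MD by fact
  have G_Arr: "amap G p \<in> Arr C" if "p \<in> Arr D" for p
    using G.amap_hom[OF in_hom_Dom_Cod[OF that]] by (simp add: hom_iff)
  show ?thesis
  proof (rule quillen_adjunctionI_fib)
    show "amap G p \<in> fib MC \<inter> weq MC" if "p \<in> fib MD \<inter> weq MD" for p
      using that CM.cof_Arr DM.fib_Arr G_Arr cof DM.lift_cof
      unfolding CM.afib_iff by (blast intro: has_lifting_right_adjoint)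
  qed (use assms fib in auto)
qed

end

context quillen_adjunction
begin

lemma G_Arr: "p \<in> Arr D \<Longrightarrow> amap G p \<in> Arr C"
  using G.amap_hom[OF in_hom_Dom_Cod] by (simp add: hom_iff)

lemma G_fib: "p \<in> fib MD \<Longrightarrow> amap G p \<in> fib MC"
  using CM.cof_Arr DM.fib_Arr G_Arr F_acof DM.lift_acof
  unfolding CM.fib_iff by (blast intro: has_lifting_right_adjoint)

lemma G_afib: "p \<in> fib MD \<inter> weq MD \<Longrightarrow> amap G p \<in> fib MC \<inter> weq MC"
  using CM.cof_Arr DM.fib_Arr G_Arr F_cof DM.lift_cof
  unfolding CM.afib_iff by (blast intro: has_lifting_right_adjoint)

end


section \<open>Relative latching and matching maps\<close>

lemma latching_category_simps [simp]:
  "f \<in> Obj (latching_category K R k) \<longleftrightarrow> f \<in> up R \<and> Cod K f = k \<and> f \<noteq> Ide K k"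
  "(h, g) \<in> Arr (latching_category K R k) \<longleftrightarrow> h \<in> up R \<and> g \<in> up R \<and> Cod K h = Dom K g \<and>
     Cod K g = k \<and> g \<noteq> Ide K k \<and> g \<cdot>\<^bsub>K\<^esub> h \<noteq> Ide K k"
  "Dom (latching_category K R k) (h, g) = g \<cdot>\<^bsub>K\<^esub> h"
  "Cod (latching_category K R k) (h, g) = g"
  by (simp_all add: latching_category_def)

lemma matching_category_simps [simp]:
  "f \<in> Obj (matching_category K R k) \<longleftrightarrow> f \<in> down R \<and> Dom K f = k \<and> f \<noteq> Ide K k"
  "(h, f) \<in> Arr (matching_category K R k) \<longleftrightarrow> h \<in> down R \<and> f \<in> down R \<and> Cod K f = Dom K h \<and>
     Dom K f = k \<and> f \<noteq> Ide K k \<and> h \<cdot>\<^bsub>K\<^esub> f \<noteq> Ide K k"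
  "Dom (matching_category K R k) (h, f) = f"
  "Cod (matching_category K R k) (h, f) = h \<cdot>\<^bsub>K\<^esub> f"
  by (simp_all add: matching_category_def)

text \<open>
  The encodings of the arrows of latching and matching categories by pairs correspond literally,
  so the two categories are equal and not only isomorphic.
\<close>

lemma latching_category_opposite:
  "latching_category (opposite K) (opposite_reedy R) k = opposite (matching_category K R k)"
  by (auto simp: latching_category_def matching_category_def opposite_def opposite_reedy_def fun_eq_iff)

lemma latching_diagram_opposite: "latching_diagram (opposite K) X = matching_diagram K X"
  by (simp add: latching_diagram_def matching_diagram_def)

lemma relative_latching_map_opposite:
  "relative_latching_map (opposite K) (opposite_reedy R) (opposite C) (opposite_arrow t) k u
     \<longleftrightarrow> relative_matching_map K R C t k u"
  unfolding relative_latching_map_def relative_matching_map_def latching_category_opposite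
    latching_diagram_opposite is_colimit_opposite is_pushout_opposite opposite_simps
    opposite_arrow_simps hom_opposite
  by (rule iffI; elim exE conjE; intro exI conjI; assumption)

text \<open>
  A relative latching map is specified by two colimits, a pushout and equations between composites,
  all of which are preserved by a left adjoint.
\<close>

lemma (in adjunction) relative_latching_map_postcomp:
  assumes "reedy_category K R" and t: "t \<in> Arr (diagrams K C)" and k: "k \<in> Obj K"
    and u: "relative_latching_map K R C t k u"
  shows "relative_latching_map K R D (amap (postcomp K F) t) k (amap F u)"
proof -
  interpret K: reedy_category K R by fact
  let ?J = "latching_category K R k"
  have J: "f \<in> Arr K" "Dom K f \<in> Obj K" "Cod K f = k" if "f \<in> Obj ?J" for f
    using that K.up_Arr K.Dom_in by auto
  have colim: "is_colimit ?J D (latching_diagram K (postcomp_obj K F X)) (omap F c) (\<lambda>j. amap F (\<kappa> j))"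
    if X: "X \<in> Obj (diagrams K C)" and "is_colimit ?J C (latching_diagram K X) c \<kappa>" for X c \<kappa>
  proof (rule left_adjoint_preserves_colimit)
    fix x assume x: "x \<in> Arr ?J"
    obtain h g where [simp]: "x = (h, g)" by (cases x)
    have "h \<in> Arr K" "g \<in> Arr K" "Cod K h = Dom K g" "g \<cdot>\<^bsub>K\<^esub> h \<in> up R"
      using x K.up_Arr K.up_Cmp by auto
    then show "Dom ?J x \<in> Obj ?J \<and> Cod ?J x \<in> Obj ?J \<and> amap (latching_diagram K X) x
        \<in> hom C (omap (latching_diagram K X) (Dom ?J x)) (omap (latching_diagram K X) (Cod ?J x))"
      using x X by (simp add: latching_diagram_def hom_iff)
    show "amap (latching_diagram K (postcomp_obj K F X)) x = amap F (amap (latching_diagram K X) x)"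
      using \<open>h \<in> Arr K\<close> by (simp add: latching_diagram_def)
  next
    fix f assume "f \<in> Obj ?J"
    then show "omap (latching_diagram K (postcomp_obj K F X)) f = omap F (omap (latching_diagram K X) f)"
      using J by (simp add: latching_diagram_def)
  qed fact
  obtain L \<kappa> L' \<kappa>' m m' l p i j where
    L: "is_colimit ?J C (latching_diagram K (nsrc t)) L \<kappa>"
    and L': "is_colimit ?J C (latching_diagram K (ntgt t)) L' \<kappa>'"
    and m: "m \<in> hom C L (omap (nsrc t) k)" "\<forall>f \<in> Obj ?J. m \<cdot>\<^bsub>C\<^esub> \<kappa> f = amap (nsrc t) f"
    and m': "m' \<in> hom C L' (omap (ntgt t) k)" "\<forall>f \<in> Obj ?J. m' \<cdot>\<^bsub>C\<^esub> \<kappa>' f = amap (ntgt t) f"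
    and l: "l \<in> hom C L L'" "\<forall>f \<in> Obj ?J. l \<cdot>\<^bsub>C\<^esub> \<kappa> f = \<kappa>' f \<cdot>\<^bsub>C\<^esub> ncmp t (Dom K f)"
    and po: "is_pushout C m l p i j"
    and u: "u \<in> hom C p (omap (ntgt t) k)" "u \<cdot>\<^bsub>C\<^esub> i = ncmp t k" "u \<cdot>\<^bsub>C\<^esub> j = m'"
    using u unfolding relative_latching_map_def by (elim exE conjE)
  note st = diagram_Arr_Obj[OF t]
  have \<kappa>: "\<kappa> f \<in> hom C (omap (nsrc t) (Dom K f)) L" "\<kappa>' f \<in> hom C (omap (ntgt t) (Dom K f)) L'"
    if "f \<in> Obj ?J" for f
    using L L' that by (auto simp: is_colimit_def is_cocone_def latching_diagram_def)
  have compat: "amap F m \<cdot>\<^bsub>D\<^esub> amap F (\<kappa> f) = amap (postcomp_obj K F (nsrc t)) f"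
    "amap F m' \<cdot>\<^bsub>D\<^esub> amap F (\<kappa>' f) = amap (postcomp_obj K F (ntgt t)) f"
    "amap F l \<cdot>\<^bsub>D\<^esub> amap F (\<kappa> f) = amap F (\<kappa>' f) \<cdot>\<^bsub>D\<^esub> ncmp (amap (postcomp K F) t) (Dom K f)"
    if f: "f \<in> Obj ?J" for f
    using F.amap_Cmp[OF \<kappa>(1)[OF f] m(1)] F.amap_Cmp[OF \<kappa>(2)[OF f] m'(1)] F.amap_Cmp[OF \<kappa>(1)[OF f] l(1)]
      F.amap_Cmp[OF diagram_component[OF in_hom_Dom_Cod[OF t], simplified] \<kappa>(2)[OF f]] m(2) m'(2) l(2) f J[OF f]
    by auto
  have "i \<in> hom C (omap (nsrc t) k) p" "j \<in> hom C L' p"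
    using po m(1) l(1) by (auto simp: is_pushout_def hom_iff)
  then have legs: "amap F u \<cdot>\<^bsub>D\<^esub> amap F i = amap F (ncmp t k)" "amap F u \<cdot>\<^bsub>D\<^esub> amap F j = amap F m'"
    using F.amap_Cmp u by metis+
  show ?thesis
    unfolding relative_latching_map_def postcomp_simps(2,3) postcomp_simps(4)[OF k]
      postcomp_obj_simps(1)[OF k]
    by (intro exI conjI ballI; (rule colim[OF st(1) L] colim[OF st(2) L'] compat legs F.amap_hom
      left_adjoint_preserves_pushout[OF po] m(1) m'(1) l(1) u(1))+)
qed

lemma opposite_postcomp: "postcomp_obj (opposite K) F X = postcomp_obj K F X"
  by (simp add: postcomp_obj_def mk_diagram_def)

lemma opposite_arrow_postcomp:
  "opposite_arrow (amap (postcomp K F) t) = amap (postcomp (opposite K) F) (opposite_arrow t)"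
  by (simp add: postcomp_def opposite_postcomp)

lemma (in adjunction) relative_matching_map_postcomp:
  assumes "reedy_category K R" "t \<in> Arr (diagrams K D)" "k \<in> Obj K"
    and "relative_matching_map K R D t k u"
  shows "relative_matching_map K R C (amap (postcomp K G) t) k (amap G u)"
  using adjunction.relative_latching_map_postcomp[OF opposite_adjunction
      reedy_category_opposite[OF assms(1)], of "opposite_arrow t" k u] assms(2-)
    relative_latching_map_opposite[of K R D t k u]
    relative_latching_map_opposite[of K R C "amap (postcomp K G) t" k "amap G u"]
  by (simp add: opposite_arrow_postcomp)


section \<open>Products\<close>

text \<open>
  The vertex \<open>d\<close> is restricted to objects explicitly because for empty \<open>I\<close> there is no leg that would
  force this.
\<close>

definition is_product :: "('o, 'a) cat \<Rightarrow> 'i set \<Rightarrow> ('i \<Rightarrow> 'o) \<Rightarrow> 'o \<Rightarrow> ('i \<Rightarrow> 'a) \<Rightarrow> bool" where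
  "is_product C I c p \<pi> \<longleftrightarrow> p \<in> Obj C \<and> (\<forall>i \<in> I. \<pi> i \<in> hom C p (c i)) \<and>
     (\<forall>d \<in> Obj C. \<forall>\<delta>. (\<forall>i \<in> I. \<delta> i \<in> hom C d (c i)) \<longrightarrow>
        (\<exists>!u. u \<in> hom C d p \<and> (\<forall>i \<in> I. \<pi> i \<cdot>\<^bsub>C\<^esub> u = \<delta> i)))"

text \<open>
  A product is a limit over the discrete category on \<open>I\<close>, which is small because \<open>I\<close> is a set of
  elements of the type \<open>'s\<close>.
\<close>

lemma small_complete_has_product:
  fixes U :: "'s::infinite itself" and I :: "'s set"
  assumes "category C" "small_complete U C" "\<And>i. i \<in> I \<Longrightarrow> c i \<in> Obj C"
  shows "\<exists>p \<pi>. is_product C I c p \<pi>"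
proof -
  interpret category C by fact
  define J :: "('s, 's) cat" where
    "J = \<lparr>Obj = I, Arr = I, Dom = \<lambda>i. i, Cod = \<lambda>i. i, Ide = \<lambda>i. i, Cmp = \<lambda>i j. i\<rparr>"
  define X where "X = \<lparr>omap = c, amap = \<lambda>i. Ide C (c i)\<rparr>"
  interpret J: category J
    by unfold_locales (auto simp: J_def hom_iff)
  interpret X: cat_functor J C X
    by unfold_locales (use assms(3) in \<open>auto simp: J_def X_def hom_iff\<close>)
  obtain p \<pi> where lim: "is_limit J C X p \<pi>"
    using assms(2) X.cat_functor_axioms unfolding small_complete_def by blast
  have cone_iff: "is_cone J C X d \<delta> \<longleftrightarrow> d \<in> Obj C \<and> (\<forall>i \<in> I. \<delta> i \<in> hom C d (c i))" for d \<delta>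
    using assms(3) by (auto simp: is_cone_def J_def X_def hom_iff)
  have "is_product C I c p \<pi>"
    using lim unfolding is_limit_def is_product_def cone_iff by (simp add: J_def)
  then show ?thesis by blast
qed

text \<open>
  Products are fixed by choice functions, so that diagrams whose values are products can be defined
  by formulas.
\<close>

locale category_with_products = category C
  for C :: "('o, 'a) cat" (structure)
    and P :: "'i set \<Rightarrow> ('i \<Rightarrow> 'o) \<Rightarrow> 'o" and \<pi> :: "'i set \<Rightarrow> ('i \<Rightarrow> 'o) \<Rightarrow> 'i \<Rightarrow> 'a" +
  assumes product: "(\<And>i. i \<in> I \<Longrightarrow> c i \<in> Obj C) \<Longrightarrow> is_product C I c (P I c) (\<pi> I c)"
begin

definition tuple :: "'i set \<Rightarrow> ('i \<Rightarrow> 'o) \<Rightarrow> 'o \<Rightarrow> ('i \<Rightarrow> 'a) \<Rightarrow> 'a" where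
  "tuple I c d \<delta> = (THE u. u \<in> hom C d (P I c) \<and> (\<forall>i \<in> I. \<pi> I c i \<cdot> u = \<delta> i))"

lemma product_Obj [simp]: "(\<And>i. i \<in> I \<Longrightarrow> c i \<in> Obj C) \<Longrightarrow> P I c \<in> Obj C"
  using product[of I c] by (simp add: is_product_def)

lemma proj_simps [simp]:
  assumes "\<And>i. i \<in> I \<Longrightarrow> c i \<in> Obj C" "i \<in> I"
  shows "\<pi> I c i \<in> Arr C" "Dom C (\<pi> I c i) = P I c" "Cod C (\<pi> I c i) = c i"
  using product[of I c] assms by (auto simp: is_product_def hom_iff)

lemma tuple_props:
  assumes "\<And>i. i \<in> I \<Longrightarrow> c i \<in> Obj C" "d \<in> Obj C"
    and "\<And>i. i \<in> I \<Longrightarrow> \<delta> i \<in> Arr C" "\<And>i. i \<in> I \<Longrightarrow> Dom C (\<delta> i) = d" "\<And>i. i \<in> I \<Longrightarrow> Cod C (\<delta> i) = c i"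
  shows "tuple I c d \<delta> \<in> hom C d (P I c) \<and> (\<forall>i \<in> I. \<pi> I c i \<cdot> tuple I c d \<delta> = \<delta> i)"
  unfolding tuple_def
  by (rule theI') (use product[of I c] assms in \<open>simp add: is_product_def hom_iff\<close>)

lemma tuple_simps [simp]:
  assumes "\<And>i. i \<in> I \<Longrightarrow> c i \<in> Obj C" "d \<in> Obj C"
    and "\<And>i. i \<in> I \<Longrightarrow> \<delta> i \<in> Arr C" "\<And>i. i \<in> I \<Longrightarrow> Dom C (\<delta> i) = d" "\<And>i. i \<in> I \<Longrightarrow> Cod C (\<delta> i) = c i"
  shows "tuple I c d \<delta> \<in> Arr C" "Dom C (tuple I c d \<delta>) = d" "Cod C (tuple I c d \<delta>) = P I c"
    "i \<in> I \<Longrightarrow> \<pi> I c i \<cdot> tuple I c d \<delta> = \<delta> i"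
  using tuple_props[OF assms] by (auto simp: hom_iff)

lemma product_eqI:
  assumes "\<And>i. i \<in> I \<Longrightarrow> c i \<in> Obj C" "u \<in> hom C d (P I c)" "v \<in> hom C d (P I c)"
    and "\<And>i. i \<in> I \<Longrightarrow> \<pi> I c i \<cdot> u = \<pi> I c i \<cdot> v"
  shows "u = v"
proof -
  have d: "d \<in> Obj C" using hom_Obj[OF assms(2)] by simp
  have "\<forall>i \<in> I. \<pi> I c i \<cdot> v \<in> hom C d (c i)"
    using assms(1,3) by (auto simp: hom_iff)
  then have "\<exists>!w. w \<in> hom C d (P I c) \<and> (\<forall>i \<in> I. \<pi> I c i \<cdot> w = \<pi> I c i \<cdot> v)"
    using product[of I c, OF assms(1)] d
    by (simp add: is_product_def)
  then show ?thesis
    using assms(2-4) by blast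
qed

lemma product_arrow_eqI:
  assumes "\<And>i. i \<in> I \<Longrightarrow> c i \<in> Obj C" "u \<in> Arr C" "v \<in> Arr C" "Dom C u = Dom C v"
    "Cod C u = P I c" "Cod C v = P I c" "\<And>i. i \<in> I \<Longrightarrow> \<pi> I c i \<cdot> u = \<pi> I c i \<cdot> v"
  shows "u = v"
  by (rule product_eqI[where d = "Dom C u"]) (use assms in \<open>auto simp: hom_iff\<close>)

text \<open>
  Diagonals for the factors \<open>f i\<close> are the components of a diagonal for the product map \<open>t\<close>.
\<close>

lemma has_lifting_product:
  assumes c: "\<And>i. i \<in> I \<Longrightarrow> c i \<in> Obj C" and c': "\<And>i. i \<in> I \<Longrightarrow> c' i \<in> Obj C"
    and f: "\<And>i. i \<in> I \<Longrightarrow> f i \<in> hom C (c i) (c' i)"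
    and t: "t \<in> hom C (P I c) (P I c')" "\<And>i. i \<in> I \<Longrightarrow> \<pi> I c' i \<cdot> t = f i \<cdot> \<pi> I c i"
    and s: "s \<in> Arr C" and lift: "\<And>i. i \<in> I \<Longrightarrow> has_lifting C s (f i)"
  shows "has_lifting C s t"
proof (rule has_liftingI)
  fix u v assume u: "u \<in> hom C (Dom C s) (Dom C t)" and v: "v \<in> hom C (Cod C s) (Cod C t)"
    and eq: "t \<cdot> u = v \<cdot> s"
  have u: "u \<in> hom C (Dom C s) (P I c)" and v: "v \<in> hom C (Cod C s) (P I c')"
    and tA: "t \<in> Arr C" "Dom C t = P I c" "Cod C t = P I c'"
    using u v t by (auto simp: hom_iff)
  have "\<exists>h. h \<in> hom C (Cod C s) (c i) \<and> h \<cdot> s = \<pi> I c i \<cdot> u \<and> f i \<cdot> h = \<pi> I c' i \<cdot> v" if i: "i \<in> I" for i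
  proof -
    have fi: "f i \<in> Arr C" "Dom C (f i) = c i" "Cod C (f i) = c' i"
      using f[OF i] by (auto simp: hom_iff)
    have "f i \<cdot> (\<pi> I c i \<cdot> u) = (f i \<cdot> \<pi> I c i) \<cdot> u"
      using fi i u c by (intro Cmp_assoc_simp[symmetric]) (auto simp: hom_iff)
    also have "\<dots> = \<pi> I c' i \<cdot> (t \<cdot> u)"
      using tA i u c' by (subst t(2)[OF i, symmetric], intro Cmp_assoc_simp) (auto simp: hom_iff)
    also have "\<dots> = (\<pi> I c' i \<cdot> v) \<cdot> s"
      using i v s c' by (subst eq, intro Cmp_assoc_simp[symmetric]) (auto simp: hom_iff)
    finally obtain h where "h \<in> hom C (Cod C s) (Dom C (f i))" "h \<cdot> s = \<pi> I c i \<cdot> u" "f i \<cdot> h = \<pi> I c' i \<cdot> v"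
      by (rule has_liftingE[OF lift[OF i]]) (use fi u v c c' i in \<open>auto simp: hom_iff\<close>)
    then show ?thesis
      using fi by auto
  qed
  then obtain h where h: "\<And>i. i \<in> I \<Longrightarrow> h i \<in> hom C (Cod C s) (c i)"
    "\<And>i. i \<in> I \<Longrightarrow> h i \<cdot> s = \<pi> I c i \<cdot> u" "\<And>i. i \<in> I \<Longrightarrow> f i \<cdot> h i = \<pi> I c' i \<cdot> v"
    by metis
  have hA: "h i \<in> Arr C" "Dom C (h i) = Cod C s" "Cod C (h i) = c i" if "i \<in> I" for i
    using h(1)[OF that] by (auto simp: hom_iff)
  define k where "k = tuple I c (Cod C s) h"
  have k: "k \<in> Arr C" "Dom C k = Cod C s" "Cod C k = P I c"
    using c hA s by (simp_all add: k_def Cod_in)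
  have \<pi>k: "\<pi> I c i \<cdot> k = h i" if "i \<in> I" for i
    using that c hA s by (simp add: k_def Cod_in)
  have "k \<cdot> s = u"
  proof (rule product_eqI[OF c])
    fix i assume i: "i \<in> I"
    have "\<pi> I c i \<cdot> (k \<cdot> s) = (\<pi> I c i \<cdot> k) \<cdot> s"
      using c i k s by (intro Cmp_assoc_simp[symmetric]) simp_all
    then show "\<pi> I c i \<cdot> (k \<cdot> s) = \<pi> I c i \<cdot> u"
      using h(2)[OF i] \<pi>k[OF i] by simp
  qed (use u k s in \<open>auto simp: hom_iff\<close>)
  moreover have "t \<cdot> k = v"
  proof (rule product_eqI[OF c'])
    fix i assume i: "i \<in> I"
    have fi: "f i \<in> Arr C" "Dom C (f i) = c i" "Cod C (f i) = c' i"
      using f[OF i] by (auto simp: hom_iff)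
    have "\<pi> I c' i \<cdot> (t \<cdot> k) = (\<pi> I c' i \<cdot> t) \<cdot> k"
      using c' i k tA by (intro Cmp_assoc_simp[symmetric]) simp_all
    also have "\<dots> = f i \<cdot> (\<pi> I c i \<cdot> k)"
      using c i k fi by (subst t(2)[OF i], intro Cmp_assoc_simp) simp_all
    finally show "\<pi> I c' i \<cdot> (t \<cdot> k) = \<pi> I c' i \<cdot> v"
      using h(3)[OF i] \<pi>k[OF i] by simp
  qed (use v k tA in \<open>auto simp: hom_iff\<close>)
  ultimately show "\<exists>h \<in> hom C (Cod C s) (Dom C t). h \<cdot> s = u \<and> t \<cdot> h = v"
    using k tA by (auto simp: hom_iff)
qed

end

lemma (in category) has_lifting_Ide:
  assumes "s \<in> Arr C" "a \<in> Obj C"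
  shows "has_lifting C s (Ide C a)"
  by (rule has_liftingI) (use assms in \<open>auto simp: hom_iff\<close>)

section \<open>Power diagrams: the right adjoint of evaluation\<close>

locale power_diagrams = category_with_products C P \<pi> + K: category K
  for K :: "('k, 'l) cat" and C :: "('o, 'a) cat" (structure)
    and P :: "'l set \<Rightarrow> ('l \<Rightarrow> 'o) \<Rightarrow> 'o" and \<pi> :: "'l set \<Rightarrow> ('l \<Rightarrow> 'o) \<Rightarrow> 'l \<Rightarrow> 'a"
begin

sublocale category_pair K C ..

abbreviation index_Cmp :: "'l \<Rightarrow> 'l \<Rightarrow> 'l" (infixr \<open>\<star>\<close> 70) where
  "g \<star> f \<equiv> g \<cdot>\<^bsub>K\<^esub> f"

abbreviation pow :: "'k \<Rightarrow> 'k \<Rightarrow> 'o \<Rightarrow> 'o" where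
  "pow j k a \<equiv> P (hom K j k) (\<lambda>_. a)"

abbreviation pr :: "'k \<Rightarrow> 'k \<Rightarrow> 'o \<Rightarrow> 'l \<Rightarrow> 'a" where
  "pr j k a \<equiv> \<pi> (hom K j k) (\<lambda>_. a)"

text \<open>
  The diagram \<open>j \<mapsto> a\<^bsup>K(j,k)\<^esup>\<close>; an arrow \<open>g\<close> of \<open>K\<close> acts by precomposition on the exponents. The maps
  \<open>power_cmp k p\<close> are the components of the map of power diagrams induced by \<open>p\<close>, and \<open>transpose X k u\<close> is
  the arrow \<open>X \<rightarrow> a\<^bsup>K(-,k)\<^esup>\<close> that corresponds to \<open>u : X\<^sub>k \<rightarrow> a\<close>.
\<close>

definition power_map :: "'k \<Rightarrow> 'o \<Rightarrow> 'l \<Rightarrow> 'a" where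
  "power_map k a g = tuple (hom K (Cod K g) k) (\<lambda>_. a) (pow (Dom K g) k a)
     (\<lambda>h. pr (Dom K g) k a (h \<star> g))"

definition power_diagram :: "'k \<Rightarrow> 'o \<Rightarrow> ('k, 'l, 'o, 'a) func" where
  "power_diagram k a = mk_diagram K (\<lambda>j. pow j k a) (power_map k a)"

definition power_cmp :: "'k \<Rightarrow> 'a \<Rightarrow> 'k \<Rightarrow> 'a" where
  "power_cmp k p j = tuple (hom K j k) (\<lambda>_. Cod C p) (pow j k (Dom C p))
     (\<lambda>h. p \<cdot>\<^bsub>C\<^esub> pr j k (Dom C p) h)"

definition power_arrow :: "'k \<Rightarrow> 'a \<Rightarrow> ('k, 'l, 'o, 'a) ntrans" where
  "power_arrow k p = mk_arrow K (power_diagram k (Dom C p)) (power_diagram k (Cod C p)) (power_cmp k p)"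

definition transpose_cmp :: "('k, 'l, 'o, 'a) func \<Rightarrow> 'k \<Rightarrow> 'a \<Rightarrow> 'k \<Rightarrow> 'a" where
  "transpose_cmp X k u j =
     tuple (hom K j k) (\<lambda>_. Cod C u) (omap X j) (\<lambda>h. u \<cdot>\<^bsub>C\<^esub> amap X h)"

definition transpose :: "('k, 'l, 'o, 'a) func \<Rightarrow> 'k \<Rightarrow> 'a \<Rightarrow> ('k, 'l, 'o, 'a) ntrans" where
  "transpose X k u = mk_arrow K X (power_diagram k (Cod C u)) (transpose_cmp X k u)"

lemma power_map_simps [simp]:
  assumes "a \<in> Obj C" "g \<in> Arr K"
  shows "power_map k a g \<in> Arr C" (is ?arr) and "Dom C (power_map k a g) = pow (Dom K g) k a" (is ?dom)
    and "Cod C (power_map k a g) = pow (Cod K g) k a" (is ?cod)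
    and "h \<in> Arr K \<Longrightarrow> Dom K h = Cod K g \<Longrightarrow> Cod K h = k \<Longrightarrow>
       pr (Cod K g) k a h \<cdot> power_map k a g = pr (Dom K g) k a (h \<star> g)" (is "_ \<Longrightarrow> _ \<Longrightarrow> _ \<Longrightarrow> ?proj")
proof -
  have "power_map k a g \<in> hom C (pow (Dom K g) k a) (pow (Cod K g) k a) \<and>
     (\<forall>h \<in> hom K (Cod K g) k. pr (Cod K g) k a h \<cdot> power_map k a g
        = pr (Dom K g) k a (h \<star> g))"
    unfolding power_map_def by (rule tuple_props) (use assms in \<open>auto simp: hom_iff\<close>)
  then show ?arr ?dom ?cod "h \<in> Arr K \<Longrightarrow> Dom K h = Cod K g \<Longrightarrow> Cod K h = k \<Longrightarrow> ?proj"
    by (auto simp: hom_iff)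
qed

lemma power_cmp_simps [simp]:
  assumes "p \<in> Arr C"
  shows "power_cmp k p j \<in> Arr C" (is ?arr) and "Dom C (power_cmp k p j) = pow j k (Dom C p)" (is ?dom)
    and "Cod C (power_cmp k p j) = pow j k (Cod C p)" (is ?cod)
    and "h \<in> Arr K \<Longrightarrow> Dom K h = j \<Longrightarrow> Cod K h = k \<Longrightarrow>
       pr j k (Cod C p) h \<cdot> power_cmp k p j = p \<cdot> pr j k (Dom C p) h" (is "_ \<Longrightarrow> _ \<Longrightarrow> _ \<Longrightarrow> ?proj")
proof -
  have "power_cmp k p j \<in> hom C (pow j k (Dom C p)) (pow j k (Cod C p)) \<and>
     (\<forall>h \<in> hom K j k. pr j k (Cod C p) h \<cdot> power_cmp k p j
        = p \<cdot> pr j k (Dom C p) h)"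
    unfolding power_cmp_def by (rule tuple_props) (use assms in \<open>auto simp: hom_iff Dom_in Cod_in\<close>)
  then show ?arr ?dom ?cod "h \<in> Arr K \<Longrightarrow> Dom K h = j \<Longrightarrow> Cod K h = k \<Longrightarrow> ?proj"
    by (auto simp: hom_iff)
qed

lemma transpose_cmp_simps [simp]:
  assumes "X \<in> Obj (diagrams K C)" "u \<in> Arr C" "Dom C u = omap X k" "j \<in> Obj K"
  shows "transpose_cmp X k u j \<in> Arr C" (is ?arr) and "Dom C (transpose_cmp X k u j) = omap X j" (is ?dom)
    and "Cod C (transpose_cmp X k u j) = pow j k (Cod C u)" (is ?cod)
    and "h \<in> Arr K \<Longrightarrow> Dom K h = j \<Longrightarrow> Cod K h = k \<Longrightarrow>
       pr j k (Cod C u) h \<cdot> transpose_cmp X k u j = u \<cdot> amap X h" (is "_ \<Longrightarrow> _ \<Longrightarrow> _ \<Longrightarrow> ?proj")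
proof -
  have "transpose_cmp X k u j \<in> hom C (omap X j) (pow j k (Cod C u)) \<and>
     (\<forall>h \<in> hom K j k. pr j k (Cod C u) h \<cdot> transpose_cmp X k u j = u \<cdot> amap X h)"
    unfolding transpose_cmp_def by (rule tuple_props) (use assms in \<open>auto simp: hom_iff Cod_in\<close>)
  then show ?arr ?dom ?cod "h \<in> Arr K \<Longrightarrow> Dom K h = j \<Longrightarrow> Cod K h = k \<Longrightarrow> ?proj"
    by (auto simp: hom_iff)
qed

lemma power_eqI:
  assumes "a \<in> Obj C" "u \<in> Arr C" "v \<in> Arr C" "Dom C u = Dom C v"
    and "Cod C u = pow j k a" "Cod C v = pow j k a"
    and "\<And>h. \<lbrakk>h \<in> Arr K; Dom K h = j; Cod K h = k\<rbrakk>
      \<Longrightarrow> pr j k a h \<cdot> u = pr j k a h \<cdot> v"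
  shows "u = v"
  by (rule product_arrow_eqI[where I = "hom K j k" and c = "\<lambda>_. a"])
    (use assms in \<open>auto simp: hom_iff\<close>)

lemma power_proj_simps [simp]:
  assumes "a \<in> Obj C" "h \<in> Arr K" "Dom K h = j" "Cod K h = k"
  shows "pr j k a h \<in> Arr C" "Dom C (pr j k a h) = pow j k a"
    "Cod C (pr j k a h) = a"
  using assms by (simp_all add: hom_iff)

lemma Cmp_rewrite:
  assumes "g \<cdot> f = k" "f \<in> Arr C" "g \<in> Arr C" "Cod C f = Dom C g" "v \<in> Arr C" "Cod C v = Dom C f"
  shows "g \<cdot> (f \<cdot> v) = k \<cdot> v"
  using Cmp_assoc_simp[of v f g] assms by simp

lemma power_diagram_Obj [simp]:
  assumes a: "a \<in> Obj C"
  shows "power_diagram k a \<in> Obj (diagrams K C)"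
  unfolding power_diagram_def
proof (rule mk_diagram_Obj[OF K.category_axioms category_axioms])
  fix j assume j: "j \<in> Obj K"
  show "power_map k a (Ide K j) = Ide C (pow j k a)"
    by (rule power_eqI[of a _ _ j k]) (use a j power_map_simps(4)[of a "Ide K j"] in auto)
next
  fix f g assume fg: "f \<in> Arr K" "g \<in> Arr K" "Cod K f = Dom K g"
  show "power_map k a (g \<star> f) = power_map k a g \<cdot> power_map k a f" (is "?l = ?r")
  proof (rule power_eqI[of a _ _ "Cod K g" k])
    fix h assume h: "h \<in> Arr K" "Dom K h = Cod K g" "Cod K h = k"
    have "pr (Cod K g) k a h \<cdot> ?r
        = pr (Dom K g) k a (h \<star> g) \<cdot> power_map k a f"
      by (rule Cmp_rewrite) (use a fg h in auto)
    also have "\<dots> = pr (Dom K f) k a (h \<star> (g \<star> f))"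
      using power_map_simps(4)[of a f "h \<star> g" k] a fg h by simp
    finally show "pr (Cod K g) k a h \<cdot> power_map k a (g \<star> f)
        = pr (Cod K g) k a h \<cdot> ?r"
      using power_map_simps(4)[of a "g \<star> f" h k] a fg h by simp
  qed (use a fg in auto)
qed (use a in \<open>auto simp: hom_iff\<close>)

lemma power_diagram_simps [simp]:
  "j \<in> Obj K \<Longrightarrow> omap (power_diagram k a) j = pow j k a"
  "g \<in> Arr K \<Longrightarrow> amap (power_diagram k a) g = power_map k a g"
  by (simp_all add: power_diagram_def)

lemma power_arrow_simps [simp]:
  "nsrc (power_arrow k p) = power_diagram k (Dom C p)"
  "ntgt (power_arrow k p) = power_diagram k (Cod C p)"
  "j \<in> Obj K \<Longrightarrow> ncmp (power_arrow k p) j = power_cmp k p j"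
  by (simp_all add: power_arrow_def)

lemma power_arrow_hom:
  assumes p: "p \<in> Arr C"
  shows "power_arrow k p \<in> hom (diagrams K C) (power_diagram k (Dom C p)) (power_diagram k (Cod C p))"
  unfolding power_arrow_def
proof (rule mk_arrow_hom)
  note ab = Dom_in[OF p] Cod_in[OF p]
  fix g assume g: "g \<in> Arr K"
  have "power_map k (Cod C p) g \<cdot> power_cmp k p (Dom K g)
      = power_cmp k p (Cod K g) \<cdot> power_map k (Dom C p) g" (is "?l = ?r")
  proof (rule power_eqI[OF ab(2), of _ _ "Cod K g" k])
    fix h assume h: "h \<in> Arr K" "Dom K h = Cod K g" "Cod K h = k"
    have "pr (Cod K g) k (Cod C p) h \<cdot> ?l
        = pr (Dom K g) k (Cod C p) (h \<star> g) \<cdot> power_cmp k p (Dom K g)"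
      by (rule Cmp_rewrite) (use p ab g h in auto)
    also have "\<dots> = p \<cdot> pr (Dom K g) k (Dom C p) (h \<star> g)"
      using p g h by simp
    also have "\<dots> = p \<cdot> (pr (Cod K g) k (Dom C p) h \<cdot> power_map k (Dom C p) g)"
      using p g h ab by simp
    also have "\<dots> = (p \<cdot> pr (Cod K g) k (Dom C p) h) \<cdot> power_map k (Dom C p) g"
      by (rule Cmp_assoc_simp[symmetric]) (use p ab g h in auto)
    also have "\<dots> = pr (Cod K g) k (Cod C p) h \<cdot> ?r"
      by (rule Cmp_rewrite[symmetric]) (use p ab g h in auto)
    finally show "pr (Cod K g) k (Cod C p) h \<cdot> ?l
        = pr (Cod K g) k (Cod C p) h \<cdot> ?r" .
  qed (use p g ab in auto)
  then show "amap (power_diagram k (Cod C p)) g \<cdot> power_cmp k p (Dom K g)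
      = power_cmp k p (Cod K g) \<cdot> amap (power_diagram k (Dom C p)) g"
    using g by simp
qed (use p K.category_axioms in \<open>auto simp: hom_iff Dom_in Cod_in\<close>)

lemma transpose_simps [simp]:
  "nsrc (transpose X k u) = X" "ntgt (transpose X k u) = power_diagram k (Cod C u)"
  "j \<in> Obj K \<Longrightarrow> ncmp (transpose X k u) j = transpose_cmp X k u j"
  by (simp_all add: transpose_def)

lemma transpose_hom:
  assumes X: "X \<in> Obj (diagrams K C)" and u: "u \<in> hom C (omap X k) a"
  shows "transpose X k u \<in> hom (diagrams K C) X (power_diagram k a)"
proof -
  have u': "u \<in> Arr C" "Dom C u = omap X k" "Cod C u = a" and a: "a \<in> Obj C"
    using u hom_Obj[OF u] by (auto simp: hom_iff)
  show ?thesis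
    unfolding transpose_def u'
  proof (rule mk_arrow_hom)
    fix g assume g: "g \<in> Arr K"
    note gK = K.Dom_in[OF g] K.Cod_in[OF g]
    have "power_map k a g \<cdot> transpose_cmp X k u (Dom K g) = transpose_cmp X k u (Cod K g) \<cdot> amap X g" (is "?l = ?r")
    proof (rule power_eqI[OF a, of _ _ "Cod K g" k])
      fix h assume h: "h \<in> Arr K" "Dom K h = Cod K g" "Cod K h = k"
      have "pr (Cod K g) k a h \<cdot> ?l
        = pr (Dom K g) k a (h \<star> g) \<cdot> transpose_cmp X k u (Dom K g)"
        by (rule Cmp_rewrite) (use X g gK h u' a in auto)
      also have "\<dots> = u \<cdot> amap X (h \<star> g)"
        using X g gK h u' a transpose_cmp_simps(4)[OF X u'(1,2) gK(1), of "h \<star> g"] by simp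
      also have "\<dots> = (u \<cdot> amap X h) \<cdot> amap X g"
        unfolding diagram_amap_Cmp[OF X g h(1) h(2)[symmetric]]
        by (rule Cmp_assoc_simp[symmetric]) (use X g h u' in auto)
      also have "\<dots> = pr (Cod K g) k a h \<cdot> ?r"
        using transpose_cmp_simps(4)[OF X u'(1,2) gK(2), of h]
        by (intro Cmp_rewrite[symmetric]) (use X g gK h u' a in auto)
      finally show "pr (Cod K g) k a h \<cdot> ?l
        = pr (Cod K g) k a h \<cdot> ?r" .
    qed (use X g gK u' a in auto)
    then show "amap (power_diagram k a) g \<cdot> transpose_cmp X k u (Dom K g)
        = transpose_cmp X k u (Cod K g) \<cdot> amap X g"
      using g by simp
  qed (use X u' a K.category_axioms in \<open>auto simp: hom_iff\<close>)
qed

lemma proj_Ide_transpose: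
  assumes X: "X \<in> Obj (diagrams K C)" and k: "k \<in> Obj K" and u: "u \<in> hom C (omap X k) a"
  shows "pr k k a (Ide K k) \<cdot> ncmp (transpose X k u) k = u"
proof -
  have u': "u \<in> Arr C" "Dom C u = omap X k" "Cod C u = a"
    using u by (auto simp: hom_iff)
  show ?thesis
    using transpose_cmp_simps(4)[OF X u'(1,2) k, of "Ide K k"] k u' X by simp
qed

text \<open>
  The Yoneda lemma in this setting: by naturality, the component of \<open>T\<^sub>j\<close> at \<open>h : j \<rightarrow> k\<close> is the composite
  of \<open>X h\<close> with the component of \<open>T\<^sub>k\<close> at the identity of \<open>k\<close>.
\<close>

lemma power_diagram_arrow_eqI:
  assumes S: "S \<in> hom (diagrams K C) X (power_diagram k a)" and T: "T \<in> hom (diagrams K C) X (power_diagram k a)"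
    and k: "k \<in> Obj K" and a: "a \<in> Obj C"
    and eq: "pr k k a (Ide K k) \<cdot> ncmp S k = pr k k a (Ide K k) \<cdot> ncmp T k"
  shows "S = T"
proof (rule diagram_arrow_eqI[OF S T])
  fix j assume j: "j \<in> Obj K"
  have X: "X \<in> Obj (diagrams K C)" using diagrams.hom_Obj[OF S] by simp
  have *: "pr j k a h \<cdot> ncmp T j = (pr k k a (Ide K k) \<cdot> ncmp T k) \<cdot> amap X h"
    if T: "T \<in> hom (diagrams K C) X (power_diagram k a)" and h: "h \<in> Arr K" "Dom K h = j" "Cod K h = k" for T h
  proof -
    have TA: "ncmp T i \<in> Arr C" "Dom C (ncmp T i) = omap X i" "Cod C (ncmp T i) = pow i k a"
      if "i \<in> Obj K" for i
      using diagram_component[OF T that] that by (auto simp: hom_iff)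
    have "pr j k a h \<cdot> ncmp T j = pr k k a (Ide K k) \<cdot> (power_map k a h \<cdot> ncmp T j)"
      using power_map_simps(4)[OF a h(1), of "Ide K k"] h j k a TA[OF j]
      by (intro Cmp_rewrite[symmetric]) auto
    also have "\<dots> = pr k k a (Ide K k) \<cdot> (ncmp T k \<cdot> amap X h)"
      using diagram_natural[OF T h(1)] h by simp
    also have "\<dots> = (pr k k a (Ide K k) \<cdot> ncmp T k) \<cdot> amap X h"
      by (rule Cmp_assoc_simp[symmetric]) (use X h k a TA[OF k] in auto)
    finally show ?thesis .
  qed
  show "ncmp S j = ncmp T j"
    by (rule power_eqI[OF a, of _ _ j k])
      (use *[OF S] *[OF T] eq diagram_component[OF S j] diagram_component[OF T j] j in \<open>auto simp: hom_iff\<close>)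
qed

text \<open>
  As for any adjunction, a square from \<open>s\<^sub>k\<close> to \<open>p\<close> transposes to a square from \<open>s\<close> to the map of power
  diagrams. Its diagonal \<open>H\<close> gives a diagonal of the original square by projecting \<open>H\<^sub>k\<close> to the factor
  of the identity of \<open>k\<close>.
\<close>

lemma has_lifting_component:
  assumes s: "s \<in> Arr (diagrams K C)" and p: "p \<in> Arr C" and k: "k \<in> Obj K"
    and lift: "has_lifting (diagrams K C) s (power_arrow k p)"
  shows "has_lifting C (ncmp s k) p"
proof (rule has_liftingI)
  let ?X = "nsrc s" and ?Y = "ntgt s" and ?pr = "pr k k (Dom C p) (Ide K k)"
  have s': "s \<in> hom (diagrams K C) ?X ?Y"
    using in_hom_Dom_Cod[OF s] by simp
  note XY = diagram_Arr_Obj[OF s] and sk = diagram_Arr_simps[OF s k]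
  fix u v assume "u \<in> hom C (Dom C (ncmp s k)) (Dom C p)" "v \<in> hom C (Cod C (ncmp s k)) (Cod C p)"
    and eq: "p \<cdot> u = v \<cdot> ncmp s k"
  then have u: "u \<in> hom C (omap ?X k) (Dom C p)" and v: "v \<in> hom C (omap ?Y k) (Cod C p)"
    using sk by auto
  note U = transpose_hom[OF XY(1) u] and V = transpose_hom[OF XY(2) v]
  note pU = proj_Ide_transpose[OF XY(1) k u] and pV = proj_Ide_transpose[OF XY(2) k v]
  have pr: "?pr \<in> Arr C" "Dom C ?pr = pow k k (Dom C p)" "Cod C ?pr = Dom C p"
    using k p by (simp_all add: Dom_in)
  have pr_power: "pr k k (Cod C p) (Ide K k) \<cdot> (power_cmp k p k \<cdot> w) = p \<cdot> (?pr \<cdot> w)"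
    if "w \<in> Arr C" "Cod C w = pow k k (Dom C p)" for w
  proof -
    have "pr k k (Cod C p) (Ide K k) \<cdot> (power_cmp k p k \<cdot> w) = (p \<cdot> ?pr) \<cdot> w"
      by (rule Cmp_rewrite) (use that k p in \<open>auto simp: Cod_in\<close>)
    then show ?thesis using that pr p by simp
  qed
  have Uk: "transpose_cmp ?X k u k \<in> Arr C" "Cod C (transpose_cmp ?X k u k) = pow k k (Dom C p)"
    and Vk: "transpose_cmp ?Y k v k \<in> Arr C" "Dom C (transpose_cmp ?Y k v k) = omap ?Y k"
      "Cod C (transpose_cmp ?Y k v k) = pow k k (Cod C p)"
    using XY u v k by (auto simp: hom_iff)
  have "power_arrow k p \<cdot>\<^bsub>diagrams K C\<^esub> transpose ?X k u = transpose ?Y k v \<cdot>\<^bsub>diagrams K C\<^esub> s"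
  proof (rule power_diagram_arrow_eqI[OF diagrams.Cmp_hom[OF U power_arrow_hom[OF p]] diagrams.Cmp_hom[OF s' V] k])
    have "pr k k (Cod C p) (Ide K k) \<cdot> (transpose_cmp ?Y k v k \<cdot> ncmp s k) = v \<cdot> ncmp s k"
      by (rule Cmp_rewrite) (use pV Vk sk k p in \<open>auto simp: Cod_in\<close>)
    then show "pr k k (Cod C p) (Ide K k) \<cdot> ncmp (power_arrow k p \<cdot>\<^bsub>diagrams K C\<^esub> transpose ?X k u) k
        = pr k k (Cod C p) (Ide K k) \<cdot> ncmp (transpose ?Y k v \<cdot>\<^bsub>diagrams K C\<^esub> s) k"
      using pr_power[OF Uk] pU eq k by simp
  qed (use p in \<open>simp add: Cod_in\<close>)
  then obtain H where H: "H \<in> hom (diagrams K C) (Cod (diagrams K C) s) (Dom (diagrams K C) (power_arrow k p))"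
    and Hs: "H \<cdot>\<^bsub>diagrams K C\<^esub> s = transpose ?X k u"
    and pH: "power_arrow k p \<cdot>\<^bsub>diagrams K C\<^esub> H = transpose ?Y k v"
    by (rule has_liftingE[OF lift]) (use U V in simp_all)
  have Hk: "ncmp H k \<in> Arr C" "Dom C (ncmp H k) = omap ?Y k" "Cod C (ncmp H k) = pow k k (Dom C p)"
    using diagram_component[OF H k] k by (simp_all add: hom_iff)
  show "\<exists>h \<in> hom C (Cod C (ncmp s k)) (Dom C p). h \<cdot> ncmp s k = u \<and> p \<cdot> h = v"
  proof (intro bexI conjI)
    show "(?pr \<cdot> ncmp H k) \<cdot> ncmp s k = u"
      using pU Hs[symmetric] k Hk pr sk by simp
    show "p \<cdot> (?pr \<cdot> ncmp H k) = v"
      using pV pH[symmetric] pr_power[OF Hk(1,3)] k by simp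
    show "?pr \<cdot> ncmp H k \<in> hom C (Cod C (ncmp s k)) (Dom C p)"
      using Hk pr sk by (simp add: hom_iff)
  qed
qed

lemma has_lifting_power_cmp:
  assumes "p \<in> Arr C" "s \<in> Arr C" "has_lifting C s p"
  shows "has_lifting C s (power_cmp k p j)"
  by (rule has_lifting_product[where I = "hom K j k" and c = "\<lambda>_. Dom C p" and c' = "\<lambda>_. Cod C p"
        and f = "\<lambda>_. p"])
    (use assms in \<open>auto simp: hom_iff Dom_in Cod_in\<close>)

text \<open>
  Evaluation at \<open>k\<close> is a left adjoint: arrows \<open>X\<^sub>k \<rightarrow> a\<close> are determined by arrows from \<open>X\<close> to a power
  diagram.
\<close>

lemma initial_diagram_pointwise:
  assumes X: "is_initial (diagrams K C) X" and k: "k \<in> Obj K"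
  shows "is_initial C (omap X k)"
  unfolding is_initial_def
proof (intro conjI ballI)
  have XO: "X \<in> Obj (diagrams K C)" using X by (simp add: is_initial_def)
  then show "omap X k \<in> Obj C" using k by simp
  fix a assume a: "a \<in> Obj C"
  have "\<exists>!T. T \<in> hom (diagrams K C) X (power_diagram k a)"
    using X a by (simp add: is_initial_def)
  then obtain T where T: "T \<in> hom (diagrams K C) X (power_diagram k a)"
    and uniq: "\<And>T'. T' \<in> hom (diagrams K C) X (power_diagram k a) \<Longrightarrow> T' = T"
    by (elim ex1E) blast
  have "u = pr k k a (Ide K k) \<cdot> ncmp T k" if "u \<in> hom C (omap X k) a" for u
    using proj_Ide_transpose[OF XO k that] uniq[OF transpose_hom[OF XO that]] by simp
  moreover have "pr k k a (Ide K k) \<cdot> ncmp T k \<in> hom C (omap X k) a"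
    using diagram_component[OF T k] a k by (simp add: hom_iff)
  ultimately show "\<exists>!u. u \<in> hom C (omap X k) a"
    by blast
qed

end

section \<open>Power diagrams over Reedy categories\<close>

locale reedy_power_diagrams = power_diagrams K C P \<pi> + reedy_category K R
  for K :: "('k, 'l) cat" and R :: "('k, 'l, 'd::wellorder) reedy_str"
    and C :: "('o, 'a) cat" (structure)
    and P :: "'l set \<Rightarrow> ('l \<Rightarrow> 'o) \<Rightarrow> 'o" and \<pi> :: "'l set \<Rightarrow> ('l \<Rightarrow> 'o) \<Rightarrow> 'l \<Rightarrow> 'a"
begin

text \<open>
  By \<open>boundary_factorize\<close>, these are the maps whose Reedy factorization has a nonidentity
  degree-lowering part. Here \<open>h\<close> is arbitrary, so that membership is easy to establish.
\<close>

definition boundary :: "'k \<Rightarrow> 'k \<Rightarrow> 'l set" where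
  "boundary j k = {h \<star> g | g h. g \<in> down R \<and> Dom K g = j \<and> g \<noteq> Ide K j \<and> h \<in> hom K (Cod K g) k}"

lemma boundaryI:
  "\<lbrakk>g \<in> down R; Dom K g = j; g \<noteq> Ide K j; h \<in> Arr K; Dom K h = Cod K g; Cod K h = k\<rbrakk>
     \<Longrightarrow> h \<star> g \<in> boundary j k"
  by (auto simp: boundary_def hom_iff)

text \<open>
  The composite of a nonidentity degree-lowering map with another degree-lowering map still strictly
  lowers the degree.
\<close>

lemma down_Cmp_not_Ide:
  assumes "g \<in> down R" "g \<noteq> Ide K (Dom K g)" "e \<in> down R" "Cod K g = Dom K e"
  shows "e \<star> g \<in> down R" "e \<star> g \<noteq> Ide K (Dom K g)"
proof -
  have A: "e \<in> Arr K" "g \<in> Arr K" using assms down_Arr by auto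
  show "e \<star> g \<in> down R" using assms down_Cmp by auto
  have "deg R (Cod K e) \<le> deg R (Cod K g)"
    using down_lowers[OF assms(3)] assms(4) A K.Ide_simps(3)[OF K.Dom_in[OF A(1)]] by force
  also have "deg R (Cod K g) < deg R (Dom K g)"
    by (rule down_lowers[OF assms(1,2)])
  finally have "Cod K (e \<star> g) \<noteq> Dom K g"
    using A assms(4) by auto
  then show "e \<star> g \<noteq> Ide K (Dom K g)"
    using K.Ide_simps(3)[OF K.Dom_in[OF A(2)]] by auto
qed

lemma factorize:
  assumes "f \<in> Arr K"
  obtains h g where "h \<in> up R" "g \<in> down R" "Cod K g = Dom K h" "f = h \<star> g"
  using factorization[OF assms] by (auto elim!: ex1E)

lemma factorization_unique:
  assumes "h \<in> up R" "g \<in> down R" "Cod K g = Dom K h"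
    and "h' \<in> up R" "g' \<in> down R" "Cod K g' = Dom K h'" "h \<star> g = h' \<star> g'"
  shows "h = h' \<and> g = g'"
proof -
  have "h \<in> Arr K" "g \<in> Arr K" using assms up_Arr down_Arr by auto
  then have "h \<star> g \<in> Arr K" using assms(3) by simp
  from factorization[OF this] obtain z where
    z: "\<And>y. (case y of (h', g') \<Rightarrow> h' \<in> up R \<and> g' \<in> down R \<and> Cod K g' = Dom K h' \<and> h \<star> g = h' \<star> g')
      \<Longrightarrow> y = z"
    by (elim ex1E) blast
  show ?thesis
    using z[of "(h, g)"] z[of "(h', g')"] assms by auto
qed

text \<open>
  Given \<open>f = h \<star> g\<close> with \<open>g\<close> lowering the degree, the degree-lowering part \<open>e\<close> of \<open>h\<close> can be absorbed
  into \<open>g\<close>.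
\<close>

lemma boundary_factorize:
  assumes "f \<in> boundary j k"
  obtains h g where "h \<in> up R" "g \<in> down R" "Dom K g = j" "g \<noteq> Ide K j" "Cod K g = Dom K h"
    "Cod K h = k" "f = h \<star> g"
proof -
  obtain g h where gh: "g \<in> down R" "Dom K g = j" "g \<noteq> Ide K j" "h \<in> Arr K" "Dom K h = Cod K g"
    "Cod K h = k" "f = h \<star> g"
    using assms by (auto simp: boundary_def hom_iff)
  obtain h' e where h'e: "h' \<in> up R" "e \<in> down R" "Cod K e = Dom K h'" "h = h' \<star> e"
    by (rule factorize[OF gh(4)])
  have A: "g \<in> Arr K" "e \<in> Arr K" "h' \<in> Arr K"
    using gh h'e up_Arr down_Arr by auto
  have ge: "Cod K g = Dom K e"
    using gh h'e A by simp
  show thesis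
    by (rule that[of h' "e \<star> g"])
      (use gh h'e A ge down_Cmp_not_Ide[of g e] in auto)
qed

lemma boundary_subset: "boundary j k \<subseteq> hom K j k"
  using down_Arr by (auto simp: boundary_def hom_iff)

definition matching_leg :: "'k \<Rightarrow> 'k \<Rightarrow> 'o \<Rightarrow> 'l \<Rightarrow> 'a" where
  "matching_leg j k a g = tuple (hom K (Cod K g) k) (\<lambda>_. a) (P (boundary j k) (\<lambda>_. a))
     (\<lambda>h. \<pi> (boundary j k) (\<lambda>_. a) (h \<star> g))"

lemma matching_leg_simps:
  assumes "a \<in> Obj C" "g \<in> down R" "Dom K g = j" "g \<noteq> Ide K j"
  shows "matching_leg j k a g \<in> Arr C" (is ?arr)
    and "Dom C (matching_leg j k a g) = P (boundary j k) (\<lambda>_. a)" (is ?dom)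
    and "Cod C (matching_leg j k a g) = pow (Cod K g) k a" (is ?cod)
    and "h \<in> Arr K \<Longrightarrow> Dom K h = Cod K g \<Longrightarrow> Cod K h = k \<Longrightarrow>
       pr (Cod K g) k a h \<cdot> matching_leg j k a g = \<pi> (boundary j k) (\<lambda>_. a) (h \<star> g)" (is "_ \<Longrightarrow> _ \<Longrightarrow> _ \<Longrightarrow> ?proj")
proof -
  have "h \<star> g \<in> boundary j k" if "h \<in> hom K (Cod K g) k" for h
    using that assms by (auto simp: boundary_def)
  then have "matching_leg j k a g \<in> hom C (P (boundary j k) (\<lambda>_. a)) (pow (Cod K g) k a) \<and>
     (\<forall>h \<in> hom K (Cod K g) k. pr (Cod K g) k a h \<cdot> matching_leg j k a g
        = \<pi> (boundary j k) (\<lambda>_. a) (h \<star> g))"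
    unfolding matching_leg_def by (intro tuple_props) (use assms in auto)
  then show ?arr ?dom ?cod "h \<in> Arr K \<Longrightarrow> Dom K h = Cod K g \<Longrightarrow> Cod K h = k \<Longrightarrow> ?proj"
    by (auto simp: hom_iff)
qed

text \<open>
  The leg at \<open>g\<close> restricts a family indexed by the boundary along \<open>h \<mapsto> h \<star> g\<close>. A cone \<open>\<delta>\<close> determines a
  family on the boundary: its member at \<open>f = h \<star> g\<close> is the component of \<open>\<delta> g\<close> at \<open>h\<close>. This does not depend
  on the way in which \<open>f\<close> is written, because by naturality of \<open>\<delta>\<close> any such \<open>h\<close> and \<open>g\<close> can be replaced
  by the Reedy factorization of \<open>f\<close>, which is unique.
\<close>

lemma matching_object_power_diagram:
  assumes a: "a \<in> Obj C"
  shows "is_limit (matching_category K R j) C (matching_diagram K (power_diagram k a))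
    (P (boundary j k) (\<lambda>_. a)) (matching_leg j k a)"
proof -
  let ?J = "matching_category K R j" and ?X = "matching_diagram K (power_diagram k a)"
  let ?M = "P (boundary j k) (\<lambda>_. a)" and ?q = "\<pi> (boundary j k) (\<lambda>_. a)"
  have X_omap: "omap ?X g = pow (Cod K g) k a" if "g \<in> down R" for g
    using that down_Arr by (simp add: matching_diagram_def K.Cod_in subset_iff)
  have X_amap: "amap ?X (e, g) = power_map k a e" if "e \<in> down R" for e g
    using that down_Arr by (simp add: matching_diagram_def subset_iff)
  have q: "?q f \<in> Arr C" "Dom C (?q f) = ?M" "Cod C (?q f) = a" if "f \<in> boundary j k" for f
    using that a by simp_all
  have cone: "is_cone ?J C ?X ?M (matching_leg j k a)"
    unfolding is_cone_def
  proof (intro conjI ballI)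
    show "?M \<in> Obj C" using a by simp
    show "matching_leg j k a g \<in> hom C ?M (omap ?X g)" if "g \<in> Obj ?J" for g
      using that matching_leg_simps(1-3)[OF a, of g j k] by (simp add: X_omap hom_iff)
    fix x assume x: "x \<in> Arr ?J"
    obtain e g where [simp]: "x = (e, g)" by (cases x)
    have eg: "e \<in> down R" "g \<in> down R" "Cod K g = Dom K e" "Dom K g = j" "g \<noteq> Ide K j"
      "e \<star> g \<noteq> Ide K j" "e \<in> Arr K" "g \<in> Arr K" "e \<star> g \<in> down R"
      using x down_Arr down_Cmp by auto
    note leg = matching_leg_simps[OF a eg(2,4,5), where k = k]
    have leg': "matching_leg j k a (e \<star> g) \<in> Arr C"
      "Dom C (matching_leg j k a (e \<star> g)) = ?M"
      "Cod C (matching_leg j k a (e \<star> g)) = pow (Cod K e) k a"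
      "\<And>h. h \<in> Arr K \<Longrightarrow> Dom K h = Cod K e \<Longrightarrow> Cod K h = k \<Longrightarrow>
         pr (Cod K e) k a h \<cdot> matching_leg j k a (e \<star> g) = ?q (h \<star> (e \<star> g))"
      using matching_leg_simps[OF a eg(9) _ eg(6), where k = k] eg by auto
    have "power_map k a e \<cdot> matching_leg j k a g = matching_leg j k a (e \<star> g)" (is "?l = ?r")
    proof (rule power_eqI[OF a, of _ _ "Cod K e" k])
      fix h assume h: "h \<in> Arr K" "Dom K h = Cod K e" "Cod K h = k"
      have "pr (Cod K e) k a h \<cdot> ?l
          = pr (Dom K e) k a (h \<star> e) \<cdot> matching_leg j k a g"
        by (rule Cmp_rewrite) (use a eg h leg in auto)
      also have "\<dots> = ?q ((h \<star> e) \<star> g)"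
        using leg(4)[of "h \<star> e"] eg h by (simp del: K.Cmp_assoc_simp)
      finally show "pr (Cod K e) k a h \<cdot> ?l
          = pr (Cod K e) k a h \<cdot> matching_leg j k a (e \<star> g)"
        using leg'(4)[OF h] eg h by simp
    qed (use a eg leg leg' in auto)
    then show "amap ?X x \<cdot> matching_leg j k a (Dom ?J x) = matching_leg j k a (Cod ?J x)"
      using eg by (simp add: X_amap)
  qed
  moreover have "\<exists>!u. u \<in> hom C d ?M \<and> (\<forall>g \<in> Obj ?J. matching_leg j k a g \<cdot> u = \<delta> g)"
    if \<delta>: "is_cone ?J C ?X d \<delta>" for d \<delta>
  proof -
    have d: "d \<in> Obj C" using \<delta> by (simp add: is_cone_def)
    have \<delta>_hom: "\<delta> g \<in> Arr C" "Dom C (\<delta> g) = d" "Cod C (\<delta> g) = pow (Cod K g) k a"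
      if "g \<in> down R" "Dom K g = j" "g \<noteq> Ide K j" for g
      using \<delta> that by (auto simp: is_cone_def X_omap hom_iff)
    have \<delta>_nat: "power_map k a e \<cdot> \<delta> g = \<delta> (e \<star> g)"
      if "e \<in> down R" "g \<in> down R" "Cod K g = Dom K e" "Dom K g = j" "g \<noteq> Ide K j" for e g
    proof -
      have "(e, g) \<in> Arr ?J" using that down_Cmp_not_Ide[of g e] by simp
      then have "amap ?X (e, g) \<cdot> \<delta> (Dom ?J (e, g)) = \<delta> (Cod ?J (e, g))"
        using \<delta> unfolding is_cone_def by blast
      then show ?thesis using that by (simp add: X_amap)
    qed
    \<comment> \<open>The family \<open>v\<close> is first defined by Reedy factorizations only; \<open>v_hg\<close> then computes it from an
    arbitrary factorization through a degree-lowering map.\<close>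
    have "\<exists>v. \<forall>h g. h \<in> up R \<longrightarrow> g \<in> down R \<longrightarrow> Dom K g = j \<longrightarrow> g \<noteq> Ide K j \<longrightarrow> Cod K g = Dom K h \<longrightarrow>
        Cod K h = k \<longrightarrow> f = h \<star> g \<longrightarrow> v = pr (Cod K g) k a h \<cdot> \<delta> g"
      if f: "f \<in> boundary j k" for f
    proof -
      obtain h g where hg: "h \<in> up R" "g \<in> down R" "Dom K g = j" "g \<noteq> Ide K j" "Cod K g = Dom K h"
        "Cod K h = k" "f = h \<star> g"
        by (rule boundary_factorize[OF f])
      show ?thesis
        by (rule exI[of _ "pr (Cod K g) k a h \<cdot> \<delta> g"])
          (intro allI impI; use factorization_unique[OF hg(1,2,5)] hg(7) in metis)
    qed
    then obtain v where v: "\<And>h g. \<lbrakk>h \<in> up R; g \<in> down R; Dom K g = j; g \<noteq> Ide K j; Cod K g = Dom K h;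
        Cod K h = k; h \<star> g \<in> boundary j k\<rbrakk> \<Longrightarrow> v (h \<star> g) = pr (Cod K g) k a h \<cdot> \<delta> g"
      by metis
    have v_hg: "v (h \<star> g) = pr (Cod K g) k a h \<cdot> \<delta> g"
      if g: "g \<in> down R" "Dom K g = j" "g \<noteq> Ide K j" and h: "h \<in> Arr K" "Dom K h = Cod K g" "Cod K h = k" for h g
    proof -
      obtain h' e where h'e: "h' \<in> up R" "e \<in> down R" "Cod K e = Dom K h'" "h = h' \<star> e"
        by (rule factorize[OF h(1)])
      have A: "g \<in> Arr K" "e \<in> Arr K" "h' \<in> Arr K"
        using g h'e up_Arr down_Arr by auto
      have ge: "Cod K g = Dom K e" and h': "Cod K h' = k"
        using g h h'e A by auto
      have eg: "e \<star> g \<in> down R" "e \<star> g \<noteq> Ide K j" "Dom K (e \<star> g) = j" "Cod K (e \<star> g) = Dom K h'"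
        using down_Cmp_not_Ide[of g e] g h'e ge A by auto
      have "v (h' \<star> (e \<star> g)) = pr (Cod K (e \<star> g)) k a h' \<cdot> \<delta> (e \<star> g)"
        by (intro v boundaryI) (use eg h'e h' A in auto)
      also have "\<dots> = pr (Cod K e) k a h' \<cdot> (power_map k a e \<cdot> \<delta> g)"
        using \<delta>_nat[OF h'e(2) g(1) ge g(2,3)] A ge by simp
      also have "\<dots> = pr (Dom K e) k a (h' \<star> e) \<cdot> \<delta> g"
        by (rule Cmp_rewrite) (use a A ge h' h'e \<delta>_hom[OF g] power_map_simps(4)[of a e h' k] in auto)
      finally show ?thesis
        using h'e A ge by simp
    qed
    have v_hom: "v f \<in> Arr C" "Dom C (v f) = d" "Cod C (v f) = a" if f: "f \<in> boundary j k" for f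
    proof -
      obtain h g where hg: "h \<in> up R" "g \<in> down R" "Dom K g = j" "g \<noteq> Ide K j" "Cod K g = Dom K h"
        "Cod K h = k" "f = h \<star> g"
        by (rule boundary_factorize[OF f])
      then have "v f = pr (Cod K g) k a h \<cdot> \<delta> g" and "h \<in> Arr K"
        using v_hg[of g h] up_Arr by auto
      then show "v f \<in> Arr C" "Dom C (v f) = d" "Cod C (v f) = a"
        using \<delta>_hom[OF hg(2,3,4)] hg a by auto
    qed
    obtain u where u: "u \<in> Arr C" "Dom C u = d" "Cod C u = ?M" "\<And>f. f \<in> boundary j k \<Longrightarrow> ?q f \<cdot> u = v f"
      by (rule that[of "tuple (boundary j k) (\<lambda>_. a) d v"]) (use a d v_hom in auto)
    show ?thesis
    proof (rule ex1I[of _ u], intro conjI ballI)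
      show "u \<in> hom C d ?M" using u by (simp add: hom_iff)
      fix g assume "g \<in> Obj ?J"
      then have g: "g \<in> down R" "Dom K g = j" "g \<noteq> Ide K j" by auto
      note leg = matching_leg_simps[OF a g, where k = k]
      show "matching_leg j k a g \<cdot> u = \<delta> g" (is "?l = ?r")
      proof (rule power_eqI[OF a, of _ _ "Cod K g" k])
        fix h assume h: "h \<in> Arr K" "Dom K h = Cod K g" "Cod K h = k"
        have "h \<star> g \<in> boundary j k"
          using g h by (intro boundaryI)
        moreover have "pr (Cod K g) k a h \<cdot> ?l = ?q (h \<star> g) \<cdot> u"
          by (rule Cmp_rewrite) (use a h u leg in auto)
        ultimately show "pr (Cod K g) k a h \<cdot> ?l
            = pr (Cod K g) k a h \<cdot> \<delta> g"
          using u(4) v_hg[OF g h] by simp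
      qed (use u leg \<delta>_hom[OF g] in auto)
    next
      fix u' assume u': "u' \<in> hom C d ?M \<and> (\<forall>g \<in> Obj ?J. matching_leg j k a g \<cdot> u' = \<delta> g)"
      show "u' = u"
      proof (rule product_eqI[where I = "boundary j k" and c = "\<lambda>_. a" and d = d])
        fix f assume f: "f \<in> boundary j k"
        obtain h g where hg: "h \<in> up R" "g \<in> down R" "Dom K g = j" "g \<noteq> Ide K j" "Cod K g = Dom K h"
          "Cod K h = k" "f = h \<star> g"
          by (rule boundary_factorize[OF f])
        then have h: "h \<in> Arr K" "Dom K h = Cod K g" "Cod K h = k" using up_Arr by auto
        note leg = matching_leg_simps[OF a hg(2,3,4), where k = k]
        have "pr (Cod K g) k a h \<cdot> (matching_leg j k a g \<cdot> u') = ?q (h \<star> g) \<cdot> u'"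
          by (rule Cmp_rewrite) (use a h u' leg in \<open>auto simp: hom_iff\<close>)
        then show "?q f \<cdot> u' = ?q f \<cdot> u"
          using u(4)[OF f] v_hg[OF hg(2,3,4) h] u' hg by simp
      qed (use a u u' in \<open>auto simp: hom_iff\<close>)
    qed
  qed
  ultimately show ?thesis
    by (simp add: is_limit_def)
qed

text \<open>
  Let \<open>H\<close> be the set of maps \<open>j \<rightarrow> k\<close> and \<open>B \<subseteq> H\<close> the boundary. The matching objects are \<open>a\<^sup>B\<close> and \<open>b\<^sup>B\<close>, so the
  pullback of \<open>b\<^sup>H \<rightarrow> b\<^sup>B \<leftarrow> a\<^sup>B\<close> is the product \<open>Q\<close> over \<open>f \<in> H\<close> of \<open>a\<close> if \<open>f \<in> B\<close> and of \<open>b\<close> otherwise. The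
  relative matching map \<open>u : a\<^sup>H \<rightarrow> Q\<close> is the product of identities over \<open>B\<close> and of copies of \<open>p\<close> over
  the complement, so that it inherits all right lifting properties of \<open>p\<close>.
\<close>

lemma relative_matching_map_power_arrow:
  assumes p: "p \<in> Arr C" and j: "j \<in> Obj K"
  shows "\<exists>u \<in> Arr C. relative_matching_map K R C (power_arrow k p) j u \<and>
    (\<forall>s \<in> Arr C. has_lifting C s p \<longrightarrow> has_lifting C s u)"
proof -
  define a b H B where "a = Dom C p" and "b = Cod C p" and H_def: "H = hom K j k" and B_def: "B = boundary j k"
  have a: "a \<in> Obj C" and b: "b \<in> Obj C" and p': "p \<in> Arr C" "Dom C p = a" "Cod C p = b"
    using p by (auto simp: a_def b_def Dom_in Cod_in)
  have BH: "f \<in> H" if "f \<in> B" for f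
    using boundary_subset that by (auto simp: H_def B_def)
  define c where "c f = (if f \<in> B then a else b)" for f
  have c: "c f \<in> Obj C" for f using a b by (simp add: c_def)
  define Xa Xb Ma Mb Q where X_def: "Xa = P H (\<lambda>_. a)" "Xb = P H (\<lambda>_. b)"
    and M_def: "Ma = P B (\<lambda>_. a)" "Mb = P B (\<lambda>_. b)" and Q_def: "Q = P H c"
  define xa xb ma mb q where x_def: "xa = \<pi> H (\<lambda>_. a)" "xb = \<pi> H (\<lambda>_. b)"
    and m_def: "ma = \<pi> B (\<lambda>_. a)" "mb = \<pi> B (\<lambda>_. b)" and q_def: "q = \<pi> H c"
  note defs = X_def M_def Q_def x_def m_def q_def
  have obj: "Xa \<in> Obj C" "Xb \<in> Obj C" "Ma \<in> Obj C" "Mb \<in> Obj C" "Q \<in> Obj C"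
    using a b c by (simp_all add: defs)
  have proj: "f \<in> H \<Longrightarrow> xa f \<in> Arr C" "f \<in> H \<Longrightarrow> Dom C (xa f) = Xa" "f \<in> H \<Longrightarrow> Cod C (xa f) = a"
    "f \<in> H \<Longrightarrow> xb f \<in> Arr C" "f \<in> H \<Longrightarrow> Dom C (xb f) = Xb" "f \<in> H \<Longrightarrow> Cod C (xb f) = b"
    "f \<in> B \<Longrightarrow> ma f \<in> Arr C" "f \<in> B \<Longrightarrow> Dom C (ma f) = Ma" "f \<in> B \<Longrightarrow> Cod C (ma f) = a"
    "f \<in> B \<Longrightarrow> mb f \<in> Arr C" "f \<in> B \<Longrightarrow> Dom C (mb f) = Mb" "f \<in> B \<Longrightarrow> Cod C (mb f) = b"
    "f \<in> H \<Longrightarrow> q f \<in> Arr C" "f \<in> H \<Longrightarrow> Dom C (q f) = Q" "f \<in> H \<Longrightarrow> Cod C (q f) = c f" for f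
    using a b c by (simp_all add: defs)
  note eq_Xb = product_arrow_eqI[where I = H and c = "\<lambda>_. b", OF b, folded defs]
    and eq_Q = product_arrow_eqI[where I = H and c = c, OF c, folded defs]
    and eq_Ma = product_arrow_eqI[where I = B and c = "\<lambda>_. a", OF a, folded defs]
    and eq_Mb = product_arrow_eqI[where I = B and c = "\<lambda>_. b", OF b, folded defs]
  have ex: "\<exists>t. t \<in> Arr C \<and> Dom C t = d \<and> Cod C t = P I e \<and> (\<forall>i \<in> I. \<pi> I e i \<cdot> t = \<delta> i)"
    if "d \<in> Obj C" "\<And>i. i \<in> I \<Longrightarrow> e i \<in> Obj C" "\<And>i. i \<in> I \<Longrightarrow> \<delta> i \<in> Arr C \<and> Dom C (\<delta> i) = d \<and> Cod C (\<delta> i) = e i"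
    for d I e \<delta>
    by (rule exI[of _ "tuple I e d \<delta>"]) (use that in auto)

  \<comment> \<open>\<open>m\<close> and \<open>m'\<close> are the matching maps, \<open>l\<close> is the map of matching objects induced by \<open>p\<close>, and \<open>r\<close>, \<open>s\<close>
  are the legs of the pullback.\<close>
  obtain m where m: "m \<in> Arr C" "Dom C m = Xa" "Cod C m = Ma" "\<And>f. f \<in> B \<Longrightarrow> ma f \<cdot> m = xa f"
    using ex[of Xa B "\<lambda>_. a" xa] a obj proj BH by (auto simp: M_def m_def)
  obtain m' where m': "m' \<in> Arr C" "Dom C m' = Xb" "Cod C m' = Mb" "\<And>f. f \<in> B \<Longrightarrow> mb f \<cdot> m' = xb f"
    using ex[of Xb B "\<lambda>_. b" xb] b obj proj BH by (auto simp: M_def m_def)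
  obtain l where l: "l \<in> Arr C" "Dom C l = Ma" "Cod C l = Mb" "\<And>f. f \<in> B \<Longrightarrow> mb f \<cdot> l = p \<cdot> ma f"
    using ex[of Ma B "\<lambda>_. b" "\<lambda>f. p \<cdot> ma f"] b p' obj proj by (auto simp: M_def m_def)
  have "(if f \<in> B then p \<cdot> q f else q f) \<in> Arr C \<and> Dom C (if f \<in> B then p \<cdot> q f else q f) = Q \<and>
      Cod C (if f \<in> B then p \<cdot> q f else q f) = b" if "f \<in> H" for f
    using p' proj(13-15)[OF that] by (auto simp: c_def)
  then obtain r where r: "r \<in> Arr C" "Dom C r = Q" "Cod C r = Xb"
    "\<And>f. f \<in> H \<Longrightarrow> xb f \<cdot> r = (if f \<in> B then p \<cdot> q f else q f)"
    using ex[of Q H "\<lambda>_. b" "\<lambda>f. if f \<in> B then p \<cdot> q f else q f"] b obj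
    by (auto simp: X_def x_def)
  obtain s where s: "s \<in> Arr C" "Dom C s = Q" "Cod C s = Ma" "\<And>f. f \<in> B \<Longrightarrow> ma f \<cdot> s = q f"
    using ex[of Q B "\<lambda>_. a" q] a obj proj BH by (auto simp: M_def m_def c_def)
  have "(if f \<in> B then xa f else p \<cdot> xa f) \<in> Arr C \<and> Dom C (if f \<in> B then xa f else p \<cdot> xa f) = Xa \<and>
      Cod C (if f \<in> B then xa f else p \<cdot> xa f) = c f" if "f \<in> H" for f
    using p' proj(1-3)[OF that] by (auto simp: c_def)
  then obtain u where u: "u \<in> Arr C" "Dom C u = Xa" "Cod C u = Q"
    "\<And>f. f \<in> H \<Longrightarrow> q f \<cdot> u = (if f \<in> B then xa f else p \<cdot> xa f)"
    using ex[of Xa H c "\<lambda>f. if f \<in> B then xa f else p \<cdot> xa f"] c obj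
    by (auto simp: Q_def q_def)
  have t: "power_cmp k p j \<in> Arr C" "Dom C (power_cmp k p j) = Xa" "Cod C (power_cmp k p j) = Xb"
    "\<And>f. f \<in> H \<Longrightarrow> xb f \<cdot> power_cmp k p j = p \<cdot> xa f"
    using power_cmp_simps[OF p, where k = k and j = j] by (auto simp: defs H_def a_def b_def hom_iff)

  have pullback: "is_pullback C m' l Q r s"
    unfolding is_pullback_def
  proof (intro conjI allI ballI impI)
    show "m' \<cdot> r = l \<cdot> s"
    proof (rule eq_Mb)
      fix f assume f: "f \<in> B"
      have "mb f \<cdot> (m' \<cdot> r) = xb f \<cdot> r"
        by (rule Cmp_rewrite) (use f m' r proj in auto)
      moreover have "mb f \<cdot> (l \<cdot> s) = (p \<cdot> ma f) \<cdot> s"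
        by (rule Cmp_rewrite) (use f l s proj in auto)
      ultimately show "mb f \<cdot> (m' \<cdot> r) = mb f \<cdot> (l \<cdot> s)"
        using f BH r(4) s p' proj by simp
    qed (use m' r l s in auto)
    fix d v w assume v: "v \<in> hom C d (Dom C m')" and w: "w \<in> hom C d (Dom C l)" and vw: "m' \<cdot> v = l \<cdot> w"
    have v': "v \<in> Arr C" "Dom C v = d" "Cod C v = Xb" and w': "w \<in> Arr C" "Dom C w = d" "Cod C w = Ma"
      using v w m' l by (auto simp: hom_iff)
    have d: "d \<in> Obj C" using hom_Obj[OF v] by simp
    have "(if f \<in> B then ma f \<cdot> w else xb f \<cdot> v) \<in> Arr C \<and> Dom C (if f \<in> B then ma f \<cdot> w else xb f \<cdot> v) = d \<and>
        Cod C (if f \<in> B then ma f \<cdot> w else xb f \<cdot> v) = c f" if "f \<in> H" for f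
      using v' w' proj that by (auto simp: c_def)
    then obtain z where z: "z \<in> Arr C" "Dom C z = d" "Cod C z = Q"
      "\<And>f. f \<in> H \<Longrightarrow> q f \<cdot> z = (if f \<in> B then ma f \<cdot> w else xb f \<cdot> v)"
      using ex[of d H c "\<lambda>f. if f \<in> B then ma f \<cdot> w else xb f \<cdot> v"] c d
      by (auto simp: Q_def q_def)
    have vw_f: "xb f \<cdot> v = p \<cdot> (ma f \<cdot> w)" if f: "f \<in> B" for f
    proof -
      have "mb f \<cdot> (m' \<cdot> v) = xb f \<cdot> v"
        by (rule Cmp_rewrite) (use f m' v' proj in auto)
      moreover have "mb f \<cdot> (l \<cdot> w) = (p \<cdot> ma f) \<cdot> w"
        by (rule Cmp_rewrite) (use f l w' proj in auto)
      ultimately show ?thesis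
        using f vw w' p' proj by simp
    qed
    show "\<exists>!u. u \<in> hom C d Q \<and> r \<cdot> u = v \<and> s \<cdot> u = w"
    proof (rule ex1I[of _ z], intro conjI)
      show "z \<in> hom C d Q" using z by (simp add: hom_iff)
      show "r \<cdot> z = v"
      proof (rule eq_Xb)
        fix f assume f: "f \<in> H"
        have "xb f \<cdot> (r \<cdot> z) = (if f \<in> B then p \<cdot> q f else q f) \<cdot> z"
          by (rule Cmp_rewrite) (use f r z proj in auto)
        then show "xb f \<cdot> (r \<cdot> z) = xb f \<cdot> v"
          using z f vw_f p' proj by (auto split: if_splits simp: c_def)
      qed (use r z v' in auto)
      show "s \<cdot> z = w"
      proof (rule eq_Ma)
        fix f assume f: "f \<in> B"
        have "ma f \<cdot> (s \<cdot> z) = q f \<cdot> z"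
          by (rule Cmp_rewrite) (use f s z proj in auto)
        then show "ma f \<cdot> (s \<cdot> z) = ma f \<cdot> w"
          using z(4)[OF BH[OF f]] f by simp
      qed (use s z w' in auto)
    next
      fix z' assume z': "z' \<in> hom C d Q \<and> r \<cdot> z' = v \<and> s \<cdot> z' = w"
      then have z'': "z' \<in> Arr C" "Dom C z' = d" "Cod C z' = Q" by (auto simp: hom_iff)
      show "z' = z"
      proof (rule eq_Q)
        fix f assume f: "f \<in> H"
        show "q f \<cdot> z' = q f \<cdot> z"
        proof (cases "f \<in> B")
          case True
          have "ma f \<cdot> (s \<cdot> z') = q f \<cdot> z'"
            by (rule Cmp_rewrite) (use True s z'' proj in auto)
          then show ?thesis using z(4)[OF f] z' True by simp
        next
          case False
          have "xb f \<cdot> (r \<cdot> z') = (if f \<in> B then p \<cdot> q f else q f) \<cdot> z'"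
            by (rule Cmp_rewrite) (use f r z'' proj in auto)
          then show ?thesis using z(4)[OF f] z' False by simp
        qed
      qed (use z z'' in auto)
    qed
  qed (use m' l r s in \<open>auto simp: hom_iff\<close>)

  have "relative_matching_map K R C (power_arrow k p) j u"
    unfolding relative_matching_map_def
  proof (intro exI conjI ballI)
    show "is_limit (matching_category K R j) C (matching_diagram K (nsrc (power_arrow k p))) Ma (matching_leg j k a)"
      using matching_object_power_diagram[OF a, of j k] by (simp add: a_def M_def B_def)
    show "is_limit (matching_category K R j) C (matching_diagram K (ntgt (power_arrow k p))) Mb (matching_leg j k b)"
      using matching_object_power_diagram[OF b, of j k] by (simp add: b_def M_def B_def)
    have omaps: "omap (nsrc (power_arrow k p)) j = Xa" "omap (ntgt (power_arrow k p)) j = Xb"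
      using j by (simp_all add: X_def H_def a_def b_def)
    show "m \<in> hom C (omap (nsrc (power_arrow k p)) j) Ma" "m' \<in> hom C (omap (ntgt (power_arrow k p)) j) Mb"
      "l \<in> hom C Ma Mb" "u \<in> hom C (omap (nsrc (power_arrow k p)) j) Q"
      unfolding omaps using m m' l u by (simp_all add: hom_iff)
    show "is_pullback C m' l Q r s" by (rule pullback)
    have "r \<cdot> u = power_cmp k p j"
    proof (rule eq_Xb)
      fix f assume f: "f \<in> H"
      have "xb f \<cdot> (r \<cdot> u) = (if f \<in> B then p \<cdot> q f else q f) \<cdot> u"
        by (rule Cmp_rewrite) (use f r u proj in auto)
      then show "xb f \<cdot> (r \<cdot> u) = xb f \<cdot> power_cmp k p j"
        using u t f p' proj by (auto split: if_splits simp: c_def)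
    qed (use r u t in auto)
    then show "r \<cdot> u = ncmp (power_arrow k p) j" using j by simp
    show "s \<cdot> u = m"
    proof (rule eq_Ma)
      fix f assume f: "f \<in> B"
      have "ma f \<cdot> (s \<cdot> u) = q f \<cdot> u"
        by (rule Cmp_rewrite) (use f s u proj in auto)
      then show "ma f \<cdot> (s \<cdot> u) = ma f \<cdot> m"
        using u(4)[OF BH[OF f]] m f by simp
    qed (use s u m in auto)
  next
    fix g assume "g \<in> Obj (matching_category K R j)"
    then have g: "g \<in> down R" "Dom K g = j" "g \<noteq> Ide K j" and gA: "g \<in> Arr K" using down_Arr by auto
    have hg: "h \<star> g \<in> B" if "h \<in> Arr K" "Dom K h = Cod K g" "Cod K h = k" for h
      unfolding B_def using g that by (intro boundaryI)
    have leg: "matching_leg j k e g \<cdot> n = power_map k e g"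
      if e: "e \<in> Obj C" and n: "n \<in> Arr C" "Dom C n = P H (\<lambda>_. e)" "Cod C n = P B (\<lambda>_. e)"
        "\<And>f. f \<in> B \<Longrightarrow> \<pi> B (\<lambda>_. e) f \<cdot> n = \<pi> H (\<lambda>_. e) f" for e n
    proof (rule power_eqI[OF e, of _ _ "Cod K g" k])
      note lg = matching_leg_simps[OF e g, where k = k, folded B_def]
      fix h assume h: "h \<in> Arr K" "Dom K h = Cod K g" "Cod K h = k"
      have "pr (Cod K g) k e h \<cdot> (matching_leg j k e g \<cdot> n) = \<pi> B (\<lambda>_. e) (h \<star> g) \<cdot> n"
        by (rule Cmp_rewrite) (use e n lg h in auto)
      then show "pr (Cod K g) k e h \<cdot> (matching_leg j k e g \<cdot> n)
          = pr (Cod K g) k e h \<cdot> power_map k e g"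
        using n(4)[OF hg[OF h]] e gA h g by (simp add: H_def)
    qed (use e n gA g matching_leg_simps[OF e g, where k = k, folded B_def] in \<open>auto simp: H_def\<close>)
    show "matching_leg j k a g \<cdot> m = amap (nsrc (power_arrow k p)) g"
      using leg[OF a m[unfolded defs]] gA by (simp add: a_def)
    show "matching_leg j k b g \<cdot> m' = amap (ntgt (power_arrow k p)) g"
      using leg[OF b m'[unfolded defs]] gA by (simp add: b_def)
    note la = matching_leg_simps[OF a g, where k = k, folded B_def, folded defs]
    note lb = matching_leg_simps[OF b g, where k = k, folded B_def, folded defs]
    have "matching_leg j k b g \<cdot> l = power_cmp k p (Cod K g) \<cdot> matching_leg j k a g" (is "?l = ?r")
    proof (rule power_eqI[OF b, of _ _ "Cod K g" k])
      fix h assume h: "h \<in> Arr K" "Dom K h = Cod K g" "Cod K h = k"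
      have "pr (Cod K g) k b h \<cdot> ?l = mb (h \<star> g) \<cdot> l"
        by (rule Cmp_rewrite) (use b l lb h in auto)
      moreover have "pr (Cod K g) k b h \<cdot> ?r
          = (p \<cdot> pr (Cod K g) k a h) \<cdot> matching_leg j k a g"
        using power_cmp_simps[OF p, where k = k and j = "Cod K g", unfolded p'] p' b la h by (intro Cmp_rewrite) auto
      ultimately show "pr (Cod K g) k b h \<cdot> ?l
          = pr (Cod K g) k b h \<cdot> ?r"
        using l(4)[OF hg[OF h]] la h a p' by simp
    qed (use b l la lb p' in auto)
    then show "matching_leg j k b g \<cdot> l = ncmp (power_arrow k p) (Cod K g) \<cdot> matching_leg j k a g"
      using gA K.Cod_in by simp
  qed
  moreover have "has_lifting C e u" if "e \<in> Arr C" "has_lifting C e p" for e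
  proof (rule has_lifting_product[where I = H and c = "\<lambda>_. a" and c' = c and f = "\<lambda>f. if f \<in> B then Ide C a else p"])
    show "\<pi> H c f \<cdot> u = (if f \<in> B then Ide C a else p) \<cdot> \<pi> H (\<lambda>_. a) f" if "f \<in> H" for f
      using u(4)[OF that] proj(1-3)[OF that] by (auto simp: defs)
  qed (use that a c u p' has_lifting_Ide in \<open>auto simp: hom_iff defs c_def\<close>)
  ultimately show ?thesis
    using u(1) by blast
qed

end


section \<open>Free and cofree diagrams\<close>

lemma small_complete_products:
  assumes "category C" "small_complete TYPE('s::infinite) C"
  shows "\<exists>(P :: 's set \<Rightarrow> ('s \<Rightarrow> 'o) \<Rightarrow> 'o) (\<pi> :: 's set \<Rightarrow> ('s \<Rightarrow> 'o) \<Rightarrow> 's \<Rightarrow> 'a). category_with_products C P \<pi>"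
proof -
  interpret category C by fact
  have "\<forall>I c. \<exists>p \<pi>. (\<forall>i \<in> I. c i \<in> Obj C) \<longrightarrow> is_product C (I :: 's set) c p \<pi>"
    using small_complete_has_product[OF assms] by blast
  then obtain P \<pi> where "\<And>I c. (\<forall>i \<in> I. c i \<in> Obj C) \<Longrightarrow> is_product C (I :: 's set) c (P I c) (\<pi> I c)"
    by metis
  then have "category_with_products C P \<pi>"
    by unfold_locales auto
  then show ?thesis by blast
qed

text \<open>
  The properties of power diagrams that matter for model structures, stated without reference to
  chosen products, so that they can be applied to opposite categories as well.
\<close>

lemma cofree_diagram_map:
  fixes K :: "('s::infinite, 's) cat" and C :: "('o, 'a) cat"
  assumes "category K" "category C" "small_complete TYPE('s) C" and p: "p \<in> Arr C" and k: "k \<in> Obj K"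
  obtains t where "t \<in> Arr (diagrams K C)"
    and "\<And>s. \<lbrakk>s \<in> Arr (diagrams K C); has_lifting (diagrams K C) s t\<rbrakk> \<Longrightarrow> has_lifting C (ncmp s k) p"
    and "\<And>s j. \<lbrakk>s \<in> Arr C; has_lifting C s p; j \<in> Obj K\<rbrakk> \<Longrightarrow> has_lifting C s (ncmp t j)"
    and "\<And>(R :: ('s, 's, 'd::wellorder) reedy_str) j. \<lbrakk>reedy_category K R; j \<in> Obj K\<rbrakk>
      \<Longrightarrow> \<exists>u \<in> Arr C. relative_matching_map K R C t j u \<and>
            (\<forall>s \<in> Arr C. has_lifting C s p \<longrightarrow> has_lifting C s u)"
proof -
  interpret K: category K by fact
  obtain P :: "'s set \<Rightarrow> ('s \<Rightarrow> 'o) \<Rightarrow> 'o" and \<pi> :: "'s set \<Rightarrow> ('s \<Rightarrow> 'o) \<Rightarrow> 's \<Rightarrow> 'a"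
    where "category_with_products C P \<pi>"
    using small_complete_products[OF assms(2,3)] by blast
  then interpret category_with_products C P \<pi> .
  interpret power_diagrams K C P \<pi> ..
  have "\<exists>u \<in> Arr C. relative_matching_map K R C (power_arrow k p) j u \<and>
      (\<forall>s \<in> Arr C. has_lifting C s p \<longrightarrow> has_lifting C s u)"
    if "reedy_category K R" "j \<in> Obj K" for R :: "('s, 's, 'd) reedy_str" and j
  proof -
    interpret R: reedy_category K R by fact
    interpret reedy_power_diagrams K R C P \<pi> ..
    show ?thesis by (rule relative_matching_map_power_arrow[OF p that(2)])
  qed
  moreover have "power_arrow k p \<in> Arr (diagrams K C)"
    using power_arrow_hom[OF p, of k] by (simp add: hom_iff)
  ultimately show thesis
    using has_lifting_component[OF _ p k] has_lifting_power_cmp[OF p] by (intro that) auto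
qed

text \<open>
  The dual statement is about the left adjoint of evaluation, whose values are copowers.
\<close>

lemma free_diagram_map:
  fixes K :: "('s::infinite, 's) cat"
  assumes K: "category K" and C: "category C" and cocomplete: "small_cocomplete TYPE('s) C"
    and i: "i \<in> Arr C" and k: "k \<in> Obj K"
  obtains t where "t \<in> Arr (diagrams K C)"
    and "\<And>s. \<lbrakk>s \<in> Arr (diagrams K C); has_lifting (diagrams K C) t s\<rbrakk> \<Longrightarrow> has_lifting C i (ncmp s k)"
    and "\<And>s j. \<lbrakk>s \<in> Arr C; has_lifting C i s; j \<in> Obj K\<rbrakk> \<Longrightarrow> has_lifting C (ncmp t j) s"
    and "\<And>(R :: ('s, 's, 'd::wellorder) reedy_str) j. \<lbrakk>reedy_category K R; j \<in> Obj K\<rbrakk>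
      \<Longrightarrow> \<exists>u \<in> Arr C. relative_latching_map K R C t j u \<and>
            (\<forall>s \<in> Arr C. has_lifting C i s \<longrightarrow> has_lifting C u s)"
proof -
  let ?K = "opposite K" and ?C = "opposite C"
  have i': "i \<in> Arr ?C" and k': "k \<in> Obj ?K" using i k by simp_all
  show thesis
  proof (rule cofree_diagram_map[where 'd = 'd, OF category_opposite[OF K] category_opposite[OF C]
        small_complete_opposite[OF cocomplete] i' k'])
    fix t assume t: "t \<in> Arr (diagrams ?K ?C)"
      and lift: "\<And>s. \<lbrakk>s \<in> Arr (diagrams ?K ?C); has_lifting (diagrams ?K ?C) s t\<rbrakk> \<Longrightarrow> has_lifting ?C (ncmp s k) i"
      and cmp: "\<And>s j. \<lbrakk>s \<in> Arr ?C; has_lifting ?C s i; j \<in> Obj ?K\<rbrakk> \<Longrightarrow> has_lifting ?C s (ncmp t j)"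
      and reedy: "\<And>(R :: ('s, 's, 'd) reedy_str) j. \<lbrakk>reedy_category ?K R; j \<in> Obj ?K\<rbrakk>
        \<Longrightarrow> \<exists>u \<in> Arr ?C. relative_matching_map ?K R ?C t j u \<and>
              (\<forall>s \<in> Arr ?C. has_lifting ?C s i \<longrightarrow> has_lifting ?C s u)"
    let ?t = "opposite_arrow t"
    show thesis
    proof (rule that[of ?t])
      show "?t \<in> Arr (diagrams K C)"
        using t opposite_arrow_Arr_iff[of t ?K ?C] by simp
    next
      fix s assume s: "s \<in> Arr (diagrams K C)" "has_lifting (diagrams K C) ?t s"
      then have "has_lifting (diagrams ?K ?C) (opposite_arrow s) t"
        using has_lifting_opposite_arrow[of ?K ?C t "opposite_arrow s"] by simp
      then show "has_lifting C i (ncmp s k)"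
        using lift[of "opposite_arrow s"] s by (simp add: has_lifting_opposite)
    next
      show "has_lifting C (ncmp ?t j) s" if "s \<in> Arr C" "has_lifting C i s" "j \<in> Obj K" for s j
        using that cmp[of s j] by (simp add: has_lifting_opposite)
    next
      fix R :: "('s, 's, 'd) reedy_str" and j assume "reedy_category K R" "j \<in> Obj K"
      then show "\<exists>u \<in> Arr C. relative_latching_map K R C ?t j u \<and>
          (\<forall>s \<in> Arr C. has_lifting C i s \<longrightarrow> has_lifting C u s)"
        using reedy[of "opposite_reedy R" j] reedy_category_opposite[of K R]
          relative_latching_map_opposite[of ?K "opposite_reedy R" ?C t j]
        by (auto simp: has_lifting_opposite)
    qed
  qed
qed

lemma initial_diagram_component:
  fixes K :: "('s::infinite, 's) cat" and C :: "('o, 'a) cat"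
  assumes "category K" "category C" "small_complete TYPE('s) C"
    and X: "is_initial (diagrams K C) X" and k: "k \<in> Obj K"
  shows "is_initial C (omap X k)"
proof -
  interpret K: category K by fact
  obtain P :: "'s set \<Rightarrow> ('s \<Rightarrow> 'o) \<Rightarrow> 'o" and \<pi> :: "'s set \<Rightarrow> ('s \<Rightarrow> 'o) \<Rightarrow> 's \<Rightarrow> 'a"
    where "category_with_products C P \<pi>"
    using small_complete_products[OF assms(2,3)] by blast
  then interpret category_with_products C P \<pi> .
  interpret power_diagrams K C P \<pi> ..
  show ?thesis by (rule initial_diagram_pointwise[OF X k])
qed

lemma terminal_diagram_component:
  fixes K :: "('s::infinite, 's) cat"
  assumes K: "category K" and C: "category C" and cocomplete: "small_cocomplete TYPE('s) C"
    and X: "is_terminal (diagrams K C) X" and k: "k \<in> Obj K"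
  shows "is_terminal C (omap X k)"
proof -
  have "is_initial (diagrams (opposite K) (opposite C)) X"
    unfolding is_initial_def
  proof (intro conjI ballI)
    show "X \<in> Obj (diagrams (opposite K) (opposite C))"
      using X by (simp add: is_terminal_def)
    fix Y assume "Y \<in> Obj (diagrams (opposite K) (opposite C))"
    then have "\<exists>!f. f \<in> hom (diagrams K C) Y X"
      using X by (simp add: is_terminal_def)
    then obtain f where f: "f \<in> hom (diagrams K C) Y X" "\<And>g. g \<in> hom (diagrams K C) Y X \<Longrightarrow> g = f"
      by (elim ex1E) blast
    have "opposite_arrow f \<in> hom (diagrams (opposite K) (opposite C)) X Y"
      using f(1) by (simp add: opposite_arrow_hom_iff)
    moreover have "g = opposite_arrow f" if "g \<in> hom (diagrams (opposite K) (opposite C)) X Y" for g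
    proof -
      have "opposite_arrow g = f"
        by (rule f(2)) (use that opposite_arrow_hom_iff[of "opposite_arrow g" K C X Y] in simp)
      then show ?thesis
        using opposite_arrow_simps(4)[of g] by simp
    qed
    ultimately show "\<exists>!f. f \<in> hom (diagrams (opposite K) (opposite C)) X Y"
      by blast
  qed
  then have "is_initial (opposite C) (omap X k)"
    using initial_diagram_component[OF category_opposite[OF K] category_opposite[OF C]
        small_complete_opposite[OF cocomplete]] k by simp
  then show ?thesis by (simp add: is_initial_opposite)
qed

section \<open>Cofibrant and fibrant diagrams\<close>

definition standard_structure ::
  "('s::infinite, 's) cat \<Rightarrow> ('s, 's, 'd::wellorder) reedy_str \<Rightarrow> ('o, 'a) cat \<Rightarrow> 'a model_str
     \<Rightarrow> ('s, 's, 'o, 'a) ntrans model_str \<Rightarrow> bool" where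
  "standard_structure K R C M N \<longleftrightarrow> projective_structure TYPE('s) K C M N \<or>
     injective_structure TYPE('s) K C M N \<or> reedy_structure TYPE('s) K R C M N"

lemma standard_structure_diagram_model:
  fixes K :: "('s::infinite, 's) cat"
  shows "standard_structure K R C M N \<Longrightarrow> diagram_model_structure TYPE('s) K C M N"
  by (auto simp: standard_structure_def projective_structure_def injective_structure_def reedy_structure_def)

lemma pointwise_classI:
  "\<lbrakk>t \<in> Arr (diagrams K C); \<And>k. k \<in> Obj K \<Longrightarrow> ncmp t k \<in> S\<rbrakk> \<Longrightarrow> t \<in> pointwise_class K C S"
  by (simp add: pointwise_class_def)

lemma pointwise_classD:
  assumes "t \<in> pointwise_class K C S"
  shows "t \<in> Arr (diagrams K C)" "k \<in> Obj K \<Longrightarrow> ncmp t k \<in> S"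
  using assms by (auto simp: pointwise_class_def)

text \<open>
  For the projective and the Reedy structure, the map \<open>t\<close> of power diagrams induced by an acyclic
  fibration \<open>p\<close> is an acyclic fibration. Hence \<open>s\<close> lifts against \<open>t\<close>, and so \<open>s\<^sub>k\<close> lifts against \<open>p\<close>.
\<close>

lemma cofibration_component:
  fixes K :: "('s::infinite, 's) cat" and R :: "('s, 's, 'd::wellorder) reedy_str"
  assumes K: "category K" and M: "model_category TYPE('s) C M"
    and str: "standard_structure K R C M N"
    and s: "s \<in> cof N" and k: "k \<in> Obj K"
  shows "ncmp s k \<in> cof M"
proof (cases "injective_structure TYPE('s) K C M N")
  case True
  then show ?thesis
    using s k by (simp add: injective_structure.cof_pointwise pointwise_classD)
next
  case False
  interpret M: model_category "TYPE('s)" C M by fact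
  interpret N: diagram_model_structure "TYPE('s)" K C M N
    by (rule standard_structure_diagram_model[OF str])
  have sA: "s \<in> Arr (diagrams K C)" using s N.cof_Arr by blast
  have "has_lifting C (ncmp s k) p" if p: "p \<in> fib M \<inter> weq M" for p
  proof -
    have pA: "p \<in> Arr C" and p_lift: "\<And>i. i \<in> cof M \<Longrightarrow> has_lifting C i p"
      using p M.fib_Arr M.lift_cof by auto
    show ?thesis
    proof (rule cofree_diagram_map[where 'd = 'd, OF K M.category_axioms M.complete pA k])
      fix t assume t: "t \<in> Arr (diagrams K C)"
        and transfer: "\<And>s. \<lbrakk>s \<in> Arr (diagrams K C); has_lifting (diagrams K C) s t\<rbrakk> \<Longrightarrow> has_lifting C (ncmp s k) p"
        and cmp: "\<And>s j. \<lbrakk>s \<in> Arr C; has_lifting C s p; j \<in> Obj K\<rbrakk> \<Longrightarrow> has_lifting C s (ncmp t j)"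
        and reedy: "\<And>(R :: ('s, 's, 'd::wellorder) reedy_str) j. \<lbrakk>reedy_category K R; j \<in> Obj K\<rbrakk>
          \<Longrightarrow> \<exists>u \<in> Arr C. relative_matching_map K R C t j u \<and>
                (\<forall>s \<in> Arr C. has_lifting C s p \<longrightarrow> has_lifting C s u)"
      have afib: "ncmp t j \<in> fib M \<inter> weq M" if j: "j \<in> Obj K" for j
        unfolding M.afib_iff using t j cmp p_lift M.cof_Arr by auto
      have "t \<in> weq N"
        unfolding N.weq_pointwise using t afib by (auto intro: pointwise_classI)
      moreover have "t \<in> fib N"
        using str False unfolding standard_structure_def
      proof (elim disjE)
        assume "projective_structure TYPE('s) K C M N"
        then show "t \<in> fib N"
          using t afib by (auto simp: projective_structure.fib_pointwise intro: pointwise_classI)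
      next
        assume "reedy_structure TYPE('s) K R C M N"
        then interpret R: reedy_structure "TYPE('s)" K R C M N .
        have "\<exists>u. relative_matching_map K R C t j u \<and> u \<in> fib M" if "j \<in> Obj K" for j
          using reedy[OF R.reedy_category_axioms that] M.afib_iff p_lift M.cof_Arr by blast
        then show "t \<in> fib N"
          using t by (simp add: R.fib_matching)
      qed simp
      ultimately show "has_lifting C (ncmp s k) p"
        using transfer[OF sA] N.lift_cof[OF s] by simp
    qed
  qed
  then show ?thesis
    unfolding M.cof_iff using sA k by simp
qed

text \<open>
  Dually, for the injective and the Reedy structure the free diagram on an acyclic cofibration \<open>i\<close>
  gives an acyclic cofibration \<open>t\<close>.
\<close>

lemma fibration_component:
  fixes K :: "('s::infinite, 's) cat" and R :: "('s, 's, 'd::wellorder) reedy_str"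
  assumes K: "category K" and M: "model_category TYPE('s) C M"
    and str: "standard_structure K R C M N"
    and s: "s \<in> fib N" and k: "k \<in> Obj K"
  shows "ncmp s k \<in> fib M"
proof (cases "projective_structure TYPE('s) K C M N")
  case True
  then show ?thesis
    using s k by (simp add: projective_structure.fib_pointwise pointwise_classD)
next
  case False
  interpret M: model_category "TYPE('s)" C M by fact
  interpret N: diagram_model_structure "TYPE('s)" K C M N
    by (rule standard_structure_diagram_model[OF str])
  have sA: "s \<in> Arr (diagrams K C)" using s N.fib_Arr by blast
  have "has_lifting C i (ncmp s k)" if i: "i \<in> cof M \<inter> weq M" for i
  proof -
    have iA: "i \<in> Arr C" and i_lift: "\<And>p. p \<in> fib M \<Longrightarrow> has_lifting C i p"
      using i M.cof_Arr M.lift_acof by auto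
    show ?thesis
    proof (rule free_diagram_map[where 'd = 'd, OF K M.category_axioms M.cocomplete iA k])
      fix t assume t: "t \<in> Arr (diagrams K C)"
        and transfer: "\<And>s. \<lbrakk>s \<in> Arr (diagrams K C); has_lifting (diagrams K C) t s\<rbrakk> \<Longrightarrow> has_lifting C i (ncmp s k)"
        and cmp: "\<And>s j. \<lbrakk>s \<in> Arr C; has_lifting C i s; j \<in> Obj K\<rbrakk> \<Longrightarrow> has_lifting C (ncmp t j) s"
        and reedy: "\<And>(R :: ('s, 's, 'd::wellorder) reedy_str) j. \<lbrakk>reedy_category K R; j \<in> Obj K\<rbrakk>
          \<Longrightarrow> \<exists>u \<in> Arr C. relative_latching_map K R C t j u \<and>
                (\<forall>s \<in> Arr C. has_lifting C i s \<longrightarrow> has_lifting C u s)"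
      have acof: "ncmp t j \<in> cof M \<inter> weq M" if j: "j \<in> Obj K" for j
        unfolding M.acof_iff using t j cmp i_lift M.fib_Arr by auto
      have "t \<in> weq N"
        unfolding N.weq_pointwise using t acof by (auto intro: pointwise_classI)
      moreover have "t \<in> cof N"
        using str False unfolding standard_structure_def
      proof (elim disjE)
        assume "injective_structure TYPE('s) K C M N"
        then show "t \<in> cof N"
          using t acof by (auto simp: injective_structure.cof_pointwise intro: pointwise_classI)
      next
        assume "reedy_structure TYPE('s) K R C M N"
        then interpret R: reedy_structure "TYPE('s)" K R C M N .
        have "\<exists>u. relative_latching_map K R C t j u \<and> u \<in> cof M" if "j \<in> Obj K" for j
          using reedy[OF R.reedy_category_axioms that] M.acof_iff i_lift M.fib_Arr by blast
        then show "t \<in> cof N"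
          using t by (simp add: R.cof_latching)
      qed simp
      ultimately show "has_lifting C i (ncmp s k)"
        using transfer[OF sA] N.lift_acof[OF _ s] by simp
    qed
  qed
  then show ?thesis
    unfolding M.fib_iff using sA k by simp
qed

lemma cofibrant_component:
  fixes K :: "('s::infinite, 's) cat" and R :: "('s, 's, 'd::wellorder) reedy_str"
  assumes K: "category K" and M: "model_category TYPE('s) C M"
    and str: "standard_structure K R C M N"
    and X: "cofibrant (diagrams K C) N X" and k: "k \<in> Obj K"
  shows "cofibrant C M (omap X k)"
proof -
  interpret M: model_category "TYPE('s)" C M by fact
  obtain I f where I: "is_initial (diagrams K C) I" and f: "f \<in> hom (diagrams K C) I X" "f \<in> cof N"
    using X by (auto simp: cofibrant_def)
  then show ?thesis
    unfolding cofibrant_def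
    using initial_diagram_component[OF K M.category_axioms M.complete I k] diagram_component[OF f(1) k]
      cofibration_component[OF K M str f(2) k] by blast
qed

lemma fibrant_component:
  fixes K :: "('s::infinite, 's) cat" and R :: "('s, 's, 'd::wellorder) reedy_str"
  assumes K: "category K" and M: "model_category TYPE('s) C M"
    and str: "standard_structure K R C M N"
    and X: "fibrant (diagrams K C) N X" and k: "k \<in> Obj K"
  shows "fibrant C M (omap X k)"
proof -
  interpret M: model_category "TYPE('s)" C M by fact
  obtain I f where I: "is_terminal (diagrams K C) I" and f: "f \<in> hom (diagrams K C) X I" "f \<in> fib N"
    using X by (auto simp: fibrant_def)
  then show ?thesis
    unfolding fibrant_def
    using terminal_diagram_component[OF K M.category_axioms M.cocomplete I k] diagram_component[OF f(1) k]
      fibration_component[OF K M str f(2) k] by blast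
qed

section \<open>The induced Quillen adjunction\<close>

definition same_type_structures where
  "same_type_structures (K :: ('s::infinite, 's) cat) R C MC NC D MD ND \<longleftrightarrow>
     projective_structure TYPE('s) K C MC NC \<and> projective_structure TYPE('s) K D MD ND \<or>
     injective_structure TYPE('s) K C MC NC \<and> injective_structure TYPE('s) K D MD ND \<or>
     reedy_structure TYPE('s) K R C MC NC \<and> reedy_structure TYPE('s) K R D MD ND"

lemma same_type_structures_standard:
  assumes "same_type_structures K R C MC NC D MD ND"
  shows "standard_structure K R C MC NC" "standard_structure K R D MD ND"
  using assms by (auto simp: same_type_structures_def standard_structure_def)

lemma postcomp_Arr:
  assumes "category K" "cat_functor C D F" "t \<in> Arr (diagrams K C)"
  shows "amap (postcomp K F) t \<in> Arr (diagrams K D)"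
  using cat_functor.amap_hom[OF cat_functor_postcomp[OF assms(1,2)] in_hom_Dom_Cod[OF assms(3)]]
  by (simp add: hom_iff)

lemma postcomp_pointwise_class:
  assumes "category K" "cat_functor C D F" "t \<in> pointwise_class K C S"
    and "\<And>f. f \<in> S \<Longrightarrow> amap F f \<in> S'"
  shows "amap (postcomp K F) t \<in> pointwise_class K D S'"
  using assms postcomp_Arr[OF assms(1,2)] by (auto simp: pointwise_class_def)

lemma pointwise_class_Int: "pointwise_class K C S \<inter> pointwise_class K C S' = pointwise_class K C (S \<inter> S')"
  by (auto simp: pointwise_class_def)

text \<open>
  In the Reedy case the two halves of the argument concern different functors: \<open>F\<^sup>K\<close> preserves
  cofibrations since \<open>F\<close> preserves relative latching maps, and \<open>G\<^sup>K\<close> preserves fibrations since \<open>G\<close>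
  preserves relative matching maps.
\<close>

lemma quillen_adjunction_diagrams:
  fixes K :: "('s::infinite, 's) cat" and R :: "('s, 's, 'd::wellorder) reedy_str"
  assumes K: "category K" and Q: "quillen_adjunction TYPE('s) C MC D MD F G \<eta> \<epsilon>"
    and str: "same_type_structures K R C MC NC D MD ND"
  shows "quillen_adjunction TYPE('s) (diagrams K C) NC (diagrams K D) ND (postcomp K F) (postcomp K G)
       (diagram_unit K F G \<eta>) (diagram_counit K F G \<epsilon>)"
proof -
  interpret quillen_adjunction "TYPE('s)" C MC D MD F G \<eta> \<epsilon> by fact
  interpret adj: adjunction "diagrams K C" "diagrams K D" "postcomp K F" "postcomp K G"
    "diagram_unit K F G \<eta>" "diagram_counit K F G \<epsilon>"
    by (rule adjunction_diagrams[OF K adjunction_axioms])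
  note F_pointwise = postcomp_pointwise_class[OF K F.cat_functor_axioms]
    and G_pointwise = postcomp_pointwise_class[OF K G.cat_functor_axioms]
  from str show ?thesis
    unfolding same_type_structures_def
  proof (elim disjE conjE)
    assume "projective_structure TYPE('s) K C MC NC" "projective_structure TYPE('s) K D MD ND"
    then interpret NC: projective_structure "TYPE('s)" K C MC NC
      + ND: projective_structure "TYPE('s)" K D MD ND .
    show ?thesis
    proof (rule adj.quillen_adjunctionI_fib[OF NC.model_category_axioms ND.model_category_axioms])
      show "amap (postcomp K G) p \<in> fib NC" if "p \<in> fib ND" for p
        using that unfolding NC.fib_pointwise ND.fib_pointwise by (rule G_pointwise) (rule G_fib)
      show "amap (postcomp K G) p \<in> fib NC \<inter> weq NC" if "p \<in> fib ND \<inter> weq ND" for p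
        using that unfolding NC.fib_pointwise ND.fib_pointwise NC.weq_pointwise ND.weq_pointwise
          pointwise_class_Int by (rule G_pointwise) (rule G_afib)
    qed
  next
    assume "injective_structure TYPE('s) K C MC NC" "injective_structure TYPE('s) K D MD ND"
    then interpret NC: injective_structure "TYPE('s)" K C MC NC
      + ND: injective_structure "TYPE('s)" K D MD ND .
    show ?thesis
    proof unfold_locales
      show "amap (postcomp K F) i \<in> cof ND" if "i \<in> cof NC" for i
        using that unfolding NC.cof_pointwise ND.cof_pointwise by (rule F_pointwise) (rule F_cof)
      show "amap (postcomp K F) i \<in> cof ND \<inter> weq ND" if "i \<in> cof NC \<inter> weq NC" for i
        using that unfolding NC.cof_pointwise ND.cof_pointwise NC.weq_pointwise ND.weq_pointwise
          pointwise_class_Int by (rule F_pointwise) (rule F_acof)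
    qed
  next
    assume "reedy_structure TYPE('s) K R C MC NC" "reedy_structure TYPE('s) K R D MD ND"
    then interpret NC: reedy_structure "TYPE('s)" K R C MC NC
      + ND: reedy_structure "TYPE('s)" K R D MD ND .
    show ?thesis
    proof (rule adj.quillen_adjunctionI_cof_fib[OF NC.model_category_axioms ND.model_category_axioms])
      fix i assume i: "i \<in> cof NC"
      then have iA: "i \<in> Arr (diagrams K C)" using NC.cof_Arr by blast
      show "amap (postcomp K F) i \<in> cof ND"
        using i postcomp_Arr[OF K F.cat_functor_axioms iA] F_cof
          relative_latching_map_postcomp[OF NC.reedy_category_axioms iA]
        unfolding NC.cof_latching ND.cof_latching by blast
    next
      fix p assume p: "p \<in> fib ND"
      then have pA: "p \<in> Arr (diagrams K D)" using ND.fib_Arr by blast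
      show "amap (postcomp K G) p \<in> fib NC"
        using p postcomp_Arr[OF K G.cat_functor_axioms pA] G_fib
          relative_matching_map_postcomp[OF NC.reedy_category_axioms pA]
        unfolding NC.fib_matching ND.fib_matching by blast
    qed
  qed
qed

text \<open>
  The adjunct of \<open>f : F\<^sup>K X \<rightarrow> Y\<close> has the adjuncts of the components \<open>f\<^sub>k\<close> as components, and \<open>X\<^sub>k\<close> is cofibrant
  and \<open>Y\<^sub>k\<close> is fibrant.
\<close>

lemma quillen_equivalence_diagrams:
  fixes K :: "('s::infinite, 's) cat" and R :: "('s, 's, 'd::wellorder) reedy_str"
  assumes K: "category K" and E: "quillen_equivalence TYPE('s) C MC D MD F G \<eta> \<epsilon>"
    and str: "same_type_structures K R C MC NC D MD ND"
  shows "quillen_equivalence TYPE('s) (diagrams K C) NC (diagrams K D) ND (postcomp K F) (postcomp K G)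
       (diagram_unit K F G \<eta>) (diagram_counit K F G \<epsilon>)"
proof -
  interpret quillen_equivalence "TYPE('s)" C MC D MD F G \<eta> \<epsilon> by fact
  interpret Q: quillen_adjunction "TYPE('s)" "diagrams K C" NC "diagrams K D" ND "postcomp K F" "postcomp K G"
    "diagram_unit K F G \<eta>" "diagram_counit K F G \<epsilon>"
    by (rule quillen_adjunction_diagrams[OF K quillen_adjunction_axioms str])
  note strC = same_type_structures_standard(1)[OF str] and strD = same_type_structures_standard(2)[OF str]
  interpret NC: diagram_model_structure "TYPE('s)" K C MC NC
    by (rule standard_structure_diagram_model[OF strC])
  interpret ND: diagram_model_structure "TYPE('s)" K D MD ND
    by (rule standard_structure_diagram_model[OF strD])
  show ?thesis
  proof
    fix X Y f
    assume X: "cofibrant (diagrams K C) NC X" and Y: "fibrant (diagrams K D) ND Y"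
      and f: "f \<in> hom (diagrams K D) (omap (postcomp K F) X) Y"
    have XO: "X \<in> Obj (diagrams K C)"
      using X Q.F.C.hom_Obj by (auto simp: cofibrant_def)
    have fA: "f \<in> Arr (diagrams K D)" using f by (simp add: hom_iff)
    have adjA: "amap (postcomp K G) f \<cdot>\<^bsub>diagrams K C\<^esub> diagram_unit K F G \<eta> X \<in> Arr (diagrams K C)"
      using Q.sharp_hom[OF XO f] by (simp only: Q.sharp_def hom_iff)
    have "ncmp f k \<in> weq MD \<longleftrightarrow> amap G (ncmp f k) \<cdot>\<^bsub>C\<^esub> \<eta> (omap X k) \<in> weq MC" if k: "k \<in> Obj K" for k
      by (rule weq_iff_adjunct_weq[OF cofibrant_component[OF K CM.model_category_axioms strC X k]
            fibrant_component[OF K DM.model_category_axioms strD Y k]])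
        (use diagram_component[OF f k] k in simp)
    then show "f \<in> weq ND \<longleftrightarrow>
        amap (postcomp K G) f \<cdot>\<^bsub>diagrams K C\<^esub> diagram_unit K F G \<eta> X \<in> weq NC"
      using fA adjA unfolding NC.weq_pointwise ND.weq_pointwise pointwise_class_def by simp
  qed
qed


section \<open>Pointwise monoidal structures\<close>

lemma pointwise_tens_simps [simp]:
  "k \<in> Obj K \<Longrightarrow> omap (pointwise_tens K T X Y) k = otens T (omap X k) (omap Y k)"
  "f \<in> Arr K \<Longrightarrow> amap (pointwise_tens K T X Y) f = atens T (amap X f) (amap Y f)"
  by (simp_all add: pointwise_tens_def)

lemma constant_diagram_simps [simp]:
  "k \<in> Obj K \<Longrightarrow> omap (constant_diagram K C x) k = x"
  "f \<in> Arr K \<Longrightarrow> amap (constant_diagram K C x) f = Ide C x"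
  by (simp_all add: constant_diagram_def)

lemma pointwise_monoidal_simps [simp]:
  "otens (pointwise_monoidal K C T) = pointwise_tens K T"
  "munit (pointwise_monoidal K C T) = constant_diagram K C (munit T)"
  "atens (pointwise_monoidal K C T) s t = mk_arrow K (pointwise_tens K T (nsrc s) (nsrc t))
     (pointwise_tens K T (ntgt s) (ntgt t)) (\<lambda>k. atens T (ncmp s k) (ncmp t k))"
  "massoc (pointwise_monoidal K C T) X Y Z = mk_arrow K (pointwise_tens K T (pointwise_tens K T X Y) Z)
     (pointwise_tens K T X (pointwise_tens K T Y Z)) (\<lambda>k. massoc T (omap X k) (omap Y k) (omap Z k))"
  "mleft (pointwise_monoidal K C T) X =
     mk_arrow K (pointwise_tens K T (constant_diagram K C (munit T)) X) X (\<lambda>k. mleft T (omap X k))"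
  "mright (pointwise_monoidal K C T) X =
     mk_arrow K (pointwise_tens K T X (constant_diagram K C (munit T))) X (\<lambda>k. mright T (omap X k))"
  by (simp_all add: pointwise_monoidal_def)

lemma constant_diagram_Obj:
  assumes "category K" "category C" "x \<in> Obj C"
  shows "constant_diagram K C x \<in> Obj (diagrams K C)"
proof -
  interpret C: category C by fact
  show ?thesis
    unfolding constant_diagram_def
    by (rule mk_diagram_Obj) (use assms C.Ide_hom[of x] C.Cmp_Ide_left in auto)
qed

lemma diagram_amap_hom:
  "X \<in> Obj (diagrams K C) \<Longrightarrow> f \<in> Arr K \<Longrightarrow> amap X f \<in> hom C (omap X (Dom K f)) (omap X (Cod K f))"
  by (simp add: hom_iff)

lemma pointwise_tens_Obj:
  assumes "category K" "monoidal_category C T" and X: "X \<in> Obj (diagrams K C)" and Y: "Y \<in> Obj (diagrams K C)"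
  shows "pointwise_tens K T X Y \<in> Obj (diagrams K C)"
proof -
  interpret K: category K by fact
  interpret monoidal_category C T by fact
  show ?thesis
    unfolding pointwise_tens_def
  proof (rule mk_diagram_Obj)
    fix f g assume fg: "f \<in> Arr K" "g \<in> Arr K" "Cod K f = Dom K g"
    show "atens T (amap X (g \<cdot>\<^bsub>K\<^esub> f)) (amap Y (g \<cdot>\<^bsub>K\<^esub> f))
        = atens T (amap X g) (amap Y g) \<cdot>\<^bsub>C\<^esub> atens T (amap X f) (amap Y f)"
      unfolding diagram_amap_Cmp[OF X fg] diagram_amap_Cmp[OF Y fg]
      by (rule atens_Cmp[OF diagram_amap_hom[OF X fg(1), unfolded fg(3)] diagram_amap_hom[OF X fg(2)]
            diagram_amap_hom[OF Y fg(1), unfolded fg(3)] diagram_amap_hom[OF Y fg(2)]])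
  qed (use X Y diagram_amap_hom[OF X] diagram_amap_hom[OF Y] K.category_axioms category_axioms
      in \<open>auto simp: otens_in atens_Ide intro: atens_hom\<close>)
qed

text \<open>
  Pointwise inverses of a natural transformation are natural.
\<close>

lemma iso_diagram:
  assumes "category K" "category C" and t: "t \<in> hom (diagrams K C) X Y"
    and iso: "\<And>k. k \<in> Obj K \<Longrightarrow> iso C (ncmp t k)"
  shows "iso (diagrams K C) t"
proof -
  interpret K: category K by fact
  interpret C: category C by fact
  interpret KC: category_pair K C ..
  have XY: "X \<in> Obj (diagrams K C)" "Y \<in> Obj (diagrams K C)" "nsrc t = X" "ntgt t = Y"
    using t by (auto simp: in_hom_diagrams_iff)
  have tk: "ncmp t k \<in> Arr C" "Dom C (ncmp t k) = omap X k" "Cod C (ncmp t k) = omap Y k"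
    if "k \<in> Obj K" for k
    using diagram_component[OF t that] by (auto simp: hom_iff)
  have "\<exists>g. g \<in> hom C (omap Y k) (omap X k) \<and> g \<cdot>\<^bsub>C\<^esub> ncmp t k = Ide C (omap X k) \<and>
      ncmp t k \<cdot>\<^bsub>C\<^esub> g = Ide C (omap Y k)" if "k \<in> Obj K" for k
    using iso[OF that] tk[OF that] by (auto simp: iso_def)
  then obtain s where s: "\<And>k. k \<in> Obj K \<Longrightarrow> s k \<in> hom C (omap Y k) (omap X k)"
    and st: "\<And>k. k \<in> Obj K \<Longrightarrow> s k \<cdot>\<^bsub>C\<^esub> ncmp t k = Ide C (omap X k)"
    and ts: "\<And>k. k \<in> Obj K \<Longrightarrow> ncmp t k \<cdot>\<^bsub>C\<^esub> s k = Ide C (omap Y k)"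
    by metis
  have sk: "s k \<in> Arr C" "Dom C (s k) = omap Y k" "Cod C (s k) = omap X k" if "k \<in> Obj K" for k
    using s[OF that] by (auto simp: hom_iff)
  have "mk_arrow K Y X s \<in> hom (diagrams K C) Y X"
  proof (rule mk_arrow_hom)
    fix f assume f: "f \<in> Arr K"
    note D = K.Dom_in[OF f] K.Cod_in[OF f]
    have "amap X f \<cdot>\<^bsub>C\<^esub> s (Dom K f) = (s (Cod K f) \<cdot>\<^bsub>C\<^esub> ncmp t (Cod K f)) \<cdot>\<^bsub>C\<^esub> (amap X f \<cdot>\<^bsub>C\<^esub> s (Dom K f))"
      using XY f D st[OF D(2)] sk[OF D(1)] by simp
    also have "\<dots> = s (Cod K f) \<cdot>\<^bsub>C\<^esub> ((ncmp t (Cod K f) \<cdot>\<^bsub>C\<^esub> amap X f) \<cdot>\<^bsub>C\<^esub> s (Dom K f))"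
      using XY f D sk tk by simp
    also have "ncmp t (Cod K f) \<cdot>\<^bsub>C\<^esub> amap X f = amap Y f \<cdot>\<^bsub>C\<^esub> ncmp t (Dom K f)"
      by (rule diagram_natural[OF t f, symmetric])
    also have "s (Cod K f) \<cdot>\<^bsub>C\<^esub> ((amap Y f \<cdot>\<^bsub>C\<^esub> ncmp t (Dom K f)) \<cdot>\<^bsub>C\<^esub> s (Dom K f))
        = s (Cod K f) \<cdot>\<^bsub>C\<^esub> (amap Y f \<cdot>\<^bsub>C\<^esub> (ncmp t (Dom K f) \<cdot>\<^bsub>C\<^esub> s (Dom K f)))"
      using XY f D sk tk by simp
    also have "\<dots> = s (Cod K f) \<cdot>\<^bsub>C\<^esub> amap Y f"
      using XY f D ts[OF D(1)] by simp
    finally show "amap X f \<cdot>\<^bsub>C\<^esub> s (Dom K f) = s (Cod K f) \<cdot>\<^bsub>C\<^esub> amap Y f" .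
  qed (use XY s K.category_axioms in auto)
  moreover have "mk_arrow K Y X s \<cdot>\<^bsub>diagrams K C\<^esub> t = Ide (diagrams K C) X"
    "t \<cdot>\<^bsub>diagrams K C\<^esub> mk_arrow K Y X s = Ide (diagrams K C) Y"
    using XY st ts by (auto intro!: mk_arrow_cong)
  moreover have "t \<in> Arr (diagrams K C)"
    using t by (simp add: hom_iff)
  ultimately show ?thesis
    using XY unfolding iso_def by (intro conjI bexI[of _ "mk_arrow K Y X s"]) (simp_all only: diagrams_simps)
qed

lemma monoidal_category_pointwise:
  assumes "category K" "monoidal_category C T"
  shows "monoidal_category (diagrams K C) (pointwise_monoidal K C T)"
proof -
  interpret K: category K by fact
  interpret monoidal_category C T by fact
  interpret KC: category_pair K C ..
  note tens_Obj = pointwise_tens_Obj[OF assms]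
  note unit_Obj = constant_diagram_Obj[OF K.category_axioms category_axioms munit_in]
  note amap_hom = diagram_amap_hom
  have massoc_arrow: "massoc (pointwise_monoidal K C T) X Y Z \<in> hom (diagrams K C)
      (pointwise_tens K T (pointwise_tens K T X Y) Z) (pointwise_tens K T X (pointwise_tens K T Y Z))"
    if "X \<in> Obj (diagrams K C)" "Y \<in> Obj (diagrams K C)" "Z \<in> Obj (diagrams K C)" for X Y Z
    unfolding pointwise_monoidal_simps
    by (rule mk_arrow_hom)
      (use that K.category_axioms in \<open>auto intro!: tens_Obj massoc_hom massoc_natural amap_hom\<close>)
  have mleft_arrow: "mleft (pointwise_monoidal K C T) X
      \<in> hom (diagrams K C) (pointwise_tens K T (constant_diagram K C (munit T)) X) X"
    if "X \<in> Obj (diagrams K C)" for X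
    unfolding pointwise_monoidal_simps
    by (rule mk_arrow_hom)
      (use that K.category_axioms in \<open>auto intro!: tens_Obj unit_Obj mleft_hom mleft_natural amap_hom\<close>)
  have mright_arrow: "mright (pointwise_monoidal K C T) X
      \<in> hom (diagrams K C) (pointwise_tens K T X (constant_diagram K C (munit T))) X"
    if "X \<in> Obj (diagrams K C)" for X
    unfolding pointwise_monoidal_simps
    by (rule mk_arrow_hom)
      (use that K.category_axioms in \<open>auto intro!: tens_Obj unit_Obj mright_hom mright_natural amap_hom\<close>)
  show ?thesis
  proof
    fix s X Y t X' Y'
    assume s: "s \<in> hom (diagrams K C) X Y" and t: "t \<in> hom (diagrams K C) X' Y'"
    then have ends: "nsrc s = X" "ntgt s = Y" "nsrc t = X'" "ntgt t = Y'"
      and obj: "X \<in> Obj (diagrams K C)" "Y \<in> Obj (diagrams K C)"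
        "X' \<in> Obj (diagrams K C)" "Y' \<in> Obj (diagrams K C)"
      by (auto simp: in_hom_diagrams_iff)
    have "atens T (amap Y f) (amap Y' f) \<cdot>\<^bsub>C\<^esub> atens T (ncmp s (Dom K f)) (ncmp t (Dom K f))
        = atens T (ncmp s (Cod K f)) (ncmp t (Cod K f)) \<cdot>\<^bsub>C\<^esub> atens T (amap X f) (amap X' f)"
      if f: "f \<in> Arr K" for f
      using atens_Cmp[OF diagram_component[OF s] amap_hom[OF obj(2) f] diagram_component[OF t] amap_hom[OF obj(4) f]]
        atens_Cmp[OF amap_hom[OF obj(1) f] diagram_component[OF s] amap_hom[OF obj(3) f] diagram_component[OF t]]
        diagram_natural[OF s f] diagram_natural[OF t f] f
      by (simp add: K.Dom_in K.Cod_in)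
    then show "atens (pointwise_monoidal K C T) s t \<in> hom (diagrams K C)
        (otens (pointwise_monoidal K C T) X X') (otens (pointwise_monoidal K C T) Y Y')"
      unfolding pointwise_monoidal_simps ends
      by (intro mk_arrow_hom tens_Obj obj K.category_axioms)
        (use diagram_component[OF s] diagram_component[OF t] in \<open>auto intro: atens_hom simp: K.Dom_in K.Cod_in\<close>)
  next
    fix X Y Z assume XYZ: "X \<in> Obj (diagrams K C)" "Y \<in> Obj (diagrams K C)" "Z \<in> Obj (diagrams K C)"
    then show "iso (diagrams K C) (massoc (pointwise_monoidal K C T) X Y Z)"
      by (intro iso_diagram[OF K.category_axioms category_axioms massoc_arrow]) (auto intro: massoc_iso)
  next
    fix X assume X: "X \<in> Obj (diagrams K C)"
    then show "iso (diagrams K C) (mleft (pointwise_monoidal K C T) X)"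
      by (intro iso_diagram[OF K.category_axioms category_axioms mleft_arrow]) (auto intro: mleft_iso)
    show "iso (diagrams K C) (mright (pointwise_monoidal K C T) X)"
      using X by (intro iso_diagram[OF K.category_axioms category_axioms mright_arrow]) (auto intro: mright_iso)
  next
    fix s X Y s' Z t X' Y' t' Z'
    assume st: "s \<in> hom (diagrams K C) X Y" "s' \<in> hom (diagrams K C) Y Z"
      "t \<in> hom (diagrams K C) X' Y'" "t' \<in> hom (diagrams K C) Y' Z'"
    then show "atens (pointwise_monoidal K C T) (s' \<cdot>\<^bsub>diagrams K C\<^esub> s) (t' \<cdot>\<^bsub>diagrams K C\<^esub> t)
      = atens (pointwise_monoidal K C T) s' t' \<cdot>\<^bsub>diagrams K C\<^esub> atens (pointwise_monoidal K C T) s t"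
      using atens_Cmp[OF st[THEN diagram_component]]
      by (auto intro!: mk_arrow_cong)
  next
    fix s X X' t Y Y' u Z Z'
    assume stu: "s \<in> hom (diagrams K C) X X'" "t \<in> hom (diagrams K C) Y Y'" "u \<in> hom (diagrams K C) Z Z'"
    then have "nsrc s = X" "ntgt s = X'" "nsrc t = Y" "ntgt t = Y'" "nsrc u = Z" "ntgt u = Z'"
      by (auto simp: in_hom_diagrams_iff)
    then show "atens (pointwise_monoidal K C T) s (atens (pointwise_monoidal K C T) t u)
        \<cdot>\<^bsub>diagrams K C\<^esub> massoc (pointwise_monoidal K C T) X Y Z
      = massoc (pointwise_monoidal K C T) X' Y' Z'
        \<cdot>\<^bsub>diagrams K C\<^esub> atens (pointwise_monoidal K C T) (atens (pointwise_monoidal K C T) s t) u"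
      using massoc_natural[OF stu[THEN diagram_component]]
      by (auto intro!: mk_arrow_cong)
  next
    fix s X Y assume s: "s \<in> hom (diagrams K C) X Y"
    then have ends: "nsrc s = X" "ntgt s = Y"
      by (auto simp: in_hom_diagrams_iff)
    then show "s \<cdot>\<^bsub>diagrams K C\<^esub> mleft (pointwise_monoidal K C T) X
      = mleft (pointwise_monoidal K C T) Y \<cdot>\<^bsub>diagrams K C\<^esub> atens (pointwise_monoidal K C T)
          (Ide (diagrams K C) (munit (pointwise_monoidal K C T))) s"
      using mleft_natural[OF diagram_component[OF s]] by (auto intro!: mk_arrow_cong)
    show "s \<cdot>\<^bsub>diagrams K C\<^esub> mright (pointwise_monoidal K C T) X
      = mright (pointwise_monoidal K C T) Y \<cdot>\<^bsub>diagrams K C\<^esub> atens (pointwise_monoidal K C T) s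
          (Ide (diagrams K C) (munit (pointwise_monoidal K C T)))"
      using mright_natural[OF diagram_component[OF s]] ends by (auto intro!: mk_arrow_cong)
  qed (use tens_Obj unit_Obj massoc_arrow mleft_arrow mright_arrow in
      \<open>auto intro!: mk_arrow_cong simp: atens_Ide pentagon triangle\<close>)
qed


lemma pointwise_lax_simps [simp]:
  "nsrc (pointwise_lax K TC TD G \<mu> X Y) = pointwise_tens K TC (postcomp_obj K G X) (postcomp_obj K G Y)"
  "ntgt (pointwise_lax K TC TD G \<mu> X Y) = postcomp_obj K G (pointwise_tens K TD X Y)"
  "k \<in> Obj K \<Longrightarrow> ncmp (pointwise_lax K TC TD G \<mu> X Y) k = \<mu> (omap X k) (omap Y k)"
  by (simp_all add: pointwise_lax_def)

lemma pointwise_lax_unit_simps [simp]: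
  "nsrc (pointwise_lax_unit K C TC D TD G \<iota>) = constant_diagram K C (munit TC)"
  "ntgt (pointwise_lax_unit K C TC D TD G \<iota>) = postcomp_obj K G (constant_diagram K D (munit TD))"
  "k \<in> Obj K \<Longrightarrow> ncmp (pointwise_lax_unit K C TC D TD G \<iota>) k = \<iota>"
  by (simp_all add: pointwise_lax_unit_def)

lemma lax_monoidal_functor_pointwise:
  assumes "category K" "lax_monoidal_functor D TD C TC G \<mu> \<iota>"
  shows "lax_monoidal_functor (diagrams K D) (pointwise_monoidal K D TD)
    (diagrams K C) (pointwise_monoidal K C TC) (postcomp K G)
    (pointwise_lax K TC TD G \<mu>) (pointwise_lax_unit K C TC D TD G \<iota>)"
proof -
  interpret K: category K by fact
  interpret lax_monoidal_functor D TD C TC G \<mu> \<iota> by fact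
  interpret KC: category_pair K C ..
  interpret KD: category_pair K D ..
  interpret DK: monoidal_category "diagrams K D" "pointwise_monoidal K D TD"
    by (rule monoidal_category_pointwise[OF K.category_axioms D.monoidal_category_axioms])
  interpret CK: monoidal_category "diagrams K C" "pointwise_monoidal K C TC"
    by (rule monoidal_category_pointwise[OF K.category_axioms C.monoidal_category_axioms])
  interpret GK: cat_functor "diagrams K D" "diagrams K C" "postcomp K G"
    by (rule cat_functor_postcomp[OF K.category_axioms G.cat_functor_axioms])
  note G_Obj = postcomp_obj_Obj[OF K.category_axioms G.cat_functor_axioms]
  note C_tens = pointwise_tens_Obj[OF K.category_axioms C.monoidal_category_axioms]
  note D_tens = pointwise_tens_Obj[OF K.category_axioms D.monoidal_category_axioms]
  show ?thesis
  proof
    fix X Y assume XY: "X \<in> Obj (diagrams K D)" "Y \<in> Obj (diagrams K D)"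
    have "pointwise_lax K TC TD G \<mu> X Y \<in> hom (diagrams K C)
        (pointwise_tens K TC (postcomp_obj K G X) (postcomp_obj K G Y)) (postcomp_obj K G (pointwise_tens K TD X Y))"
      unfolding pointwise_lax_def
      by (rule mk_arrow_hom)
        (use XY K.category_axioms in \<open>auto intro!: G_Obj C_tens D_tens lax_hom lax_natural diagram_amap_hom
          simp: K.Dom_in K.Cod_in\<close>)
    then show "pointwise_lax K TC TD G \<mu> X Y \<in> hom (diagrams K C)
        (otens (pointwise_monoidal K C TC) (omap (postcomp K G) X) (omap (postcomp K G) Y))
        (omap (postcomp K G) (otens (pointwise_monoidal K D TD) X Y))"
      by simp
  next
    fix s X X' t Y Y' assume st: "s \<in> hom (diagrams K D) X X'" "t \<in> hom (diagrams K D) Y Y'"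
    then have "nsrc s = X" "ntgt s = X'" "nsrc t = Y" "ntgt t = Y'"
      by (auto simp: in_hom_diagrams_iff)
    then show "amap (postcomp K G) (atens (pointwise_monoidal K D TD) s t)
        \<cdot>\<^bsub>diagrams K C\<^esub> pointwise_lax K TC TD G \<mu> X Y
      = pointwise_lax K TC TD G \<mu> X' Y' \<cdot>\<^bsub>diagrams K C\<^esub>
        atens (pointwise_monoidal K C TC) (amap (postcomp K G) s) (amap (postcomp K G) t)"
      using lax_natural[OF st[THEN diagram_component]] by (auto intro!: mk_arrow_cong)
  next
    have "pointwise_lax_unit K C TC D TD G \<iota> \<in> hom (diagrams K C) (constant_diagram K C (munit TC))
        (postcomp_obj K G (constant_diagram K D (munit TD)))"
      unfolding pointwise_lax_unit_def
      using C.hom_Obj[OF lax_unit_hom] D.munit_in lax_unit_hom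
      by (intro mk_arrow_hom)
        (auto intro!: G_Obj constant_diagram_Obj K.category_axioms C.category_axioms D.category_axioms
          simp: G.amap_Ide hom_iff)
    then show "pointwise_lax_unit K C TC D TD G \<iota> \<in> hom (diagrams K C) (munit (pointwise_monoidal K C TC))
        (omap (postcomp K G) (munit (pointwise_monoidal K D TD)))"
      by simp
  qed (auto intro!: mk_arrow_cong simp: lax_assoc lax_left_unit lax_right_unit)
qed

section \<open>The comparison maps of the left adjoint\<close>

lemma oplax_tens_hom:
  assumes "adjunction C D F G \<eta> \<epsilon>" "lax_monoidal_functor D TD C TC G \<mu> \<iota>" "x \<in> Obj C" "y \<in> Obj C"
  shows "oplax_tens C TC D TD F \<eta> \<epsilon> \<mu> x y
    \<in> hom D (omap F (otens TC x y)) (otens TD (omap F x) (omap F y))"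
proof -
  interpret adjunction C D F G \<eta> \<epsilon> by fact
  interpret L: lax_monoidal_functor D TD C TC G \<mu> \<iota> by fact
  have "\<mu> (omap F x) (omap F y) \<cdot>\<^bsub>C\<^esub> atens TC (\<eta> x) (\<eta> y)
      \<in> hom C (otens TC x y) (omap G (otens TD (omap F x) (omap F y)))"
    using assms(3,4) by (intro F.C.Cmp_hom[OF L.C.atens_hom L.lax_hom] unit_hom F.omap_in)
  then show ?thesis
    unfolding oplax_tens_def flat_def[symmetric]
    using assms(3,4) by (intro flat_hom L.D.otens_in F.omap_in)
qed

lemma oplax_unit_hom:
  assumes "adjunction C D F G \<eta> \<epsilon>" "lax_monoidal_functor D TD C TC G \<mu> \<iota>"
  shows "oplax_unit D TD F \<epsilon> \<iota> \<in> hom D (omap F (munit TC)) (munit TD)"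
proof -
  interpret adjunction C D F G \<eta> \<epsilon> by fact
  interpret L: lax_monoidal_functor D TD C TC G \<mu> \<iota> by fact
  show ?thesis
    unfolding oplax_unit_def flat_def[symmetric]
    by (intro flat_hom L.D.munit_in L.lax_unit_hom)
qed

section \<open>Weak equivalences between cofibrant objects\<close>

context model_category
begin

text \<open>
  An identity is a retract of the acyclic fibration in any factorization of it.
\<close>

lemma weq_Ide:
  assumes a: "a \<in> Obj C"
  shows "Ide C a \<in> weq M"
proof -
  obtain c i p where i: "i \<in> hom C a c" and p: "p \<in> hom C c a" "p \<in> weq M" and pi: "Ide C a = p \<cdot> i"
    using factor_cof[OF Ide_hom[OF a]] by blast
  have "is_retract C (Ide C a) p"
    by (rule is_retractI[where i = i and r = p and j = "Ide C a" and s = "Ide C a"])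
      (use a i p pi[symmetric] in \<open>auto simp: hom_iff\<close>)
  then show ?thesis
    using p(2) by (rule weq_retract)
qed

lemma cof_Cmp:
  assumes i: "i \<in> cof M" and j: "j \<in> cof M" and ij: "i \<in> hom C a b" "j \<in> hom C b c"
  shows "j \<cdot> i \<in> cof M"
  unfolding cof_iff
proof (intro conjI ballI has_liftingI)
  show "j \<cdot> i \<in> Arr C" using ij by (simp add: hom_iff)
  fix p u v assume p: "p \<in> fib M \<inter> weq M" and u: "u \<in> hom C (Dom C (j \<cdot> i)) (Dom C p)"
    and v: "v \<in> hom C (Cod C (j \<cdot> i)) (Cod C p)" and eq: "p \<cdot> u = v \<cdot> (j \<cdot> i)"
  have pA: "p \<in> Arr C" using p fib_Arr by auto
  have uv: "u \<in> Arr C" "Dom C u = a" "Cod C u = Dom C p" "v \<in> Arr C" "Dom C v = c" "Cod C v = Cod C p"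
    using u v ij by (auto simp: hom_iff)
  have ijA: "i \<in> Arr C" "Dom C i = a" "Cod C i = b" "j \<in> Arr C" "Dom C j = b" "Cod C j = c"
    using ij by (auto simp: hom_iff)
  have "p \<cdot> u = (v \<cdot> j) \<cdot> i" using eq uv ijA by simp
  then obtain h where h: "h \<in> hom C (Cod C i) (Dom C p)" "h \<cdot> i = u" "p \<cdot> h = v \<cdot> j"
    by (rule has_liftingE[OF lift_cof[OF i p]]) (use uv ijA in \<open>auto simp: hom_iff\<close>)
  obtain g where g: "g \<in> hom C (Cod C j) (Dom C p)" "g \<cdot> j = h" "p \<cdot> g = v"
    by (rule has_liftingE[OF lift_cof[OF j p] h(3)]) (use uv ijA h in \<open>auto simp: hom_iff\<close>)
  have "g \<cdot> (j \<cdot> i) = u"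
    using g h(2) ijA Cmp_assoc_simp[of i j g] by (auto simp: hom_iff)
  then show "\<exists>h \<in> hom C (Cod C (j \<cdot> i)) (Dom C p). h \<cdot> (j \<cdot> i) = u \<and> p \<cdot> h = v"
    using g ijA by (intro bexI[of _ g]) (auto simp: hom_iff)
qed

end

lemma (in category) initial_arrow_unique:
  "is_initial C i \<Longrightarrow> f \<in> hom C i x \<Longrightarrow> g \<in> hom C i x \<Longrightarrow> f = g"
  using hom_Obj[of f i x] by (auto simp: is_initial_def)

text \<open>
  Any two distinct elements of the infinite type \<open>'s\<close> can serve as the index set.
\<close>

lemma has_binary_coproduct:
  fixes U :: "'s::infinite itself"
  assumes "model_category U C M" and ab: "a \<in> Obj C" "b \<in> Obj C"
  obtains s i j where "i \<in> hom C a s" "j \<in> hom C b s"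
    "\<And>d f g. \<lbrakk>f \<in> hom C a d; g \<in> hom C b d\<rbrakk> \<Longrightarrow> \<exists>!u. u \<in> hom C s d \<and> u \<cdot>\<^bsub>C\<^esub> i = f \<and> u \<cdot>\<^bsub>C\<^esub> j = g"
proof -
  interpret model_category U C M by fact
  obtain x y :: 's where xy: "x \<noteq> y"
    by (metis infinite_UNIV finite.emptyI finite_insert UNIV_eq_I insertCI)
  define c where "c z = (if z = x then a else b)" for z
  have c: "c z \<in> Obj (opposite C)" for z
    using ab by (simp add: c_def)
  obtain s \<kappa> where s: "is_product (opposite C) {x, y} c s \<kappa>"
    using small_complete_has_product[OF category_opposite[OF category_axioms] small_complete_opposite[OF cocomplete],
        of "{x, y}" c] c by blast
  show thesis
  proof (rule that[of "\<kappa> x" s "\<kappa> y"])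
    show "\<kappa> x \<in> hom C a s" "\<kappa> y \<in> hom C b s"
      using s xy by (auto simp: is_product_def c_def)
    fix d f g assume f: "f \<in> hom C a d" and g: "g \<in> hom C b d"
    then have d: "d \<in> Obj C" using hom_Obj by blast
    have "\<exists>!u. u \<in> hom (opposite C) d s \<and> (\<forall>z \<in> {x, y}. \<kappa> z \<cdot>\<^bsub>opposite C\<^esub> u = (if z = x then f else g))"
      using s d f g xy unfolding is_product_def
      by (elim conjE) (drule bspec[of _ _ d], simp, drule spec[of _ "\<lambda>z. if z = x then f else g"], simp add: c_def)
    then show "\<exists>!u. u \<in> hom C s d \<and> u \<cdot>\<^bsub>C\<^esub> \<kappa> x = f \<and> u \<cdot>\<^bsub>C\<^esub> \<kappa> y = g"
      using xy by simp
  qed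
qed


text \<open>
  The inclusion of \<open>x\<close> is the pushout of \<open>0 \<rightarrow> y\<close>. A diagonal is the copair of the upper side of the
  square with a lift on \<open>y\<close>, which exists because \<open>y\<close> is cofibrant.
\<close>

lemma (in model_category) coproduct_inclusion_cof:
  assumes k: "k \<in> hom C x s" and l: "l \<in> hom C y s" and y: "cofibrant C M y"
    and univ: "\<And>d f g. \<lbrakk>f \<in> hom C x d; g \<in> hom C y d\<rbrakk>
      \<Longrightarrow> \<exists>!u. u \<in> hom C s d \<and> u \<cdot> k = f \<and> u \<cdot> l = g"
  shows "k \<in> cof M"
proof -
  obtain i2 \<gamma> where init: "is_initial C i2" and \<gamma>: "\<gamma> \<in> hom C i2 y" "\<gamma> \<in> cof M"
    using y by (auto simp: cofibrant_def)
  show ?thesis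
    unfolding cof_iff
  proof (intro conjI ballI has_liftingI)
    show "k \<in> Arr C" using k by (simp add: hom_iff)
    fix p u v assume p: "p \<in> fib M \<inter> weq M" and u: "u \<in> hom C (Dom C k) (Dom C p)"
      and v: "v \<in> hom C (Cod C k) (Cod C p)" and eq: "p \<cdot> u = v \<cdot> k"
    have A: "p \<in> Arr C" "u \<in> Arr C" "Dom C u = x" "Cod C u = Dom C p" "v \<in> Arr C" "Dom C v = s" "Cod C v = Cod C p"
      "k \<in> Arr C" "Dom C k = x" "Cod C k = s" "l \<in> Arr C" "Dom C l = y" "Cod C l = s"
      "\<gamma> \<in> Arr C" "Dom C \<gamma> = i2" "Cod C \<gamma> = y"
      using p fib_Arr u v k l \<gamma> by (auto simp: hom_iff)
    have "Dom C p \<in> Obj C" using A by (simp add: Dom_in)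
    then obtain w where w: "w \<in> hom C i2 (Dom C p)"
      using init by (auto simp: is_initial_def)
    have "p \<cdot> w = (v \<cdot> l) \<cdot> \<gamma>"
      by (rule initial_arrow_unique[OF init, of _ "Cod C p"]) (use A w in \<open>auto simp: hom_iff\<close>)
    then obtain h where h: "h \<in> hom C (Cod C \<gamma>) (Dom C p)" "h \<cdot> \<gamma> = w" "p \<cdot> h = v \<cdot> l"
      by (rule has_liftingE[OF lift_cof[OF \<gamma>(2) p]]) (use A w in \<open>auto simp: hom_iff\<close>)
    obtain g where g: "g \<in> hom C s (Dom C p)" "g \<cdot> k = u" "g \<cdot> l = h"
      using univ[of u "Dom C p" h] A h by (auto simp: hom_iff)
    have "\<exists>!t. t \<in> hom C s (Cod C p) \<and> t \<cdot> k = p \<cdot> u \<and> t \<cdot> l = p \<cdot> h"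
      by (rule univ) (use A h in \<open>auto simp: hom_iff\<close>)
    moreover have "v \<in> hom C s (Cod C p) \<and> v \<cdot> k = p \<cdot> u \<and> v \<cdot> l = p \<cdot> h"
      using A eq h by (simp add: hom_iff)
    moreover have "p \<cdot> g \<in> hom C s (Cod C p) \<and> (p \<cdot> g) \<cdot> k = p \<cdot> u \<and> (p \<cdot> g) \<cdot> l = p \<cdot> h"
      using A g by (simp add: hom_iff)
    ultimately have "p \<cdot> g = v" by blast
    then show "\<exists>h \<in> hom C (Cod C k) (Dom C p). h \<cdot> k = u \<and> p \<cdot> h = v"
      using g A by (intro bexI[of _ g]) auto
  qed
qed

text \<open>
  Ken Brown's lemma. Factor \<open>(f, id) : a + b \<rightarrow> b\<close> as a cofibration \<open>q\<close> followed by an acyclic fibration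
  \<open>p\<close>. The inclusions of the summands are cofibrations because \<open>a\<close> and \<open>b\<close> are
  cofibrant, so the restrictions of \<open>q\<close> are acyclic cofibrations, hence preserved by \<open>F\<close>. Since \<open>p\<close>
  is a retraction of one of these restrictions, \<open>F p\<close> is a weak equivalence; \<open>f\<close> is the composite
  of \<open>p\<close> with the other one.
\<close>

lemma (in quillen_adjunction) F_weq_between_cofibrant:
  assumes f: "f \<in> hom C a b" "f \<in> weq MC" and a: "cofibrant C MC a" and b: "cofibrant C MC b"
  shows "amap F f \<in> weq MD"
proof -
  have ab: "a \<in> Obj C" "b \<in> Obj C" using F.C.hom_Obj[OF f(1)] by auto
  obtain s i j where i: "i \<in> hom C a s" and j: "j \<in> hom C b s"
    and coprod: "\<And>d f g. \<lbrakk>f \<in> hom C a d; g \<in> hom C b d\<rbrakk> \<Longrightarrow>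
      \<exists>!u. u \<in> hom C s d \<and> u \<cdot>\<^bsub>C\<^esub> i = f \<and> u \<cdot>\<^bsub>C\<^esub> j = g"
    by (rule has_binary_coproduct[OF CM.model_category_axioms ab]) blast
  have i_cof: "i \<in> cof MC" by (rule CM.coproduct_inclusion_cof[OF i j b coprod])
  have j_cof: "j \<in> cof MC"
  proof (rule CM.coproduct_inclusion_cof[OF j i a])
    fix d f g assume "f \<in> hom C b d" "g \<in> hom C a d"
    from coprod[OF this(2,1)] show "\<exists>!u. u \<in> hom C s d \<and> u \<cdot>\<^bsub>C\<^esub> j = f \<and> u \<cdot>\<^bsub>C\<^esub> i = g"
      by (simp add: conj_commute)
  qed
  obtain u where u: "u \<in> hom C s b" "u \<cdot>\<^bsub>C\<^esub> i = f" "u \<cdot>\<^bsub>C\<^esub> j = Ide C b"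
    using coprod[OF f(1) F.C.Ide_hom[OF ab(2)]] by blast
  obtain z q p where q: "q \<in> hom C s z" "q \<in> cof MC" and p: "p \<in> hom C z b" "p \<in> fib MC \<inter> weq MC"
    and upq: "u = p \<cdot>\<^bsub>C\<^esub> q"
    using CM.factor_cof[OF u(1)] by blast
  have qi: "q \<cdot>\<^bsub>C\<^esub> i \<in> hom C a z" "q \<cdot>\<^bsub>C\<^esub> i \<in> cof MC" and qj: "q \<cdot>\<^bsub>C\<^esub> j \<in> hom C b z" "q \<cdot>\<^bsub>C\<^esub> j \<in> cof MC"
    using F.C.Cmp_hom[OF i q(1)] F.C.Cmp_hom[OF j q(1)] CM.cof_Cmp[OF i_cof q(2) i q(1)]
      CM.cof_Cmp[OF j_cof q(2) j q(1)] by auto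
  have pqi: "p \<cdot>\<^bsub>C\<^esub> (q \<cdot>\<^bsub>C\<^esub> i) = f" and pqj: "p \<cdot>\<^bsub>C\<^esub> (q \<cdot>\<^bsub>C\<^esub> j) = Ide C b"
    using F.C.Cmp_assoc[OF i q(1) p(1)] F.C.Cmp_assoc[OF j q(1) p(1)] u upq by auto
  have "q \<cdot>\<^bsub>C\<^esub> i \<in> weq MC" "q \<cdot>\<^bsub>C\<^esub> j \<in> weq MC"
    using CM.weq_cancel_left[OF qi(1) p(1)] CM.weq_cancel_left[OF qj(1) p(1)] p(2) pqi pqj f(2)
      CM.weq_Ide[OF ab(2)] by auto
  then have F_weq: "amap F (q \<cdot>\<^bsub>C\<^esub> i) \<in> weq MD" "amap F (q \<cdot>\<^bsub>C\<^esub> j) \<in> weq MD"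
    using F_acof qi(2) qj(2) by auto
  have "amap F p \<cdot>\<^bsub>D\<^esub> amap F (q \<cdot>\<^bsub>C\<^esub> j) = Ide D (omap F b)"
    using F.amap_Cmp[OF qj(1) p(1)] pqj F.amap_Ide[OF ab(2)] by simp
  then have "amap F p \<in> weq MD"
    using DM.weq_cancel_right[OF F.amap_hom[OF qj(1)] F.amap_hom[OF p(1)] F_weq(2)]
      DM.weq_Ide[OF F.omap_in[OF ab(2)]] by simp
  then have "amap F p \<cdot>\<^bsub>D\<^esub> amap F (q \<cdot>\<^bsub>C\<^esub> i) \<in> weq MD"
    using DM.weq_comp[OF F.amap_hom[OF qi(1)] F.amap_hom[OF p(1)] F_weq(1)] by simp
  then show ?thesis
    using F.amap_Cmp[OF qi(1) p(1)] pqi by simp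
qed

lemma (in model_category) cofibrant_replacement_exists:
  assumes x: "x \<in> Obj C" and i: "is_initial C i"
  obtains Q q where "cofibrant_replacement C M x Q q" "q \<in> fib M"
proof -
  obtain f where "f \<in> hom C i x" using x i by (auto simp: is_initial_def)
  then obtain Q g q where "g \<in> hom C i Q" "q \<in> hom C Q x" "g \<in> cof M" "q \<in> fib M \<inter> weq M"
    using factor_cof by blast
  then show thesis
    using i by (intro that) (auto simp: cofibrant_replacement_def cofibrant_def)
qed

lemma (in model_category) cofibrant_replacement_compare:
  assumes Q: "cofibrant_replacement C M x Q q" and R: "cofibrant_replacement C M x R r" "r \<in> fib M"
  obtains h where "h \<in> hom C Q R" "h \<in> weq M" "r \<cdot> h = q"
proof -
  have q: "q \<in> hom C Q x" "q \<in> weq M" and r: "r \<in> hom C R x" "r \<in> weq M"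
    using Q R by (auto simp: cofibrant_replacement_def)
  obtain i f where i: "is_initial C i" and f: "f \<in> hom C i Q" "f \<in> cof M"
    using Q by (auto simp: cofibrant_replacement_def cofibrant_def)
  have "R \<in> Obj C" using hom_Obj[OF r(1)] by simp
  then obtain w where w: "w \<in> hom C i R" using i by (auto simp: is_initial_def)
  have r_afib: "r \<in> fib M \<inter> weq M" using r(2) R(2) by simp
  have "r \<cdot> w = q \<cdot> f"
    by (rule initial_arrow_unique[OF i Cmp_hom[OF w r(1)] Cmp_hom[OF f(1) q(1)]])
  then obtain h where h: "h \<in> hom C (Cod C f) (Dom C r)" "h \<cdot> f = w" "r \<cdot> h = q"
    by (rule has_liftingE[OF lift_cof[OF f(2) r_afib]]) (use r w q f in \<open>auto simp: hom_iff\<close>)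
  then have h': "h \<in> hom C Q R" using f r by (simp add: hom_iff)
  show thesis
    by (rule that[OF h' _ h(3)]) (use weq_cancel_left[OF h' r(1)] r(2) q(2) h(3) in simp)
qed

text \<open>
  Both replacements map by weak equivalences of cofibrant objects to a third one, \<open>r : R \<rightarrow> x\<close>, chosen
  to be a fibration; \<open>F\<close> preserves these weak equivalences.
\<close>

lemma (in quillen_adjunction) weq_on_cofibrant_replacements:
  assumes e: "e \<in> hom D (omap F x) y"
    and Q: "cofibrant_replacement C MC x Q q" "e \<cdot>\<^bsub>D\<^esub> amap F q \<in> weq MD"
    and Q': "cofibrant_replacement C MC x Q' q'"
  shows "e \<cdot>\<^bsub>D\<^esub> amap F q' \<in> weq MD"
proof -
  have q: "q \<in> hom C Q x" and q': "q' \<in> hom C Q' x"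
    using Q Q' by (auto simp: cofibrant_replacement_def)
  obtain i where i: "is_initial C i"
    using Q(1) by (auto simp: cofibrant_replacement_def cofibrant_def)
  have x: "x \<in> Obj C" using F.C.hom_Obj[OF q] by simp
  obtain R r where R: "cofibrant_replacement C MC x R r" "r \<in> fib MC"
    using CM.cofibrant_replacement_exists[OF x i] by blast
  have r: "r \<in> hom C R x" using R by (simp add: cofibrant_replacement_def)
  have er: "e \<cdot>\<^bsub>D\<^esub> amap F r \<in> hom D (omap F R) y"
    by (rule F.D.Cmp_hom[OF F.amap_hom[OF r] e])
  obtain h where h: "h \<in> hom C Q R" "h \<in> weq MC" "r \<cdot>\<^bsub>C\<^esub> h = q"
    by (rule CM.cofibrant_replacement_compare[OF Q(1) R])
  obtain h' where h': "h' \<in> hom C Q' R" "h' \<in> weq MC" "r \<cdot>\<^bsub>C\<^esub> h' = q'"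
    by (rule CM.cofibrant_replacement_compare[OF Q' R])
  have cof: "cofibrant C MC Q" "cofibrant C MC Q'" "cofibrant C MC R"
    using Q Q' R by (auto simp: cofibrant_replacement_def)
  have "(e \<cdot>\<^bsub>D\<^esub> amap F r) \<cdot>\<^bsub>D\<^esub> amap F h = e \<cdot>\<^bsub>D\<^esub> amap F q"
    using F.D.Cmp_assoc[OF F.amap_hom[OF h(1)] F.amap_hom[OF r] e] F.amap_Cmp[OF h(1) r] h(3) by simp
  then have "e \<cdot>\<^bsub>D\<^esub> amap F r \<in> weq MD"
    using DM.weq_cancel_right[OF F.amap_hom[OF h(1)] er F_weq_between_cofibrant[OF h(1,2) cof(1,3)]] Q(2) by simp
  then have "(e \<cdot>\<^bsub>D\<^esub> amap F r) \<cdot>\<^bsub>D\<^esub> amap F h' \<in> weq MD"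
    using DM.weq_comp[OF F.amap_hom[OF h'(1)] er F_weq_between_cofibrant[OF h'(1,2) cof(2,3)]] by simp
  moreover have "(e \<cdot>\<^bsub>D\<^esub> amap F r) \<cdot>\<^bsub>D\<^esub> amap F h' = e \<cdot>\<^bsub>D\<^esub> amap F q'"
    using F.D.Cmp_assoc[OF F.amap_hom[OF h'(1)] F.amap_hom[OF r] e] F.amap_Cmp[OF h'(1) r] h'(3) by simp
  ultimately show ?thesis by simp
qed

lemma (in model_category) initial_exists:
  obtains i where "is_initial C i"
proof -
  obtain i c \<kappa> where i: "is_product (opposite C) ({} :: 's set) c i \<kappa>"
    using small_complete_has_product[OF category_opposite[OF category_axioms] small_complete_opposite[OF cocomplete],
        of "{}" undefined] by auto
  have "is_initial C i"
    unfolding is_initial_def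
    using i by (auto simp: is_product_def)
  then show thesis by (rule that)
qed

section \<open>The induced weak monoidal Quillen adjunction\<close>

text \<open>
  The unit condition is checked at each \<open>k\<close> for the component of a replacement of
  the constant diagram, using that the choice of a replacement in \<open>C\<close> does not matter.
\<close>

lemma weak_monoidal_quillen_conditions_diagrams:
  fixes K :: "('s::infinite, 's) cat" and R :: "('s, 's, 'd::wellorder) reedy_str"
  assumes K: "category K"
    and W: "weak_monoidal_quillen_conditions TYPE('s) C MC TC D MD TD F G \<eta> \<epsilon> \<mu> \<iota>"
    and str: "same_type_structures K R C MC NC D MD ND"
  shows "weak_monoidal_quillen_conditions TYPE('s)
       (diagrams K C) NC (pointwise_monoidal K C TC) (diagrams K D) ND (pointwise_monoidal K D TD)
       (postcomp K F) (postcomp K G) (diagram_unit K F G \<eta>) (diagram_counit K F G \<epsilon>)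
       (pointwise_lax K TC TD G \<mu>) (pointwise_lax_unit K C TC D TD G \<iota>)"
proof -
  interpret W: weak_monoidal_quillen_conditions "TYPE('s)" C MC TC D MD TD F G \<eta> \<epsilon> \<mu> \<iota> by fact
  interpret K: category K by fact
  interpret Q: quillen_adjunction "TYPE('s)" "diagrams K C" NC "diagrams K D" ND "postcomp K F" "postcomp K G"
    "diagram_unit K F G \<eta>" "diagram_counit K F G \<epsilon>"
    by (rule quillen_adjunction_diagrams[OF K W.quillen_adjunction_axioms str])
  interpret L: lax_monoidal_functor "diagrams K D" "pointwise_monoidal K D TD" "diagrams K C"
    "pointwise_monoidal K C TC" "postcomp K G" "pointwise_lax K TC TD G \<mu>" "pointwise_lax_unit K C TC D TD G \<iota>"
    by (rule lax_monoidal_functor_pointwise[OF K W.lax_monoidal_functor_axioms])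
  note strC = same_type_structures_standard(1)[OF str] and strD = same_type_structures_standard(2)[OF str]
  interpret NC: diagram_model_structure "TYPE('s)" K C MC NC
    by (rule standard_structure_diagram_model[OF strC])
  interpret ND: diagram_model_structure "TYPE('s)" K D MD ND
    by (rule standard_structure_diagram_model[OF strD])
  note component = cofibrant_component[OF K W.CM.model_category_axioms strC]
  let ?\<delta> = "oplax_tens (diagrams K C) (pointwise_monoidal K C TC) (diagrams K D) (pointwise_monoidal K D TD)
    (postcomp K F) (diagram_unit K F G \<eta>) (diagram_counit K F G \<epsilon>) (pointwise_lax K TC TD G \<mu>)"
  have oplax: "ncmp (?\<delta> X Y) k = oplax_tens C TC D TD F \<eta> \<epsilon> \<mu> (omap X k) (omap Y k)" if "k \<in> Obj K" for X Y k
    using that by (simp add: oplax_tens_def)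
  let ?e = "oplax_unit (diagrams K D) (pointwise_monoidal K D TD) (postcomp K F)
    (diagram_counit K F G \<epsilon>) (pointwise_lax_unit K C TC D TD G \<iota>)"
  have unit: "ncmp ?e k = oplax_unit D TD F \<epsilon> \<iota>" if "k \<in> Obj K" for k
    using that by (simp add: oplax_unit_def)
  show ?thesis
  proof
    fix X Y assume X: "cofibrant (diagrams K C) NC X" and Y: "cofibrant (diagrams K C) NC Y"
    then have XY: "X \<in> Obj (diagrams K C)" "Y \<in> Obj (diagrams K C)"
      using Q.F.C.hom_Obj by (auto simp: cofibrant_def)
    show "?\<delta> X Y \<in> weq ND"
      unfolding ND.weq_pointwise
    proof (rule pointwise_classI)
      show "?\<delta> X Y \<in> Arr (diagrams K D)"
        using oplax_tens_hom[OF Q.adjunction_axioms L.lax_monoidal_functor_axioms XY] by (simp only: hom_iff)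
    qed (simp add: oplax W.oplax_tens_weq[OF component[OF X] component[OF Y]])
  next
    obtain I where I: "is_initial (diagrams K C) I"
      by (rule Q.CM.initial_exists)
    obtain Q q where Q: "cofibrant_replacement (diagrams K C) NC (munit (pointwise_monoidal K C TC)) Q q"
      using Q.CM.cofibrant_replacement_exists[OF L.C.munit_in I] by blast
    then have q: "q \<in> hom (diagrams K C) Q (munit (pointwise_monoidal K C TC))" "q \<in> weq NC"
      and Q_cof: "cofibrant (diagrams K C) NC Q"
      by (auto simp: cofibrant_replacement_def)
    obtain Q0 q0 where Q0: "cofibrant_replacement C MC (munit TC) Q0 q0"
      "oplax_unit D TD F \<epsilon> \<iota> \<cdot>\<^bsub>D\<^esub> amap F q0 \<in> weq MD"
      using W.oplax_unit_weq by blast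
    have "oplax_unit D TD F \<epsilon> \<iota> \<cdot>\<^bsub>D\<^esub> amap F (ncmp q k) \<in> weq MD" if k: "k \<in> Obj K" for k
    proof (rule W.weq_on_cofibrant_replacements[OF _ Q0])
      show "oplax_unit D TD F \<epsilon> \<iota> \<in> hom D (omap F (munit TC)) (munit TD)"
        by (rule oplax_unit_hom[OF W.adjunction_axioms W.lax_monoidal_functor_axioms])
      show "cofibrant_replacement C MC (munit TC) (omap Q k) (ncmp q k)"
        using component[OF Q_cof k] diagram_component[OF q(1) k] q(2) k
        unfolding cofibrant_replacement_def NC.weq_pointwise by (simp add: pointwise_class_def)
    qed
    moreover have "?e \<cdot>\<^bsub>diagrams K D\<^esub> amap (postcomp K F) q \<in> Arr (diagrams K D)"
      using Q.F.D.Cmp_hom[OF Q.F.amap_hom[OF q(1)]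
          oplax_unit_hom[OF Q.adjunction_axioms L.lax_monoidal_functor_axioms]] by (simp only: hom_iff)
    ultimately have "?e \<cdot>\<^bsub>diagrams K D\<^esub> amap (postcomp K F) q \<in> weq ND"
      unfolding ND.weq_pointwise by (intro pointwise_classI) (simp_all add: unit)
    then show "\<exists>Q q. cofibrant_replacement (diagrams K C) NC (munit (pointwise_monoidal K C TC)) Q q \<and>
        ?e \<cdot>\<^bsub>diagrams K D\<^esub> amap (postcomp K F) q \<in> weq ND"
      using Q by blast
  qed
qed

theorem proposition9p1:
  fixes K :: "('s::infinite, 's) cat"
    and C :: "('o, 'a) cat" and MC :: "'a model_str"
    and D :: "('p, 'b) cat" and MD :: "'b model_str"
    and F :: "('o, 'a, 'p, 'b) func" and G :: "('p, 'b, 'o, 'a) func"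
    and \<eta> :: "'o \<Rightarrow> 'a" and \<epsilon> :: "'p \<Rightarrow> 'b"
    and R :: "('s, 's, 'd::wellorder) reedy_str"
    and NC :: "('s, 's, 'o, 'a) ntrans model_str"
    and ND :: "('s, 's, 'p, 'b) ntrans model_str"
  assumes "category K"
    and "quillen_adjunction TYPE('s) C MC D MD F G \<eta> \<epsilon>"
    and "projective_structure TYPE('s) K C MC NC \<and> projective_structure TYPE('s) K D MD ND \<or>
         injective_structure TYPE('s) K C MC NC \<and> injective_structure TYPE('s) K D MD ND \<or>
         reedy_structure TYPE('s) K R C MC NC \<and> reedy_structure TYPE('s) K R D MD ND"
  shows
    "quillen_adjunction TYPE('s) (diagrams K C) NC (diagrams K D) ND (postcomp K F) (postcomp K G)
       (diagram_unit K F G \<eta>) (diagram_counit K F G \<epsilon>) \<and>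
     (quillen_equivalence TYPE('s) C MC D MD F G \<eta> \<epsilon> \<longrightarrow>
      quillen_equivalence TYPE('s) (diagrams K C) NC (diagrams K D) ND (postcomp K F) (postcomp K G)
       (diagram_unit K F G \<eta>) (diagram_counit K F G \<epsilon>)) \<and>
     (\<forall>TC TD \<mu> \<iota>.
      weak_monoidal_quillen_adjunction TYPE('s) C MC TC D MD TD F G \<eta> \<epsilon> \<mu> \<iota> \<longrightarrow>
      weak_monoidal_quillen_conditions TYPE('s)
       (diagrams K C) NC (pointwise_monoidal K C TC) (diagrams K D) ND (pointwise_monoidal K D TD)
       (postcomp K F) (postcomp K G) (diagram_unit K F G \<eta>) (diagram_counit K F G \<epsilon>)
       (pointwise_lax K TC TD G \<mu>) (pointwise_lax_unit K C TC D TD G \<iota>))"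
proof -
  have str: "same_type_structures K R C MC NC D MD ND"
    using assms(3) by (simp add: same_type_structures_def)
  show ?thesis
    using quillen_adjunction_diagrams[OF assms(1,2) str] quillen_equivalence_diagrams[OF assms(1) _ str]
      weak_monoidal_quillen_conditions_diagrams[OF assms(1) _ str]
    by (auto simp: weak_monoidal_quillen_adjunction_def)
qed

end
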